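(* Let $n,s,t,l$ be positive integers with $n\ge 10$, $s,t\ge 2$, $l\ge 1$ and $n\ge s+t+l$. Let $R(\rho_0,\rho_1,\rho_2)$ denote the set of relators $$\rho_0^2,\ \rho_1^2,\ \rho_2^2,\ (\rho_0\rho_1)^{2^s},\ (\rho_1\rho_2)^{2^t},\ (\rho_0\rho_2)^{2^l},\ [(\rho_0\rho_1)^4,\rho_2],\ [\rho_0,(\rho_1\rho_2)^4],\ [(\rho_0\rho_2)^2,\rho_1],$$ and define the finitely presented group $$G=\begin{cases}\langle \rho_0,\rho_1,\rho_2 \mid R(\rho_0,\rho_1,\rho_2),\ [(\rho_0\rho_1)^2,\rho_2]^{2^{(n-s-t-l)/2}}\rangle, & n-s-t-l \text{ even},\\[2pt] \langle \rho_0,\rho_1,\rho_2 \mid R(\rho_0,\rho_1,\rho_2),\ [(\rho_0\rho_1)^2,(\rho_1\rho_2)^2]^{2^{(n-s-t-l-1)/2}}\rangle, & n-s-t-l \text{ odd}.\end{cases}$$ Then $|G|=2^n$, and $G$ is the automorphism group of a regular hypertope of rank $3$ of type $(2^s,2^t,2^l)$ (with distinguished generators $\rho_0,\rho_1,\rho_2$). Moreover, $$G\cong\begin{cases}(C_{2^{s-2}}\times C_{2^{t-2}}\times C_{2^{l-1}}).\big((D_{2^{(n-s-t-l+4)/2}}\times D_{2^{(n-s-t-l+4)/2}})\rtimes C_2\big), & n-s-t-l\text{ even},\\[2pt] (C_{2^{s-2}}\times C_{2^{t-2}}\times C_{2^{l-1}}).\big((D_{2^{(n-s-t-l+3)/2}}\times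 D_{2^{(n-s-t-l+3)/2}})\rtimes (C_2\times C_2)\big), & n-s-t-l\text{ odd}.\end{cases}$$
   Context: Notation: $[x,y]=x^{-1}y^{-1}xy$; $C_m$ is the cyclic group of order $m$; $D_{2m}$ denotes the dihedral group of order $2m$; $N.Q$ denotes a group having a normal subgroup isomorphic to $N$ with quotient isomorphic to $Q$. An incidence geometry $\Gamma=(X,*,t,I)$ consists of a set $X$ of elements, a set $I$ of types, a type function $t:X\to I$, and a reflexive symmetric incidence relation $*$ such that incident elements of the same type are equal, and every flag (set of pairwise incident elements) is contained in a chamber (a flag containing one element of each type). The residue of a flag $F$ is the geometry of elements incident to all of $F$ and not in $F$, with types $I\setminus t(F)$. $\Gamma$ is thin if every residue of rank one has exactly two elements, residually connected if every residue of rank at least two has connected incidence graph; a hypertope is a thin residually connected incidence geometry. It is regular if its group of type-preserving automorphisms acts regularly on chambers. For a group $G$ generated by involutions $\rho_0,\rho_1,\rho_2$, with $G_i=\langle\rho_j: j\ne i\rangle$, the coset geometry $\Gamma(G;(G_0,G_1,G_2))$ has as elements of type $i$ the right cosets $G_ig$, two cosets being incident iff they intersect; $G$ acts on it by right multiplication. The pair $(G,\{\rho_0,\rho_1,\rho_2\})$ is a C-group if $\langle\rho_j:j\in J\rangle\cap\langle\rho_j:j\in K\rangle=\langle\rho_j:j\in J\cap K\rangle$ for all $J,K\subseteq\{0,1,2\}$. A regular rank-3 hypertope with automorphism group $G$ and distinguished generators $\rho_0,\rho_1,\rho_2$ (here: the coset geometry above) has type $(a,b,c)$ where $a,b,c$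 are the orders of $\rho_0\rho_1$, $\rho_1\rho_2$, $\rho_0\rho_2$ respectively. *)

theory Defs
  imports "HOL-Algebra.Algebra"
begin

section \<open>Group presentations\<close>

text \<open>
  A word over generators of type \<open>'a\<close> is a list of letters; \<open>(x, False)\<close> stands for the
  generator \<open>x\<close> and \<open>(x, True)\<close> for its formal inverse.
\<close>

type_synonym 'a word = "('a \<times> bool) list"

definition words :: "'a set \<Rightarrow> 'a word set"
  where "words S = lists (S \<times> UNIV)"

definition winv :: "'a word \<Rightarrow> 'a word"
  where "winv w = map (\<lambda>(x, b). (x, \<not> b)) (rev w)"

definition wpow :: "'a word \<Rightarrow> nat \<Rightarrow> 'a word"
  where "wpow w k = concat (replicate k w)"

definition wcomm :: "'a word \<Rightarrow> 'a word \<Rightarrow> 'a word"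
  where "wcomm u v = winv u @ winv v @ u @ v"

text \<open>The least congruence on words that cancels inverse letters and kills the relators.\<close>

inductive pres_eq :: "'a set \<Rightarrow> 'a word set \<Rightarrow> 'a word \<Rightarrow> 'a word \<Rightarrow> bool" for S R
  where
    cancel: "x \<in> S \<Longrightarrow> pres_eq S R [(x, b), (x, \<not> b)] []"
  | relator: "r \<in> R \<Longrightarrow> r \<in> words S \<Longrightarrow> pres_eq S R r []"
  | refl: "w \<in> words S \<Longrightarrow> pres_eq S R w w"
  | sym: "pres_eq S R u v \<Longrightarrow> pres_eq S R v u"
  | trans: "pres_eq S R u v \<Longrightarrow> pres_eq S R v w \<Longrightarrow> pres_eq S R u w"
  | append: "pres_eq S R u u' \<Longrightarrow> pres_eq S R v v' \<Longrightarrow> pres_eq S R (u @ v) (u' @ v')"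

definition pres_rel :: "'a set \<Rightarrow> 'a word set \<Rightarrow> ('a word \<times> 'a word) set"
  where "pres_rel S R = {(u, v). pres_eq S R u v}"

definition presented_group :: "'a set \<Rightarrow> 'a word set \<Rightarrow> 'a word set monoid"
  where "presented_group S R =
    \<lparr>carrier = words S // pres_rel S R,
     monoid.mult = (\<lambda>A B. \<Union>u\<in>A. \<Union>v\<in>B. pres_rel S R `` {u @ v}),
     one = pres_rel S R `` {[]}\<rparr>"

definition pres_gen :: "'a set \<Rightarrow> 'a word set \<Rightarrow> 'a \<Rightarrow> 'a word set"
  where "pres_gen S R x = pres_rel S R `` {[(x, False)]}"

lemma pres_eq_words: "pres_eq S R u v \<Longrightarrow> u \<in> words S \<and> v \<in> words S"
  by (induction rule: pres_eq.induct) (auto simp: words_def)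

lemma equiv_pres_rel: "equiv (words S) (pres_rel S R)"
proof (rule equivI)
  show "pres_rel S R \<subseteq> words S \<times> words S"
    using pres_eq_words by (fastforce simp: pres_rel_def)
  show "refl_on (words S) (pres_rel S R)"
    by (auto simp: refl_on_def pres_rel_def intro: pres_eq.refl)
  show "Relation.sym (pres_rel S R)"
    by (auto simp: Relation.sym_def pres_rel_def intro: pres_eq.sym)
  show "Relation.trans (pres_rel S R)"
    by (auto simp: Relation.trans_def pres_rel_def intro: pres_eq.trans)
qed

lemma pres_mult:
  assumes "u \<in> words S" "v \<in> words S"
  shows "(\<Union>a\<in>pres_rel S R `` {u}. \<Union>b\<in>pres_rel S R `` {v}. pres_rel S R `` {a @ b}) =
    pres_rel S R `` {u @ v}"
proof (rule UN_equiv_class2[OF equiv_pres_rel equiv_pres_rel _ assms])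
  show "congruent2 (pres_rel S R) (pres_rel S R) (\<lambda>a b. pres_rel S R `` {a @ b})"
    unfolding congruent2_def
    by (auto simp: pres_rel_def intro: pres_eq.append pres_eq.trans pres_eq.sym)
qed

lemma winv_words: "w \<in> words S \<Longrightarrow> winv w \<in> words S"
  by (auto simp: words_def winv_def in_lists_conv_set)

lemma winv_left: "w \<in> words S \<Longrightarrow> pres_eq S R (winv w @ w) []"
proof (induction w)
  case Nil
  then show ?case by (simp add: winv_def pres_eq.refl)
next
  case (Cons a w)
  obtain x b where a: "a = (x, b)" by force
  have x: "x \<in> S" and w: "w \<in> words S" using Cons.prems a by (auto simp: words_def)
  have "pres_eq S R ([(x, \<not> b), (x, b)] @ w) ([] @ w)"
    using pres_eq.cancel[OF x, of R "\<not> b"] pres_eq.refl[OF w] pres_eq.append by fastforce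
  then have "pres_eq S R (winv w @ ([(x, \<not> b), (x, b)] @ w)) (winv w @ w)"
    using pres_eq.append[OF pres_eq.refl[OF winv_words[OF w]]] by fastforce
  then show ?case
    using Cons.IH[OF w] by (auto simp: a winv_def intro: pres_eq.trans)
qed

lemma presented_group_is_group: "group (presented_group S R)"
proof (rule groupI)
  fix A assume "A \<in> carrier (presented_group S R)"
  then obtain u where u: "u \<in> words S" "A = pres_rel S R `` {u}"
    by (auto simp: presented_group_def quotient_def)
  have nil: "[] \<in> words S" by (simp add: words_def)
  show "\<one>\<^bsub>presented_group S R\<^esub> \<otimes>\<^bsub>presented_group S R\<^esub> A = A"
    using pres_mult[OF nil u(1)] by (simp add: presented_group_def u(2))
  have "pres_rel S R `` {winv u @ u} = pres_rel S R `` {[]}"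
    by (rule equiv_class_eq[OF equiv_pres_rel]) (simp add: pres_rel_def winv_left u)
  then show "\<exists>B\<in>carrier (presented_group S R).
      B \<otimes>\<^bsub>presented_group S R\<^esub> A = \<one>\<^bsub>presented_group S R\<^esub>"
    using pres_mult[OF winv_words[OF u(1)] u(1), of R] winv_words[OF u(1)]
    by (intro bexI[of _ "pres_rel S R `` {winv u}"])
      (simp_all add: presented_group_def u(2) quotientI)
  fix B assume "B \<in> carrier (presented_group S R)"
  then obtain v where v: "v \<in> words S" "B = pres_rel S R `` {v}"
    by (auto simp: presented_group_def quotient_def)
  have uv: "u @ v \<in> words S" using u v by (auto simp: words_def)
  show "A \<otimes>\<^bsub>presented_group S R\<^esub> B \<in> carrier (presented_group S R)"
    using pres_mult[OF u(1) v(1)] uv by (simp add: presented_group_def u(2) v(2) quotientI)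
  fix C assume "C \<in> carrier (presented_group S R)"
  then obtain w where w: "w \<in> words S" "C = pres_rel S R `` {w}"
    by (auto simp: presented_group_def quotient_def)
  have vw: "v @ w \<in> words S" using v w by (auto simp: words_def)
  show "A \<otimes>\<^bsub>presented_group S R\<^esub> B \<otimes>\<^bsub>presented_group S R\<^esub> C =
      A \<otimes>\<^bsub>presented_group S R\<^esub> (B \<otimes>\<^bsub>presented_group S R\<^esub> C)"
    by (simp add: presented_group_def u(2) v(2) w(2) pres_mult u(1) v(1) w(1) uv vw)
next
  show "\<one>\<^bsub>presented_group S R\<^esub> \<in> carrier (presented_group S R)"
    by (simp add: presented_group_def quotientI words_def)
qed


section \<open>Semidirect products, dihedral groups, extensions\<close>

definition semidirect ::
    "('a, 'c) monoid_scheme \<Rightarrow> ('b, 'd) monoid_scheme \<Rightarrow> ('b \<Rightarrow> 'a \<Rightarrow> 'a) \<Rightarrow> ('a \<times> 'b) monoid"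
  where "semidirect N K \<phi> =
    \<lparr>carrier = carrier N \<times> carrier K,
     monoid.mult = (\<lambda>(a, x) (b, y). (a \<otimes>\<^bsub>N\<^esub> \<phi> x b, x \<otimes>\<^bsub>K\<^esub> y)),
     one = (\<one>\<^bsub>N\<^esub>, \<one>\<^bsub>K\<^esub>)\<rparr>"

text \<open>
  The dihedral group, indexed by its \<^emph>\<open>order\<close> \<open>k\<close> (even and at least \<open>2\<close>): rotations
  \<open>C\<^bsub>k/2\<^esub>\<close> extended by an involution that inverts them. In particular \<open>k = 4\<close> gives the Klein
  four-group.
\<close>

definition dihedral_group :: "nat \<Rightarrow> (int \<times> int) monoid"
  where "dihedral_group k =
    (let C = integer_mod_group (k div 2)
     in semidirect C (integer_mod_group 2)
          (\<lambda>e. \<lambda>a\<in>carrier C. if e = 0 then a else inv\<^bsub>C\<^esub> a))"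

text \<open>\<open>G\<close> is of the form \<open>N.Q\<close>.\<close>

definition is_extension ::
    "('g, 'c) monoid_scheme \<Rightarrow> ('a, 'd) monoid_scheme \<Rightarrow> ('b, 'e) monoid_scheme \<Rightarrow> bool"
  where "is_extension G N Q \<longleftrightarrow>
    (\<exists>M. M \<lhd> G \<and> G\<lparr>carrier := M\<rparr> \<cong> N \<and> G Mod M \<cong> Q)"

lemma semidirect_is_group:
  assumes "group N" "group K" "\<phi> \<in> hom K (AutoGroup N)"
  shows "group (semidirect N K \<phi>)"
proof -
  interpret N: group N by fact
  interpret K: group K by fact
  have aut: "\<phi> x \<in> hom N N" "\<phi> x \<in> Bij (carrier N)" if "x \<in> carrier K" for x
    using assms(3) that by (auto simp: hom_def AutoGroup_def auto_def)
  have cl: "\<phi> x a \<in> carrier N" if "x \<in> carrier K" "a \<in> carrier N" for x a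
    using aut(1)[OF that(1)] that by (auto simp: hom_def)
  have add: "\<phi> x (a \<otimes>\<^bsub>N\<^esub> b) = \<phi> x a \<otimes>\<^bsub>N\<^esub> \<phi> x b"
    if "x \<in> carrier K" "a \<in> carrier N" "b \<in> carrier N" for x a b
    using aut(1)[OF that(1)] that by (auto simp: hom_def)
  have comp: "\<phi> (x \<otimes>\<^bsub>K\<^esub> y) a = \<phi> x (\<phi> y a)"
    if "x \<in> carrier K" "y \<in> carrier K" "a \<in> carrier N" for x y a
    using assms(3) that aut(2) by (auto simp: hom_def AutoGroup_def BijGroup_def compose_def)
  interpret A: group "AutoGroup N" by (rule N.AutoGroup)
  have one: "\<phi> \<one>\<^bsub>K\<^esub> a = a" if "a \<in> carrier N" for a
  proof -
    have "\<phi> \<one>\<^bsub>K\<^esub> = \<one>\<^bsub>AutoGroup N\<^esub>"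
      using hom_one[OF assms(3) K.group_axioms A.group_axioms] .
    then show ?thesis using that by (simp add: AutoGroup_def BijGroup_def)
  qed
  show ?thesis
  proof (rule groupI)
    fix p assume "p \<in> carrier (semidirect N K \<phi>)"
    then obtain a x where p: "p = (a, x)" "a \<in> carrier N" "x \<in> carrier K"
      by (auto simp: semidirect_def)
    have "\<phi> (inv\<^bsub>K\<^esub> x) (inv\<^bsub>N\<^esub> a) \<otimes>\<^bsub>N\<^esub> \<phi> (inv\<^bsub>K\<^esub> x) a = \<phi> (inv\<^bsub>K\<^esub> x) \<one>\<^bsub>N\<^esub>"
      using p by (simp flip: add)
    also have "\<dots> = \<one>\<^bsub>N\<^esub>"
      using hom_one[OF aut(1)[of "inv\<^bsub>K\<^esub> x"] N.group_axioms N.group_axioms] p by simp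
    finally show "\<exists>q\<in>carrier (semidirect N K \<phi>).
        q \<otimes>\<^bsub>semidirect N K \<phi>\<^esub> p = \<one>\<^bsub>semidirect N K \<phi>\<^esub>"
      using p by (intro bexI[of _ "(\<phi> (inv\<^bsub>K\<^esub> x) (inv\<^bsub>N\<^esub> a), inv\<^bsub>K\<^esub> x)"])
        (auto simp: semidirect_def cl)
  qed (auto simp: semidirect_def cl add comp one N.m_assoc K.m_assoc)
qed


section \<open>Incidence geometries and hypertopes\<close>

record ('x, 'i) geometry =
  elements :: "'x set"
  type_set :: "'i set"
  type_of :: "'x \<Rightarrow> 'i"
  incident :: "'x \<Rightarrow> 'x \<Rightarrow> bool"

definition flag :: "('x, 'i) geometry \<Rightarrow> 'x set \<Rightarrow> bool"
  where "flag \<Gamma> F \<longleftrightarrow> F \<subseteq> elements \<Gamma> \<and> (\<forall>x\<in>F. \<forall>y\<in>F. incident \<Gamma> x y)"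

definition chamber :: "('x, 'i) geometry \<Rightarrow> 'x set \<Rightarrow> bool"
  where "chamber \<Gamma> C \<longleftrightarrow> flag \<Gamma> C \<and> bij_betw (type_of \<Gamma>) C (type_set \<Gamma>)"

definition geom_rank :: "('x, 'i) geometry \<Rightarrow> nat"
  where "geom_rank \<Gamma> = card (type_set \<Gamma>)"

text \<open>Finiteness of the type set is required so that \<open>geom_rank\<close> is meaningful.\<close>

definition incidence_geometry :: "('x, 'i) geometry \<Rightarrow> bool"
  where "incidence_geometry \<Gamma> \<longleftrightarrow>
    finite (type_set \<Gamma>) \<and>
    type_of \<Gamma> ` elements \<Gamma> \<subseteq> type_set \<Gamma> \<and>
    (\<forall>x\<in>elements \<Gamma>. incident \<Gamma> x x) \<and>
    (\<forall>x\<in>elements \<Gamma>. \<forall>y\<in>elements \<Gamma>. incident \<Gamma> x y \<longrightarrow> incident \<Gamma> y x) \<and>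
    (\<forall>x\<in>elements \<Gamma>. \<forall>y\<in>elements \<Gamma>. incident \<Gamma> x y \<and> type_of \<Gamma> x = type_of \<Gamma> y \<longrightarrow> x = y) \<and>
    (\<forall>F. flag \<Gamma> F \<longrightarrow> (\<exists>C. chamber \<Gamma> C \<and> F \<subseteq> C))"

definition residue :: "('x, 'i) geometry \<Rightarrow> 'x set \<Rightarrow> ('x, 'i) geometry"
  where "residue \<Gamma> F = \<Gamma>
    \<lparr>elements := {x \<in> elements \<Gamma>. x \<notin> F \<and> (\<forall>y\<in>F. incident \<Gamma> x y)},
     type_set := type_set \<Gamma> - type_of \<Gamma> ` F\<rparr>"

definition incidence_connected :: "('x, 'i) geometry \<Rightarrow> bool"
  where "incidence_connected \<Gamma> \<longleftrightarrow>
    (\<forall>x\<in>elements \<Gamma>. \<forall>y\<in>elements \<Gamma>.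
       (\<lambda>u v. u \<in> elements \<Gamma> \<and> v \<in> elements \<Gamma> \<and> incident \<Gamma> u v)\<^sup>*\<^sup>* x y)"

definition thin :: "('x, 'i) geometry \<Rightarrow> bool"
  where "thin \<Gamma> \<longleftrightarrow>
    (\<forall>F. flag \<Gamma> F \<and> geom_rank (residue \<Gamma> F) = 1 \<longrightarrow> card (elements (residue \<Gamma> F)) = 2)"

definition residually_connected :: "('x, 'i) geometry \<Rightarrow> bool"
  where "residually_connected \<Gamma> \<longleftrightarrow>
    (\<forall>F. flag \<Gamma> F \<and> geom_rank (residue \<Gamma> F) \<ge> 2 \<longrightarrow> incidence_connected (residue \<Gamma> F))"

definition hypertope :: "('x, 'i) geometry \<Rightarrow> bool"
  where "hypertope \<Gamma> \<longleftrightarrow> incidence_geometry \<Gamma> \<and> thin \<Gamma> \<and> residually_connected \<Gamma>"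

definition type_auts :: "('x, 'i) geometry \<Rightarrow> ('x \<Rightarrow> 'x) set"
  where "type_auts \<Gamma> = {f \<in> Bij (elements \<Gamma>).
    (\<forall>x\<in>elements \<Gamma>. type_of \<Gamma> (f x) = type_of \<Gamma> x) \<and>
    (\<forall>x\<in>elements \<Gamma>. \<forall>y\<in>elements \<Gamma>. incident \<Gamma> (f x) (f y) \<longleftrightarrow> incident \<Gamma> x y)}"

definition type_aut_group :: "('x, 'i) geometry \<Rightarrow> ('x \<Rightarrow> 'x) monoid"
  where "type_aut_group \<Gamma> = BijGroup (elements \<Gamma>)\<lparr>carrier := type_auts \<Gamma>\<rparr>"

definition regular_hypertope :: "('x, 'i) geometry \<Rightarrow> bool"
  where "regular_hypertope \<Gamma> \<longleftrightarrow> hypertope \<Gamma> \<and>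
    (\<forall>C D. chamber \<Gamma> C \<and> chamber \<Gamma> D \<longrightarrow> (\<exists>!f. f \<in> type_auts \<Gamma> \<and> f ` C = D))"


section \<open>Coset geometries\<close>

text \<open>
  An element of type \<open>i\<close> is a coset tagged with \<open>i\<close>, so that elements of different types are
  distinct even when the cosets coincide as sets.
\<close>

definition coset_geometry ::
    "('g, 'c) monoid_scheme \<Rightarrow> 'i set \<Rightarrow> ('i \<Rightarrow> 'g set) \<Rightarrow> ('i \<times> 'g set, 'i) geometry"
  where "coset_geometry G I H =
    \<lparr>elements = (SIGMA i:I. rcosets\<^bsub>G\<^esub> (H i)),
     type_set = I,
     type_of = fst,
     incident = (\<lambda>x y. snd x \<inter> snd y \<noteq> {})\<rparr>"

text \<open>The coset geometry \<open>\<Gamma>(G; (G\<^sub>i)\<^sub>i)\<close> with \<open>G\<^sub>i\<close> generated by the \<open>\<rho>\<^sub>j\<close>, \<open>j \<noteq> i\<close>.\<close>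

definition gens_geometry ::
    "('g, 'c) monoid_scheme \<Rightarrow> 'i set \<Rightarrow> ('i \<Rightarrow> 'g) \<Rightarrow> ('i \<times> 'g set, 'i) geometry"
  where "gens_geometry G I \<rho> = coset_geometry G I (\<lambda>i. generate G (\<rho> ` (I - {i})))"

text \<open>
  Automorphisms are functions written on the left, so the right multiplication action is turned
  into a left action by letting \<open>g\<close> multiply by its inverse. Since the generators below
  are involutions, \<open>\<rho>\<^sub>i\<close> itself acts as right multiplication by \<open>\<rho>\<^sub>i\<close>.
\<close>

definition coset_action ::
    "('g, 'c) monoid_scheme \<Rightarrow> ('i \<times> 'g set, 'i) geometry \<Rightarrow> 'g \<Rightarrow> 'i \<times> 'g set \<Rightarrow> 'i \<times> 'g set"
  where "coset_action G \<Gamma> g = (\<lambda>(i, A)\<in>elements \<Gamma>. (i, A #>\<^bsub>G\<^esub> inv\<^bsub>G\<^esub> g))"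

text \<open>
  \<open>G\<close> is the automorphism group of the regular hypertope \<open>gens_geometry G I \<rho>\<close>, with
  distinguished generators \<open>\<rho>\<^sub>i\<close>: right multiplication identifies \<open>G\<close> with the group of
  \<^emph>\<open>all\<close> type-preserving automorphisms, and \<open>\<rho>\<^sub>i\<close> fixes all elements of the base chamber
  \<open>{(j, G\<^sub>j) | j \<in> I}\<close> except the one of type \<open>i\<close>.
\<close>

definition aut_group_of_regular_hypertope ::
    "('g, 'c) monoid_scheme \<Rightarrow> 'i set \<Rightarrow> ('i \<Rightarrow> 'g) \<Rightarrow> bool"
  where "aut_group_of_regular_hypertope G I \<rho> \<longleftrightarrow>
    group G \<and>
    (\<forall>i\<in>I. \<rho> i \<in> carrier G \<and> group.ord G (\<rho> i) = 2) \<and>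
    generate G (\<rho> ` I) = carrier G \<and>
    regular_hypertope (gens_geometry G I \<rho>) \<and>
    coset_action G (gens_geometry G I \<rho>) \<in> iso G (type_aut_group (gens_geometry G I \<rho>))"


section \<open>The presentations\<close>

abbreviation r0 :: "nat word" where "r0 \<equiv> [(0, False)]"
abbreviation r1 :: "nat word" where "r1 \<equiv> [(1, False)]"
abbreviation r2 :: "nat word" where "r2 \<equiv> [(2, False)]"

definition base_relators :: "nat \<Rightarrow> nat \<Rightarrow> nat \<Rightarrow> nat word set"
  where "base_relators s t l =
    {wpow r0 2, wpow r1 2, wpow r2 2,
     wpow (r0 @ r1) (2 ^ s), wpow (r1 @ r2) (2 ^ t), wpow (r0 @ r2) (2 ^ l),
     wcomm (wpow (r0 @ r1) 4) r2,
     wcomm r0 (wpow (r1 @ r2) 4),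
     wcomm (wpow (r0 @ r2) 2) r1}"

definition hyp_relators :: "nat \<Rightarrow> nat \<Rightarrow> nat \<Rightarrow> nat \<Rightarrow> nat word set"
  where "hyp_relators n s t l = base_relators s t l \<union>
    (if even (n - s - t - l)
     then {wpow (wcomm (wpow (r0 @ r1) 2) r2) (2 ^ ((n - s - t - l) div 2))}
     else {wpow (wcomm (wpow (r0 @ r1) 2) (wpow (r1 @ r2) 2)) (2 ^ ((n - s - t - l - 1) div 2))})"

definition hyp_group :: "nat \<Rightarrow> nat \<Rightarrow> nat \<Rightarrow> nat \<Rightarrow> nat word set monoid"
  where "hyp_group n s t l = presented_group {0, 1, 2} (hyp_relators n s t l)"

definition hyp_gen :: "nat \<Rightarrow> nat \<Rightarrow> nat \<Rightarrow> nat \<Rightarrow> nat \<Rightarrow> nat word set"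
  where "hyp_gen n s t l = pres_gen {0, 1, 2} (hyp_relators n s t l)"

end

theory Submission
  imports Defs
begin

text \<open>
  Write \<open>a, b, c\<close> for the generators. Killing one of them maps \<open>G\<close> onto a dihedral group, and this
  map is injective on the subgroup generated by the other two. So \<open>ab\<close>, \<open>bc\<close>, \<open>ac\<close> have the
  prescribed orders, and the intersection property and flag-transitivity of the coset geometry
  follow by projecting along these maps.

  The elements \<open>(ab)\<^sup>4\<close>, \<open>(bc)\<^sup>4\<close>, \<open>(ac)\<^sup>2\<close> are fixed or inverted by each generator, hence commute
  with each other and generate a normal subgroup \<open>N\<close>; the three dihedral quotients show that it is
  the direct product of cyclic groups of the maximal possible orders. The quotient \<open>G / N\<close> is the
  group of a toroidal map of type \<open>{4,4}\<close>. Its reflections in the sides of the squares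
  (even case) or in their diagonals (odd case) generate a product of two dihedral groups, one for
  each direction, and the remaining generators swap the two directions. The presentation gives a
  homomorphism from \<open>G\<close> onto the resulting semidirect product; since conversely the semidirect
  product maps to \<open>G / N\<close> compatibly with the generators, its kernel is \<open>N\<close>.
\<close>

section \<open>Evaluation of words and the universal property of a presentation\<close>

text \<open>A presentation yields homomorphisms out of \<open>G\<close>, which only bound
  \<open>G\<close> from below. Upper bounds come from elsewhere: for \<open>N\<close> from the
  exponents of its commuting generators, for \<open>G / N\<close> from the fact that dihedral
  groups, direct products and semidirect products can be mapped out of by lifting generators, so the
  concrete model also maps onto \<open>G / N\<close>.

  The last relator costs nothing in the dihedral quotients, because killing any generator makes one
  argument of its commutator trivial. In \<open>G / N\<close> the same commutator is the square of a
  product of two parallel mirrors. With exponent \<open>k\<close>, that product has order dividing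
  \<open>2 * k\<close>, which explains the dihedral factors of order \<open>4 * k\<close>. Writing
  \<open>m = n - s - t - l\<close>, we have \<open>k^2 = 2^m\<close> in the even case and
  \<open>k^2 = 2^(m-1)\<close> in the odd case; the model has \<open>2^(m+5)\<close> elements either
  way and \<open>N\<close> has \<open>2^(s+t+l-5)\<close>.

  For flag-transitivity the obstacle is a triangle of pairwise meeting cosets. It needs the
  factorisation of every element of \<open>G_1\<close> lying in \<open>G_0 G_2\<close> into factors
  from \<open>G_0\<close> and \<open>G_2\<close> that also lie in \<open>G_1\<close>; the map
  killing \<open>\<rho> 1\<close> provides it.\<close>

definition weval :: "('g, 'c) monoid_scheme \<Rightarrow> ('a \<Rightarrow> 'g) \<Rightarrow> 'a word \<Rightarrow> 'g"
  where "weval H f w =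
    foldr (\<lambda>(x, b) h. (if b then inv\<^bsub>H\<^esub> (f x) else f x) \<otimes>\<^bsub>H\<^esub> h) w \<one>\<^bsub>H\<^esub>"

lemma words_simps [simp]:
  "[] \<in> words S" "(x, b) # w \<in> words S \<longleftrightarrow> x \<in> S \<and> w \<in> words S"
  "u @ v \<in> words S \<longleftrightarrow> u \<in> words S \<and> v \<in> words S"
  by (auto simp: words_def)

lemma wpow_words [simp]: "w \<in> words S \<Longrightarrow> wpow w k \<in> words S"
  by (induction k) (auto simp: wpow_def)

lemma wcomm_words [simp]: "u \<in> words S \<Longrightarrow> v \<in> words S \<Longrightarrow> wcomm u v \<in> words S"
  by (auto simp: wcomm_def winv_words)

lemma weval_simps [simp]:
  "weval H f [] = \<one>\<^bsub>H\<^esub>"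
  "weval H f ((x, False) # w) = f x \<otimes>\<^bsub>H\<^esub> weval H f w"
  "weval H f ((x, True) # w) = inv\<^bsub>H\<^esub> (f x) \<otimes>\<^bsub>H\<^esub> weval H f w"
  by (auto simp: weval_def)

context group
begin

lemma weval_closed [simp]:
  assumes "f \<in> S \<rightarrow> carrier G" "w \<in> words S"
  shows "weval G f w \<in> carrier G"
  using assms(2)
proof (induction w)
  case (Cons p w)
  obtain x b where "p = (x, b)" by force
  then show ?case using Cons assms(1) by (cases b) auto
qed simp

lemma weval_append [simp]:
  assumes f: "f \<in> S \<rightarrow> carrier G" and "u \<in> words S" "v \<in> words S"
  shows "weval G f (u @ v) = weval G f u \<otimes> weval G f v"
  using assms(2)
proof (induction u)
  case Nil
  then show ?case using assms by simp
next
  case (Cons p u)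
  obtain x b where p: "p = (x, b)" by force
  then have "f x \<in> carrier G" "u \<in> words S" using Cons.prems f by auto
  then show ?case
    using p Cons weval_closed[OF f] assms(3) by (cases b) (auto simp: m_assoc)
qed

lemma weval_winv:
  assumes f: "f \<in> S \<rightarrow> carrier G" and "w \<in> words S"
  shows "weval G f (winv w) = inv (weval G f w)"
  using assms(2)
proof (induction w)
  case (Cons p w)
  obtain x b where p: "p = (x, b)" by force
  then have x: "x \<in> S" "f x \<in> carrier G" and w: "w \<in> words S" using Cons.prems f by auto
  have "winv (p # w) = winv w @ [(x, \<not> b)]" by (simp add: winv_def p)
  then show ?case
    using p x w Cons.IH[OF w] weval_append[OF f winv_words[OF w], of "[(x, \<not> b)]"]
      weval_closed[OF f w]
    by (cases b) (auto simp: inv_mult_group)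
qed (simp add: winv_def)

lemma weval_wpow:
  assumes f: "f \<in> S \<rightarrow> carrier G" and "w \<in> words S"
  shows "weval G f (wpow w k) = weval G f w [^] k"
proof (induction k)
  case (Suc k)
  have "weval G f (wpow w (Suc k)) = weval G f w \<otimes> weval G f w [^] k"
    using Suc weval_append[OF f assms(2) wpow_words[OF assms(2), of k]]
    by (simp add: wpow_def)
  then show ?case using weval_closed[OF assms] by (metis nat_pow_Suc2)
qed (simp add: wpow_def)

lemma weval_wcomm:
  assumes f: "f \<in> S \<rightarrow> carrier G" and "u \<in> words S" "v \<in> words S"
  shows "weval G f (wcomm u v) =
    inv (weval G f u) \<otimes> (inv (weval G f v) \<otimes> (weval G f u \<otimes> weval G f v))"
  using assms
  by (simp add: wcomm_def weval_append[OF f] winv_words weval_winv[OF f])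

text \<open>Having equal values is a congruence that contains the cancellations and the relators,
  and \<open>pres_eq\<close> is the least such congruence.\<close>

lemma weval_pres_eq:
  assumes f: "f \<in> S \<rightarrow> carrier G"
    and R: "\<And>r. r \<in> R \<Longrightarrow> r \<in> words S \<Longrightarrow> weval G f r = \<one>"
    and uv: "pres_eq S R u v"
  shows "weval G f u = weval G f v"
  using uv
proof induction
  case (cancel x b)
  then have "f x \<in> carrier G" using f by auto
  then show ?case by (cases b) auto
next
  case (append u u' v v')
  then show ?case using pres_eq_words by (metis weval_append[OF f])
qed (auto simp: R)

end

abbreviation pres_class :: "'a set \<Rightarrow> 'a word set \<Rightarrow> 'a word \<Rightarrow> 'a word set"
  where "pres_class S R w \<equiv> pres_rel S R `` {w}"

lemma carrier_presented_group: "carrier (presented_group S R) = pres_class S R ` words S"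
  by (auto simp: presented_group_def quotient_def)

lemma pres_class_mult:
  "u \<in> words S \<Longrightarrow> v \<in> words S \<Longrightarrow>
    pres_class S R u \<otimes>\<^bsub>presented_group S R\<^esub> pres_class S R v = pres_class S R (u @ v)"
  using pres_mult[of u S v R] by (simp add: presented_group_def)

lemma pres_class_eq_iff:
  "u \<in> words S \<Longrightarrow> v \<in> words S \<Longrightarrow> pres_class S R u = pres_class S R v \<longleftrightarrow> pres_eq S R u v"
  using eq_equiv_class_iff[OF equiv_pres_rel] by (fastforce simp: pres_rel_def)

lemma one_presented_group: "\<one>\<^bsub>presented_group S R\<^esub> = pres_class S R []"
  by (simp add: presented_group_def)

lemma pres_gen_closed: "pres_gen S R \<in> S \<rightarrow> carrier (presented_group S R)"
  by (auto simp: pres_gen_def carrier_presented_group)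

theorem presented_group_universal:
  assumes "group H" and f: "f \<in> S \<rightarrow> carrier H"
    and R: "\<And>r. r \<in> R \<Longrightarrow> r \<in> words S \<Longrightarrow> weval H f r = \<one>\<^bsub>H\<^esub>"
  obtains h where "h \<in> hom (presented_group S R) H" "\<And>x. x \<in> S \<Longrightarrow> h (pres_gen S R x) = f x"
proof
  interpret H: group H by fact
  \<comment> \<open>The representative picked by \<open>SOME\<close> is immaterial: by
    \<open>weval_pres_eq\<close> the value is constant on each class.\<close>
  define h where "h A = weval H f (SOME u. u \<in> A)" for A
  have h: "h (pres_class S R w) = weval H f w" if w: "w \<in> words S" for w
  proof -
    have "(SOME u. u \<in> pres_class S R w) \<in> pres_class S R w"
      unfolding some_in_eq using equiv_class_self[OF equiv_pres_rel w] by blast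
    then show ?thesis
      using H.weval_pres_eq[OF f R] by (simp add: h_def pres_rel_def)
  qed
  show "h \<in> hom (presented_group S R) H"
    by (rule homI)
      (auto simp: carrier_presented_group h pres_class_mult H.weval_closed[OF f] H.weval_append[OF f])
  show "h (pres_gen S R x) = f x" if "x \<in> S" for x
    using that funcset_mem[OF f that] h[of "[(x, False)]"] by (simp add: pres_gen_def)
qed

text \<open>Transfers statements about words into the presented group: relators become equations
  between the generators, and every class becomes a product of generators and their
  inverses.\<close>

lemma weval_pres_gen:
  assumes "w \<in> words S"
  shows "weval (presented_group S R) (pres_gen S R) w = pres_class S R w"
  using assms
proof (induction w)
  case Nil
  then show ?case by (simp add: one_presented_group)
next
  case (Cons p w)
  interpret G: group "presented_group S R" by (rule presented_group_is_group)
  obtain x b where p: "p = (x, b)" by force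
  then have x: "x \<in> S" and w: "w \<in> words S" using Cons.prems by auto
  have "inv\<^bsub>presented_group S R\<^esub> (pres_gen S R x) = pres_class S R [(x, True)]"
  proof (rule G.inv_equality)
    have "pres_eq S R [(x, True), (x, False)] []"
      using pres_eq.cancel[OF x, of R True] by simp
    then show "pres_class S R [(x, True)] \<otimes>\<^bsub>presented_group S R\<^esub> pres_gen S R x =
        \<one>\<^bsub>presented_group S R\<^esub>"
      using x by (simp add: pres_gen_def pres_class_mult one_presented_group pres_class_eq_iff)
  qed (use x in \<open>auto simp: carrier_presented_group pres_gen_def\<close>)
  then show ?case
    using Cons.IH[OF w] p x w
    by (cases b) (simp_all add: pres_class_mult pres_gen_def)
qed

lemma weval_relator:
  assumes "r \<in> R" "r \<in> words S"
  shows "weval (presented_group S R) (pres_gen S R) r = \<one>\<^bsub>presented_group S R\<^esub>"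
  using assms by (simp add: weval_pres_gen one_presented_group pres_class_eq_iff pres_eq.relator)

lemma generate_pres_gen:
  "generate (presented_group S R) (pres_gen S R ` S) = carrier (presented_group S R)"
proof
  interpret G: group "presented_group S R" by (rule presented_group_is_group)
  show "generate (presented_group S R) (pres_gen S R ` S) \<subseteq> carrier (presented_group S R)"
    using pres_gen_closed[of S R] by (intro G.generate_incl) auto
  have "weval (presented_group S R) (pres_gen S R) w \<in>
      generate (presented_group S R) (pres_gen S R ` S)" if "w \<in> words S" for w
    using that
  proof (induction w)
    case (Cons p w)
    then obtain x b where "p = (x, b)" "x \<in> S" "w \<in> words S" by (cases p) auto
    then show ?case
      using Cons.IH by (cases b) (auto intro: generate.eng[OF generate.incl] generate.eng[OF generate.inv])
  qed (simp add: generate.one)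
  then show "carrier (presented_group S R) \<subseteq> generate (presented_group S R) (pres_gen S R ` S)"
    by (auto simp: carrier_presented_group weval_pres_gen)
qed

section \<open>Homomorphisms out of dihedral groups and semidirect products\<close>

context group
begin

lemma conj_hom: "g \<in> carrier G \<Longrightarrow> (\<lambda>x. g \<otimes> x \<otimes> inv g) \<in> hom G G"
proof (rule homI)
  fix x y assume *: "g \<in> carrier G" "x \<in> carrier G" "y \<in> carrier G"
  then have "inv g \<otimes> (g \<otimes> (y \<otimes> inv g)) = y \<otimes> inv g"
    by (metis inv_closed l_inv l_one m_assoc m_closed)
  then show "g \<otimes> (x \<otimes> y) \<otimes> inv g = g \<otimes> x \<otimes> inv g \<otimes> (g \<otimes> y \<otimes> inv g)"
    using * by (simp add: m_assoc)
qed simp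

lemma int_pow_conj:
  "g \<in> carrier G \<Longrightarrow> x \<in> carrier G \<Longrightarrow> g \<otimes> x [^] (i::int) \<otimes> inv g = (g \<otimes> x \<otimes> inv g) [^] i"
  using hom_int_pow[OF conj_hom _ is_group is_group] by simp

lemma nat_pow_conj:
  "g \<in> carrier G \<Longrightarrow> x \<in> carrier G \<Longrightarrow> g \<otimes> x [^] (i::nat) \<otimes> inv g = (g \<otimes> x \<otimes> inv g) [^] i"
  using int_pow_conj[of g x "int i"] by (simp add: int_pow_int)

lemma hom_eq_on_generate:
  assumes "group H" "f \<in> hom G H" "g \<in> hom G H" "S \<subseteq> carrier G"
    and eq: "\<And>x. x \<in> S \<Longrightarrow> f x = g x" and x: "x \<in> generate G S"
  shows "f x = g x"
proof -
  interpret f: group_hom G H f using assms by (simp add: group_hom_def group_hom_axioms_def)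
  interpret g: group_hom G H g using assms by (simp add: group_hom_def group_hom_axioms_def)
  show ?thesis
    using x
  proof induction
    case (eng h1 h2)
    then show ?case using generate_in_carrier[OF assms(4)] by simp
  qed (use assms(4) eq in auto)
qed

text \<open>Links powers in \<open>G\<close> with \<open>integer_mod_group r\<close>, whose elements
  are reduced residues.\<close>

lemma int_pow_mod:
  assumes "g \<in> carrier G" "g [^] r = \<one>"
  shows "g [^] (i mod int r) = g [^] i"
proof -
  have "g [^] i = g [^] (int r * (i div int r)) \<otimes> g [^] (i mod int r)"
    using assms(1) by (simp flip: int_pow_mult)
  also have "g [^] (int r * (i div int r)) = \<one>"
    using assms by (simp add: int_pow_int flip: int_pow_pow)
  finally show ?thesis using assms(1) by simp
qed

lemma ord_involution:
  assumes "x \<in> carrier G" "x \<otimes> x = \<one>" "x \<noteq> \<one>"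
  shows "ord x = 2"
proof -
  have "ord x dvd 2"
    using assms pow_eq_id[of x 2] by (simp add: numeral_2_eq_2)
  then show ?thesis
    using assms ord_eq_1 by (metis two_is_prime_nat prime_nat_iff)
qed

lemma inv_involution: "x \<in> carrier G \<Longrightarrow> x \<otimes> x = \<one> \<Longrightarrow> inv x = x"
  by (simp add: inv_equality)

end

lemma mult_semidirect:
  "(a, x) \<otimes>\<^bsub>semidirect N K \<phi>\<^esub> (b, y) = (a \<otimes>\<^bsub>N\<^esub> \<phi> x b, x \<otimes>\<^bsub>K\<^esub> y)"
  and carrier_semidirect: "carrier (semidirect N K \<phi>) = carrier N \<times> carrier K"
  and one_semidirect: "\<one>\<^bsub>semidirect N K \<phi>\<^esub> = (\<one>\<^bsub>N\<^esub>, \<one>\<^bsub>K\<^esub>)"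
  by (simp_all add: semidirect_def)

text \<open>Members of \<open>AutoGroup N\<close> must be undefined outside the carrier, so an
  action given by a formula has to be restricted first. Bijectivity is free: the inverse of
  \<open>\<theta> x\<close> is the action of the inverse of \<open>x\<close>.\<close>

lemma restrict_action_hom:
  assumes "group N" "group K"
    and hom: "\<And>x. x \<in> carrier K \<Longrightarrow> \<theta> x \<in> hom N N"
    and mult: "\<And>x y a. x \<in> carrier K \<Longrightarrow> y \<in> carrier K \<Longrightarrow> a \<in> carrier N \<Longrightarrow>
      \<theta> (x \<otimes>\<^bsub>K\<^esub> y) a = \<theta> x (\<theta> y a)"
    and one: "\<And>a. a \<in> carrier N \<Longrightarrow> \<theta> \<one>\<^bsub>K\<^esub> a = a"
  shows "(\<lambda>x. restrict (\<theta> x) (carrier N)) \<in> hom K (AutoGroup N)"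
proof -
  interpret N: group N by fact
  interpret K: group K by fact
  have cl: "\<theta> x a \<in> carrier N" if "x \<in> carrier K" "a \<in> carrier N" for x a
    using hom_in_carrier[OF hom] that .
  have inv: "\<theta> x (\<theta> (inv\<^bsub>K\<^esub> x) a) = a" "\<theta> (inv\<^bsub>K\<^esub> x) (\<theta> x a) = a"
    if "x \<in> carrier K" "a \<in> carrier N" for x a
    using that one mult[of x "inv\<^bsub>K\<^esub> x" a] mult[of "inv\<^bsub>K\<^esub> x" x a] by simp_all
  have Bij: "restrict (\<theta> x) (carrier N) \<in> Bij (carrier N)" if "x \<in> carrier K" for x
    unfolding Bij_def
    using that inv cl
    by (auto intro!: bij_betw_byWitness[where f' = "\<theta> (inv\<^bsub>K\<^esub> x)"])
  show ?thesis
  proof (rule homI)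
    fix x assume x: "x \<in> carrier K"
    have "restrict (\<theta> x) (carrier N) \<in> hom N N"
      using hom[OF x] by (auto simp: hom_def)
    then show "restrict (\<theta> x) (carrier N) \<in> carrier (AutoGroup N)"
      using Bij[OF x] by (simp add: AutoGroup_def auto_def)
    fix y assume y: "y \<in> carrier K"
    show "restrict (\<theta> (x \<otimes>\<^bsub>K\<^esub> y)) (carrier N) =
        restrict (\<theta> x) (carrier N) \<otimes>\<^bsub>AutoGroup N\<^esub> restrict (\<theta> y) (carrier N)"
      using x y Bij cl mult
      by (auto simp: AutoGroup_def BijGroup_def compose_def intro!: restrict_ext)
  qed
qed

section \<open>Dihedral groups: arithmetic, generation and universal property\<close>

lemma carrier_dihedral: "r > 0 \<Longrightarrow> carrier (dihedral_group (2 * r)) = {0..<int r} \<times> {0, 1}"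
  by (auto simp: dihedral_group_def Let_def semidirect_def carrier_integer_mod_group)

lemma one_dihedral: "\<one>\<^bsub>dihedral_group k\<^esub> = (0, 0)"
  by (simp add: dihedral_group_def Let_def semidirect_def)

text \<open>The second rotation must be a reduced residue because the action is undefined elsewhere;
  the first may be any integer.\<close>

lemma mult_dihedral:
  assumes "r > 0" "0 \<le> j" "j < int r"
  shows "(i, x) \<otimes>\<^bsub>dihedral_group (2 * r)\<^esub> (j, y) =
    ((if x = 0 then i + j else i - j) mod int r, (x + y) mod 2)"
  using assms
  by (auto simp: dihedral_group_def Let_def semidirect_def carrier_integer_mod_group mod_simps)

lemma carrier_C2: "carrier (integer_mod_group 2) = {0, 1}"
  by (auto simp: carrier_integer_mod_group)

lemma dihedral_is_group: "group (dihedral_group k)"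
proof -
  let ?C = "integer_mod_group (k div 2)"
  interpret C: comm_group ?C by simp
  let ?\<theta> = "\<lambda>e::int. \<lambda>a. if e = 0 then a else inv\<^bsub>?C\<^esub> a"
  have "(\<lambda>e. restrict (?\<theta> e) (carrier ?C)) \<in> hom (integer_mod_group 2) (AutoGroup ?C)"
  proof (rule restrict_action_hom)
    show "?\<theta> e \<in> hom ?C ?C" for e
      by (simp add: hom_def C.inv_mult del: inv_integer_mod_group mult_integer_mod_group)
    show "?\<theta> (e \<otimes>\<^bsub>integer_mod_group 2\<^esub> e') a = ?\<theta> e (?\<theta> e' a)"
      if "e \<in> carrier (integer_mod_group 2)" "e' \<in> carrier (integer_mod_group 2)"
        "a \<in> carrier ?C" for e e' a
      using that C.inv_inv[OF that(3)] unfolding carrier_C2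
      by (auto simp del: inv_integer_mod_group)
  qed simp_all
  then show ?thesis
    unfolding dihedral_group_def Let_def by (intro semidirect_is_group) simp_all
qed

text \<open>The reflections are chosen so that \<open>dihP \<otimes> dihQ r\<close> is the rotation by \<open>1\<close>.\<close>

definition dihP :: "int \<times> int" where "dihP = (0, 1)"

definition dihQ :: "nat \<Rightarrow> int \<times> int" where "dihQ r = ((- 1) mod int r, 1)"

locale dihedral =
  fixes r :: nat
  assumes r_pos: "r > 0"
begin

abbreviation "D \<equiv> dihedral_group (2 * r)"

lemma is_group [simp]: "group D"
  using dihedral_is_group .

sublocale D: group D
  by simp

lemma P_closed [simp]: "dihP \<in> carrier D"
  and Q_closed [simp]: "dihQ r \<in> carrier D"
  using r_pos by (auto simp: carrier_dihedral dihP_def dihQ_def)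

lemma P_P [simp]: "dihP \<otimes>\<^bsub>D\<^esub> dihP = \<one>\<^bsub>D\<^esub>"
  and Q_Q [simp]: "dihQ r \<otimes>\<^bsub>D\<^esub> dihQ r = \<one>\<^bsub>D\<^esub>"
  and P_Q: "dihP \<otimes>\<^bsub>D\<^esub> dihQ r = (1 mod int r, 0)"
  using r_pos by (auto simp: mult_dihedral dihP_def dihQ_def one_dihedral mod_simps)

lemma PQ_pow: "(dihP \<otimes>\<^bsub>D\<^esub> dihQ r) [^]\<^bsub>D\<^esub> (k::nat) = (int k mod int r, 0)"
  using r_pos
  by (induction k) (auto simp: P_Q one_dihedral mult_dihedral mod_simps add.commute)

text \<open>The rotation has order exactly \<open>r\<close>. This is the source of the lower bounds
  on the orders of \<open>ab\<close>, \<open>bc\<close>, \<open>ac\<close> and on the size of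
  \<open>N\<close>.\<close>

lemma PQ_pow_eq_one_iff: "(dihP \<otimes>\<^bsub>D\<^esub> dihQ r) [^]\<^bsub>D\<^esub> (k::nat) = \<one>\<^bsub>D\<^esub> \<longleftrightarrow> r dvd k"
  by (simp add: PQ_pow one_dihedral flip: dvd_eq_mod_eq_0)

lemma order_D: "order D = 2 * r"
  using r_pos by (simp add: order_def carrier_dihedral)

text \<open>Powers of \<open>dihP\<close> times \<open>dihQ r\<close> exhaust the rotations, and one
  more factor \<open>dihP\<close> gives the reflections.\<close>

lemma subgroup_eq_carrier:
  assumes H: "subgroup H D" and "dihP \<in> H" "dihQ r \<in> H"
  shows "H = carrier D"
proof
  show "H \<subseteq> carrier D" using subgroup.subset[OF H] .
  show "carrier D \<subseteq> H"
  proof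
    fix u assume "u \<in> carrier D"
    then obtain i x where u: "u = (i, x)" "0 \<le> i" "i < int r" "x \<in> {0, 1}"
      by (auto simp: carrier_dihedral[OF r_pos])
    have pw: "(i, 0) \<in> H"
      using D.subgroup_int_pow_closed[OF H, of "dihP \<otimes>\<^bsub>D\<^esub> dihQ r" "int (nat i)"] u
        PQ_pow[of "nat i"] subgroup.m_closed[OF H assms(2,3)]
      by (simp add: int_pow_int)
    have "(i, 0) \<otimes>\<^bsub>D\<^esub> dihP = (i, 1)"
      using u r_pos by (simp add: dihP_def mult_dihedral)
    then show "u \<in> H" using pw u subgroup.m_closed[OF H pw assms(2)] by auto
  qed
qed

lemma generate_PQ: "generate D {dihP, dihQ r} = carrier D"
  by (rule subgroup_eq_carrier) (auto intro: D.generate_is_subgroup generate.incl)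

end

text \<open>The normal form \<open>(p q)^i p^x\<close>, matching the convention that
  \<open>dihP\<close> times \<open>dihQ\<close> is the rotation by 1.\<close>

definition dihedral_lift :: "('g, 'c) monoid_scheme \<Rightarrow> 'g \<Rightarrow> 'g \<Rightarrow> int \<times> int \<Rightarrow> 'g"
  where "dihedral_lift G p q =
    (\<lambda>(i, x). (p \<otimes>\<^bsub>G\<^esub> q) [^]\<^bsub>G\<^esub> i \<otimes>\<^bsub>G\<^esub> (if x = 0 then \<one>\<^bsub>G\<^esub> else p))"

context group
begin

text \<open>The universal property of the presentation with relators \<open>p^2\<close>,
  \<open>q^2\<close>, \<open>(p q)^r\<close>. Conjugation by \<open>p\<close> inverts
  \<open>p q\<close>, so \<open>p\<close> moves past a power of \<open>p q\<close> at the price of a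
  sign, exactly as in \<open>mult_dihedral\<close>.\<close>

lemma
  assumes r: "r > 0" and p: "p \<in> carrier G" "p \<otimes> p = \<one>" and q: "q \<in> carrier G" "q \<otimes> q = \<one>"
    and pq: "(p \<otimes> q) [^] r = \<one>"
  shows dihedral_lift_hom: "dihedral_lift G p q \<in> hom (dihedral_group (2 * r)) G"
    and dihedral_lift_P: "dihedral_lift G p q dihP = p"
    and dihedral_lift_Q: "dihedral_lift G p q (dihQ r) = q"
proof -
  let ?g = "p \<otimes> q"
  have g: "?g \<in> carrier G" using p q by simp
  have inv: "inv p = p" "inv q = q" using p q by (simp_all add: inv_involution)
  have gi: "inv ?g = q \<otimes> p" using p q by (simp add: inv_mult_group inv)
  have "p \<otimes> ?g \<otimes> inv p = inv ?g" using p q by (simp add: gi inv flip: m_assoc)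
  then have "p \<otimes> ?g [^] j \<otimes> inv p = ?g [^] (- j)" for j :: int
    using int_pow_conj[OF p(1) g, of j] g by (simp add: int_pow_inv int_pow_neg)
  then have sw: "p \<otimes> ?g [^] j = ?g [^] (- j) \<otimes> p" for j :: int
    using p(1) g by (metis inv_solve_right' int_pow_closed m_closed)
  show "dihedral_lift G p q \<in> hom (dihedral_group (2 * r)) G"
  proof (rule homI)
    fix u assume "u \<in> carrier (dihedral_group (2 * r))"
    then obtain i x where u: "u = (i, x)" "0 \<le> i" "i < int r" "x \<in> {0, 1}"
      by (auto simp: carrier_dihedral[OF r])
    show "dihedral_lift G p q u \<in> carrier G" using p g by (simp add: dihedral_lift_def u(1))
    fix v assume "v \<in> carrier (dihedral_group (2 * r))"
    then obtain j y where v: "v = (j, y)" "0 \<le> j" "j < int r" "y \<in> {0, 1}"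
      by (auto simp: carrier_dihedral[OF r])
    have "?g [^] i \<otimes> p \<otimes> (?g [^] j \<otimes> w) = ?g [^] (i - j) \<otimes> (p \<otimes> w)" if "w \<in> carrier G" for w
    proof -
      have "?g [^] i \<otimes> p \<otimes> (?g [^] j \<otimes> w) = ?g [^] i \<otimes> (p \<otimes> ?g [^] j) \<otimes> w"
        using that p g by (simp add: m_assoc)
      also have "\<dots> = ?g [^] i \<otimes> ?g [^] (- j) \<otimes> (p \<otimes> w)"
        using that p(1) g unfolding sw by (simp add: m_assoc)
      finally show ?thesis using g by (simp flip: int_pow_mult)
    qed
    moreover have "?g [^] i \<otimes> (?g [^] j \<otimes> w) = ?g [^] (i + j) \<otimes> w" if "w \<in> carrier G" for w
      using that g by (simp add: m_assoc int_pow_mult)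
    ultimately show "dihedral_lift G p q (u \<otimes>\<^bsub>dihedral_group (2 * r)\<^esub> v) =
        dihedral_lift G p q u \<otimes> dihedral_lift G p q v"
      using u v p r g by (auto simp: dihedral_lift_def mult_dihedral int_pow_mod[OF g pq])
  qed
  show "dihedral_lift G p q dihP = p" using p by (simp add: dihedral_lift_def dihP_def)
  \<comment> \<open>\<open>dihQ r\<close> is the rotation by \<open>-1\<close> followed by
    \<open>dihP\<close>, and \<open>(p q)^(-1) p = q p p = q\<close>.\<close>
  have "?g [^] (- 1 :: int) \<otimes> p = q"
    using p q by (simp add: int_pow_neg[OF g] gi m_assoc del: inv_mult_group)
  then show "dihedral_lift G p q (dihQ r) = q"
    by (simp add: dihedral_lift_def dihQ_def int_pow_mod[OF g pq] p q)
qed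

end

context group
begin

lemma DirProd_lift_hom:
  assumes f: "f \<in> hom A G" and h: "h \<in> hom B G"
    and comm: "\<And>a b. a \<in> carrier A \<Longrightarrow> b \<in> carrier B \<Longrightarrow> f a \<otimes> h b = h b \<otimes> f a"
  shows "(\<lambda>(a, b). f a \<otimes> h b) \<in> hom (A \<times>\<times> B) G"
proof (rule homI)
  fix u assume "u \<in> carrier (A \<times>\<times> B)"
  then obtain a b where u: "u = (a, b)" "a \<in> carrier A" "b \<in> carrier B" by auto
  have cu: "f a \<in> carrier G" "h b \<in> carrier G"
    using u f h by (auto intro: hom_in_carrier)
  then show "(case u of (a, b) \<Rightarrow> f a \<otimes> h b) \<in> carrier G" by (simp add: u(1))
  fix v assume "v \<in> carrier (A \<times>\<times> B)"
  then obtain c d where v: "v = (c, d)" "c \<in> carrier A" "d \<in> carrier B" by auto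
  have cv: "f c \<in> carrier G" "h d \<in> carrier G"
    using v f h by (auto intro: hom_in_carrier)
  have "f a \<otimes> h b \<otimes> (f c \<otimes> h d) = f a \<otimes> (h b \<otimes> f c) \<otimes> h d"
    using cu cv by (simp add: m_assoc)
  also have "\<dots> = f a \<otimes> f c \<otimes> (h b \<otimes> h d)"
    unfolding comm[OF v(2) u(3), symmetric] using cu cv by (simp add: m_assoc)
  finally show "(case u \<otimes>\<^bsub>A \<times>\<times> B\<^esub> v of (a, b) \<Rightarrow> f a \<otimes> h b) =
      (case u of (a, b) \<Rightarrow> f a \<otimes> h b) \<otimes> (case v of (a, b) \<Rightarrow> f a \<otimes> h b)"
    using u v hom_mult[OF f] hom_mult[OF h] by simp
qed

text \<open>The requirement that \<open>h x\<close> acts on the image of \<open>f\<close> as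
  \<open>\<phi> x\<close> does is stated in the form \<open>eq\<close>, free of inverses, which is
  how the later intertwining identities arise.\<close>

lemma semidirect_lift_hom:
  assumes f: "f \<in> hom N G" and h: "h \<in> hom K G"
    and cl: "\<And>x a. x \<in> carrier K \<Longrightarrow> a \<in> carrier N \<Longrightarrow> \<phi> x a \<in> carrier N"
    and eq: "\<And>x a. x \<in> carrier K \<Longrightarrow> a \<in> carrier N \<Longrightarrow> f (\<phi> x a) \<otimes> h x = h x \<otimes> f a"
  shows "(\<lambda>(a, x). f a \<otimes> h x) \<in> hom (semidirect N K \<phi>) G"
proof (rule homI)
  fix u assume "u \<in> carrier (semidirect N K \<phi>)"
  then obtain a x where u: "u = (a, x)" "a \<in> carrier N" "x \<in> carrier K"
    by (auto simp: carrier_semidirect)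
  have cu: "f a \<in> carrier G" "h x \<in> carrier G"
    using u f h by (auto intro: hom_in_carrier)
  then show "(case u of (a, x) \<Rightarrow> f a \<otimes> h x) \<in> carrier G" by (simp add: u(1))
  fix v assume "v \<in> carrier (semidirect N K \<phi>)"
  then obtain b y where v: "v = (b, y)" "b \<in> carrier N" "y \<in> carrier K"
    by (auto simp: carrier_semidirect)
  have cv: "f b \<in> carrier G" "h y \<in> carrier G" "f (\<phi> x b) \<in> carrier G"
    using u v f h cl by (auto intro: hom_in_carrier)
  have "f a \<otimes> h x \<otimes> (f b \<otimes> h y) = f a \<otimes> (h x \<otimes> f b) \<otimes> h y"
    using cu cv by (simp add: m_assoc)
  also have "\<dots> = f a \<otimes> f (\<phi> x b) \<otimes> (h x \<otimes> h y)"
    unfolding eq[OF u(3) v(2), symmetric] using cu cv by (simp add: m_assoc)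
  finally show "(case u \<otimes>\<^bsub>semidirect N K \<phi>\<^esub> v of (a, x) \<Rightarrow> f a \<otimes> h x) =
      (case u of (a, x) \<Rightarrow> f a \<otimes> h x) \<otimes> (case v of (a, x) \<Rightarrow> f a \<otimes> h x)"
    using u v cl hom_mult[OF f] hom_mult[OF h] by (simp add: mult_semidirect)
qed

end

section \<open>Regular hypertopes from coset geometries\<close>

text \<open>Intersections of the subgroups \<open>G_j\<close> already determine those of all
  standard subgroups, hence the form of \<open>intersection\<close>. The assumption
  \<open>flag_transitive\<close> says that pairwise meeting cosets share an element; through it
  every flag extends to a chamber and all flags of one type are translates of each other.\<close>

locale coset_hypertope = group G for G (structure) +
  fixes I :: "'i set" and \<rho> :: "'i \<Rightarrow> 'a"
  assumes finite_I: "finite I"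
    and gen_closed: "i \<in> I \<Longrightarrow> \<rho> i \<in> carrier G"
    and gen_involution: "i \<in> I \<Longrightarrow> \<rho> i \<otimes> \<rho> i = \<one>"
    and gen_nontrivial: "i \<in> I \<Longrightarrow> \<rho> i \<noteq> \<one>"
    and generates: "generate G (\<rho> ` I) = carrier G"
    and intersection: "\<And>J. J \<subseteq> I \<Longrightarrow> J \<noteq> {} \<Longrightarrow>
      (\<Inter>j\<in>J. generate G (\<rho> ` (I - {j}))) \<subseteq> generate G (\<rho> ` (I - J))"
    and flag_transitive: "\<And>J A. J \<subseteq> I \<Longrightarrow> J \<noteq> {} \<Longrightarrow>
      (\<And>j. j \<in> J \<Longrightarrow> A j \<in> rcosets (generate G (\<rho> ` (I - {j})))) \<Longrightarrow>
      (\<And>i j. i \<in> J \<Longrightarrow> j \<in> J \<Longrightarrow> A i \<inter> A j \<noteq> {}) \<Longrightarrow> (\<Inter>j\<in>J. A j) \<noteq> {}"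
begin

abbreviation "\<Gamma> \<equiv> gens_geometry G I \<rho>"

text \<open>By the intersection property, this is the intersection of the \<open>G\<^sub>j\<close> with \<open>j \<in> J\<close>.\<close>

definition par :: "'i set \<Rightarrow> 'a set"
  where "par J = generate G (\<rho> ` (I - J))"

definition cell :: "'a \<Rightarrow> 'i \<Rightarrow> 'i \<times> 'a set"
  where "cell g i = (i, par {i} #> g)"

lemma par_subgroup: "subgroup (par J) G"
  unfolding par_def using gen_closed by (intro generate_is_subgroup) auto

lemmas par_m_closed = subgroup.m_closed[OF par_subgroup]
  and par_subset = subgroup.subset[OF par_subgroup]
  and par_one = subgroup.one_closed[OF par_subgroup]
  and par_inv_closed = subgroup.m_inv_closed[OF par_subgroup]

lemma par_closed: "h \<in> par J \<Longrightarrow> h \<in> carrier G"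
  using par_subset by blast

lemma par_antimono: "J \<subseteq> K \<Longrightarrow> par K \<subseteq> par J"
  unfolding par_def by (intro mono_generate) auto

lemma par_empty: "par {} = carrier G"
  by (simp add: par_def generates)

lemma par_I: "par I = {\<one>}"
  by (simp add: par_def generate_empty)

lemma gen_in_par: "i \<in> I \<Longrightarrow> i \<notin> J \<Longrightarrow> \<rho> i \<in> par J"
  by (auto simp: par_def intro: generate.incl)

lemma par_Inter:
  assumes "J \<subseteq> I" "h \<in> carrier G" "\<And>j. j \<in> J \<Longrightarrow> h \<in> par {j}"
  shows "h \<in> par J"
proof (cases "J = {}")
  case False
  have "h \<in> (\<Inter>j\<in>J. par {j})" using assms(3) by blast
  then show ?thesis using intersection[OF assms(1) False] unfolding par_def by blast
qed (simp add: par_empty assms(2))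

lemma par_single:
  assumes i: "i \<in> I"
  shows "par (I - {i}) = {\<one>, \<rho> i}"
proof
  have sub: "subgroup {\<one>, \<rho> i} G"
    using gen_closed[OF i] gen_involution[OF i] inv_involution[of "\<rho> i"]
    by (intro subgroupI) auto
  show "par (I - {i}) \<subseteq> {\<one>, \<rho> i}"
    unfolding par_def using i by (intro generate_subgroup_incl[OF _ sub]) auto
  show "{\<one>, \<rho> i} \<subseteq> par (I - {i})"
    using i gen_in_par[OF i] par_one by auto
qed

text \<open>Otherwise \<open>\<rho> i\<close> would lie in every \<open>par {j}\<close>, hence in
  \<open>par I\<close>, which is trivial. This keeps the two elements of a panel distinct.\<close>

lemma gen_notin_par:
  assumes i: "i \<in> I"
  shows "\<rho> i \<notin> par {i}"
proof
  assume i': "\<rho> i \<in> par {i}"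
  have "\<rho> i \<in> par {j}" for j
    using i' gen_in_par[OF i, of "{j}"] by (cases "j = i") auto
  then have "\<rho> i \<in> par I"
    using gen_closed[OF i] par_Inter[OF subset_refl] by simp
  then show False using gen_nontrivial[OF i] by (simp add: par_I)
qed

lemma elements: "elements \<Gamma> = (SIGMA i:I. rcosets (par {i}))"
  and type_set: "type_set \<Gamma> = I"
  and type_of: "type_of \<Gamma> = fst"
  and incident: "incident \<Gamma> x y \<longleftrightarrow> snd x \<inter> snd y \<noteq> {}"
  by (simp_all add: gens_geometry_def coset_geometry_def par_def)

lemma coset_eq_iff:
  assumes "g \<in> carrier G" "h \<in> carrier G"
  shows "par J #> g = par J #> h \<longleftrightarrow> g \<otimes> inv h \<in> par J"
proof
  assume "par J #> g = par J #> h"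
  then have "g \<in> par J #> h" using rcos_self[OF assms(1) par_subgroup[of J]] by simp
  then show "g \<otimes> inv h \<in> par J"
    using subgroup.rcos_module_imp[OF par_subgroup is_group assms(2)] by simp
next
  assume "g \<otimes> inv h \<in> par J"
  then have "g \<in> par J #> h"
    using subgroup.rcos_module_rev[OF par_subgroup is_group assms(2,1)] by simp
  then show "par J #> g = par J #> h"
    using repr_independence[OF _ assms(2) par_subgroup] by simp
qed

lemma coset_mult_par: "h \<in> par J \<Longrightarrow> g \<in> carrier G \<Longrightarrow> par J #> (h \<otimes> g) = par J #> g"
  by (simp add: coset_eq_iff par_closed m_assoc)

lemma coset_repr: "A \<in> rcosets (par J) \<Longrightarrow> g \<in> A \<Longrightarrow> g \<in> carrier G \<and> A = par J #> g"
proof -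
  assume "A \<in> rcosets (par J)" and g: "g \<in> A"
  then obtain x where x: "x \<in> carrier G" "A = par J #> x" by (auto simp: RCOSETS_def)
  then show ?thesis
    using g repr_independence[OF _ x(1) par_subgroup] r_coset_subset_G[OF par_subset x(1)] by blast
qed

lemma self_in_coset: "g \<in> carrier G \<Longrightarrow> g \<in> par J #> g"
  using rcos_self par_subgroup by blast

lemma cell_in_elements: "i \<in> I \<Longrightarrow> g \<in> carrier G \<Longrightarrow> cell g i \<in> elements \<Gamma>"
  using rcosetsI[OF par_subset] by (auto simp: elements cell_def)

lemma elements_cell: "x \<in> elements \<Gamma> \<Longrightarrow> \<exists>g\<in>carrier G. \<exists>i\<in>I. x = cell g i"
  by (auto simp: elements cell_def RCOSETS_def)

lemma fst_cell [simp]: "fst (cell g i) = i"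
  and snd_cell: "snd (cell g i) = par {i} #> g"
  by (simp_all add: cell_def)

lemma cell_incident: "g \<in> carrier G \<Longrightarrow> incident \<Gamma> (cell g i) (cell g j)"
  using self_in_coset by (fastforce simp: incident snd_cell)

lemma incident_same_type:
  assumes "x \<in> elements \<Gamma>" "y \<in> elements \<Gamma>" "incident \<Gamma> x y" "fst x = fst y"
  shows "x = y"
proof -
  obtain g where "g \<in> snd x" "g \<in> snd y" using assms(3) by (auto simp: incident)
  then have "snd x = snd y"
    using assms coset_repr[of "snd x" "{fst x}" g] coset_repr[of "snd y" "{fst x}" g]
    by (auto simp: elements)
  then show ?thesis using assms(4) by (simp add: prod_eq_iff)
qed

lemma flag_cell: "J \<subseteq> I \<Longrightarrow> g \<in> carrier G \<Longrightarrow> flag \<Gamma> (cell g ` J)"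
  using cell_incident cell_in_elements by (auto simp: flag_def)

text \<open>The central structural fact: the members of a flag have a common group element
  \<open>g\<close>, supplied by \<open>flag_transitive\<close>. Everything about flags is then
  computed with translates of standard subgroups.\<close>

lemma flag_form:
  assumes F: "flag \<Gamma> F"
  obtains g J where "g \<in> carrier G" "J \<subseteq> I" "F = cell g ` J"
proof (cases "F = {}")
  case True
  then show ?thesis using that[of \<one> "{}"] by simp
next
  case False
  \<comment> \<open>The coset of type \<open>j\<close> in \<open>F\<close>; it is unique because
    incident elements of equal type coincide.\<close>
  define A where "A j = snd (SOME x. x \<in> F \<and> fst x = j)" for j
  have A: "A (fst x) = snd x" if x: "x \<in> F" for x
  proof -
    have "(SOME y. y \<in> F \<and> fst y = fst x) \<in> F \<and> fst (SOME y. y \<in> F \<and> fst y = fst x) = fst x"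
      by (rule someI[of _ x]) (simp add: x)
    then have "(SOME y. y \<in> F \<and> fst y = fst x) = x"
      using F x incident_same_type unfolding flag_def by blast
    then show ?thesis by (simp add: A_def)
  qed
  have FI: "fst ` F \<subseteq> I" using F by (auto simp: flag_def elements)
  have "(\<Inter>j\<in>fst ` F. A j) \<noteq> {}"
  proof (rule flag_transitive[OF FI])
    show "A j \<in> rcosets (generate G (\<rho> ` (I - {j})))" if "j \<in> fst ` F" for j
    proof -
      obtain x where "x \<in> F" "j = fst x" using \<open>j \<in> fst ` F\<close> by blast
      then show ?thesis using F A[of x] by (auto simp: flag_def elements par_def)
    qed
    show "A i \<inter> A j \<noteq> {}" if ij: "i \<in> fst ` F" "j \<in> fst ` F" for i j
    proof -
      obtain x y where "x \<in> F" "i = fst x" "y \<in> F" "j = fst y" using ij by blast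
      then show ?thesis using F A[of x] A[of y] by (auto simp: flag_def incident)
    qed
  qed (use False in auto)
  then obtain g where "\<forall>j\<in>fst ` F. g \<in> A j" by auto
  then have g: "\<forall>x\<in>F. g \<in> snd x" using A by auto
  have g': "g \<in> carrier G \<and> x = cell g (fst x)" if "x \<in> F" for x
    using that F g coset_repr[of "snd x" "{fst x}" g]
    by (auto simp: flag_def elements cell_def prod_eq_iff)
  then have "F = cell g ` fst ` F" by force
  then show ?thesis using that[of g "fst ` F"] g' FI False by blast
qed

lemma chamber_cell: "g \<in> carrier G \<Longrightarrow> chamber \<Gamma> (cell g ` I)"
  using flag_cell[of I g] by (auto simp: chamber_def type_of type_set bij_betw_def inj_on_def image_image)

lemma chamber_form:
  assumes C: "chamber \<Gamma> C"
  obtains g where "g \<in> carrier G" "C = cell g ` I"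
proof -
  obtain g J where "g \<in> carrier G" "J \<subseteq> I" and eq: "C = cell g ` J"
    using C flag_form unfolding chamber_def by metis
  moreover have "fst ` C = I" using C by (simp add: chamber_def type_of type_set bij_betw_def)
  ultimately show ?thesis using that[of g] by (simp add: image_image)
qed

text \<open>Adding an element of the residue to the flag gives a flag again, so it has a common
  element \<open>k\<close>. Then \<open>k\<close> times the inverse of \<open>g\<close> lies in
  \<open>par {j}\<close> for all \<open>j\<close> in \<open>J\<close>, hence in
  \<open>par J\<close>.\<close>

lemma residue_elements:
  assumes J: "J \<subseteq> I" and g: "g \<in> carrier G"
  shows "elements (residue \<Gamma> (cell g ` J)) = {cell (h \<otimes> g) i |h i. h \<in> par J \<and> i \<in> I - J}"
    (is "?L = ?R")
proof
  show "?R \<subseteq> ?L"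
  proof
    fix x assume "x \<in> ?R"
    then obtain h i where x: "x = cell (h \<otimes> g) i" and h: "h \<in> par J" and i: "i \<in> I" "i \<notin> J"
      by blast
    have "cell g j = cell (h \<otimes> g) j" if "j \<in> J" for j
      using h par_antimono[of "{j}" J] that g by (auto simp: cell_def coset_mult_par)
    then have "incident \<Gamma> x (cell g j)" if "j \<in> J" for j
      using that x cell_incident[of "h \<otimes> g"] g par_closed[OF h] by simp
    moreover have "x \<in> elements \<Gamma>"
      using x i g par_closed[OF h] by (simp add: cell_in_elements)
    moreover have "x \<notin> cell g ` J" using i x by (metis fst_cell imageE)
    ultimately show "x \<in> ?L" by (auto simp: residue_def)
  qed
  show "?L \<subseteq> ?R"
  proof
    fix x assume "x \<in> ?L"
    then have x: "x \<in> elements \<Gamma>" "x \<notin> cell g ` J" and inc: "\<And>j. j \<in> J \<Longrightarrow> incident \<Gamma> x (cell g j)"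
      by (auto simp: residue_def)
    have nJ: "fst x \<notin> J"
      using incident_same_type[OF x(1) cell_in_elements[OF _ g] inc] x(2) J by fastforce
    have "incident \<Gamma> x x" using x(1) elements_cell cell_incident by metis
    moreover have "incident \<Gamma> (cell g j) x" if "j \<in> J" for j
      using inc[OF that] by (auto simp: incident)
    ultimately have "flag \<Gamma> (insert x (cell g ` J))"
      using x(1) inc flag_cell[OF J g] by (auto simp: flag_def)
    then obtain k K where k: "k \<in> carrier G" and eq: "insert x (cell g ` J) = cell k ` K"
      by (rule flag_form)
    have cell_k: "y = cell k (fst y)" if "y \<in> insert x (cell g ` J)" for y
      using that unfolding eq by auto
    have "k \<otimes> inv g \<in> par J"
    proof (rule par_Inter[OF J])
      fix j assume "j \<in> J"
      then have "cell k j = cell g j" using cell_k[of "cell g j"] by simp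
      then show "k \<otimes> inv g \<in> par {j}" using k g by (simp add: cell_def coset_eq_iff)
    qed (use k g in simp)
    moreover have "x = cell (k \<otimes> inv g \<otimes> g) (fst x)"
      using cell_k[of x] k g by (simp add: m_assoc)
    moreover have "fst x \<in> I" using x(1) by (auto simp: elements)
    ultimately show "x \<in> ?R" using nJ by blast
  qed
qed

lemma cell_gen_mult:
  assumes "i \<in> I" "m \<in> I" "i \<noteq> m" "g \<in> carrier G"
  shows "cell (\<rho> m \<otimes> g) i = cell g i"
  using assms gen_in_par[of m "{i}"] by (simp add: cell_def coset_mult_par)

lemma cell_gen_mult_neq:
  assumes "i \<in> I" "g \<in> carrier G"
  shows "cell (\<rho> i \<otimes> g) i \<noteq> cell g i"
  using assms gen_notin_par[of i] gen_closed[of i]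
  by (simp add: cell_def coset_eq_iff m_assoc)

lemma panel_residue:
  assumes "i \<in> I" "g \<in> carrier G"
  shows "elements (residue \<Gamma> (cell g ` (I - {i}))) = {cell g i, cell (\<rho> i \<otimes> g) i}"
proof -
  have "I - (I - {i}) = {i}" using assms by auto
  then have "elements (residue \<Gamma> (cell g ` (I - {i}))) =
      {cell (h \<otimes> g) j |h j. h \<in> {\<one>, \<rho> i} \<and> j \<in> {i}}"
    using assms by (simp add: residue_elements par_single)
  also have "\<dots> = {cell (\<one> \<otimes> g) i, cell (\<rho> i \<otimes> g) i}" by blast
  finally show ?thesis using assms by simp
qed

lemma thin_geometry: "thin \<Gamma>"
  unfolding thin_def
proof (intro allI impI, elim conjE)
  fix F assume "flag \<Gamma> F" and rank: "geom_rank (residue \<Gamma> F) = 1"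
  then obtain g J where g: "g \<in> carrier G" and J: "J \<subseteq> I" and F: "F = cell g ` J"
    using flag_form by metis
  have "card (I - J) = 1"
    using rank by (simp add: geom_rank_def residue_def type_set type_of F image_image)
  then obtain i where i: "I - J = {i}" by (auto simp: card_1_singleton_iff)
  then have "i \<in> I" "J = I - {i}" using J by auto
  then show "card (elements (residue \<Gamma> F)) = 2"
    using panel_residue[of i g] g cell_gen_mult_neq[of i g] by (simp add: F)
qed

lemma residually_connected_geometry: "residually_connected \<Gamma>"
  unfolding residually_connected_def
proof (intro allI impI, elim conjE)
  fix F assume "flag \<Gamma> F" and rank: "geom_rank (residue \<Gamma> F) \<ge> 2"
  then obtain g J where g: "g \<in> carrier G" and J: "J \<subseteq> I" and F: "F = cell g ` J"
    using flag_form by metis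
  have card: "card (I - J) \<ge> 2"
    using rank by (simp add: geom_rank_def residue_def type_set type_of F image_image)
  define E where "E = elements (residue \<Gamma> F)"
  define R where "R = (\<lambda>u v. u \<in> E \<and> v \<in> E \<and> incident \<Gamma> u v)"
  have E: "E = {cell (h \<otimes> g) i |h i. h \<in> par J \<and> i \<in> I - J}"
    by (simp add: E_def F residue_elements[OF J g])
  have R: "R (cell (h \<otimes> g) i) (cell (h \<otimes> g) k)" if "h \<in> par J" "i \<in> I - J" "k \<in> I - J" for h i k
    using that g par_closed by (auto simp: R_def E cell_incident)
  \<comment> \<open>Induction on the word for \<open>h\<close>; the start \<open>h'\<close> and both
    types are kept arbitrary so that paths for the two factors of a product can be
    concatenated.\<close>
  have conn: "R\<^sup>*\<^sup>* (cell (h' \<otimes> g) i) (cell (h \<otimes> h' \<otimes> g) k)"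
    if h: "h \<in> generate G (\<rho> ` (I - J))" and "h' \<in> par J" "i \<in> I - J" "k \<in> I - J" for h h' i k
    using h that(2-)
  proof (induction arbitrary: h' i k)
    case one
    then show ?case using R[OF one] par_closed by auto
  next
    case (incl h)
    then obtain m where m: "m \<in> I - J" "h = \<rho> m" by blast
    \<comment> \<open>Rank at least two enters here: there is a type \<open>k'\<close> other than
      \<open>m\<close> in the residue, and left multiplication by \<open>\<rho> m\<close> does not
      change the cell of type \<open>k'\<close>.\<close>
    have "\<not> I - J \<subseteq> {m}" using card card_mono[of "{m}" "I - J"] by auto
    then obtain k' where k': "k' \<in> I - J" "k' \<noteq> m" by blast
    have h: "h \<in> par J" using incl(1) by (simp add: par_def generate.incl)
    have "cell (h \<otimes> h' \<otimes> g) k' = cell (h' \<otimes> g) k'"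
      using cell_gen_mult[of k' m "h' \<otimes> g"] k' m g par_closed incl(2) gen_closed
      by (simp add: m_assoc)
    then have "R (cell (h' \<otimes> g) i) (cell (h \<otimes> h' \<otimes> g) k')"
      using R[OF incl(2,3) k'(1)] by simp
    moreover have "R (cell (h \<otimes> h' \<otimes> g) k') (cell (h \<otimes> h' \<otimes> g) k)"
      using R[OF par_m_closed[OF h incl(2)] k'(1) incl(4)] .
    ultimately show ?case by simp
  next
    case (inv h)
    then obtain m where m: "m \<in> I - J" "h = \<rho> m" by blast
    then have eq: "inv h = \<rho> m" using inv_involution[of "\<rho> m"] gen_closed gen_involution by simp
    have "\<not> I - J \<subseteq> {m}" using card card_mono[of "{m}" "I - J"] by auto
    then obtain k' where k': "k' \<in> I - J" "k' \<noteq> m" by blast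
    have h: "\<rho> m \<in> par J" using m gen_in_par by blast
    have "cell (\<rho> m \<otimes> h' \<otimes> g) k' = cell (h' \<otimes> g) k'"
      using cell_gen_mult[of k' m "h' \<otimes> g"] k' m g par_closed inv(2) gen_closed
      by (simp add: m_assoc)
    then have "R (cell (h' \<otimes> g) i) (cell (\<rho> m \<otimes> h' \<otimes> g) k')"
      using R[OF inv(2,3) k'(1)] by simp
    moreover have "R (cell (\<rho> m \<otimes> h' \<otimes> g) k') (cell (\<rho> m \<otimes> h' \<otimes> g) k)"
      using R[OF par_m_closed[OF h inv(2)] k'(1) inv(4)] .
    ultimately show ?case unfolding eq by simp
  next
    case (eng h1 h2)
    have h12: "h1 \<in> par J" "h2 \<in> par J" using eng(1,2) by (simp_all add: par_def)
    have "R\<^sup>*\<^sup>* (cell (h2 \<otimes> h' \<otimes> g) k) (cell (h1 \<otimes> (h2 \<otimes> h') \<otimes> g) k)"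
      using eng.IH(1)[OF par_m_closed[OF h12(2) eng.prems(1)] eng.prems(3,3)] .
    then show ?case
      using rtranclp_trans[OF eng.IH(2)[OF eng.prems]] h12 eng.prems(1) par_closed
      by (simp add: m_assoc)
  qed
  have "R\<^sup>*\<^sup>* x y" if xy: "x \<in> E" "y \<in> E" for x y
  proof -
    obtain h i h' k where x: "x = cell (h \<otimes> g) i" "h \<in> par J" "i \<in> I - J"
      and y: "y = cell (h' \<otimes> g) k" "h' \<in> par J" "k \<in> I - J"
      using xy unfolding E by blast
    have "h' \<otimes> inv h \<in> generate G (\<rho> ` (I - J))"
      using par_m_closed[OF y(2) par_inv_closed[OF x(2)]] by (simp add: par_def)
    moreover have "h' \<otimes> inv h \<otimes> h = h'"
      using par_closed[OF x(2)] par_closed[OF y(2)] by (simp add: m_assoc)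
    ultimately show ?thesis
      using conn[OF _ x(2,3) y(3), of "h' \<otimes> inv h"] x(1) y(1) by simp
  qed
  then show "incidence_connected (residue \<Gamma> F)"
    unfolding incidence_connected_def E_def R_def by (simp add: residue_def)
qed

lemma incidence_geometry_geometry: "incidence_geometry \<Gamma>"
  unfolding incidence_geometry_def
proof (intro conjI ballI allI impI)
  show "finite (type_set \<Gamma>)" by (simp add: type_set finite_I)
  show "type_of \<Gamma> ` elements \<Gamma> \<subseteq> type_set \<Gamma>" by (auto simp: type_set type_of elements)
  show "incident \<Gamma> x x" if "x \<in> elements \<Gamma>" for x
    using elements_cell[OF that] cell_incident by auto
  show "incident \<Gamma> y x" if "incident \<Gamma> x y" for x y
    using that by (auto simp: incident)
  show "x = y" if "x \<in> elements \<Gamma>" "y \<in> elements \<Gamma>"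
    "incident \<Gamma> x y \<and> type_of \<Gamma> x = type_of \<Gamma> y" for x y
    using that incident_same_type by (simp add: type_of)
  fix F assume "flag \<Gamma> F"
  then obtain g J where "g \<in> carrier G" "J \<subseteq> I" "F = cell g ` J"
    using flag_form by metis
  then show "\<exists>C. chamber \<Gamma> C \<and> F \<subseteq> C"
    using chamber_cell[of g] by blast
qed

lemma hypertope_geometry: "hypertope \<Gamma>"
  by (simp add: hypertope_def incidence_geometry_geometry thin_geometry residually_connected_geometry)

section \<open>Automorphisms of the coset geometry\<close>

abbreviation "act \<equiv> coset_action G \<Gamma>"

lemma act_cell:
  assumes "g \<in> carrier G" "h \<in> carrier G" "i \<in> I"
  shows "act h (cell g i) = cell (g \<otimes> inv h) i"
  using assms cell_in_elements[OF assms(3,1)] par_subset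
  by (simp add: coset_action_def cell_def coset_mult_assoc)

lemma act_type_auts:
  assumes h: "h \<in> carrier G"
  shows "act h \<in> type_auts \<Gamma>"
proof -
  have cl: "act k x \<in> elements \<Gamma>" if "k \<in> carrier G" "x \<in> elements \<Gamma>" for k x
    using that elements_cell act_cell cell_in_elements by fastforce
  have inv: "act k (act (inv k) x) = x" if "k \<in> carrier G" "x \<in> elements \<Gamma>" for k x
    using elements_cell[OF that(2)] that(1) by (auto simp: act_cell m_assoc)
  have "bij_betw (act h) (elements \<Gamma>) (elements \<Gamma>)"
    using cl inv[of h] inv[of "inv h"] h
    by (intro bij_betw_byWitness[where f' = "act (inv h)"]) auto
  then have "act h \<in> Bij (elements \<Gamma>)"
    by (simp add: Bij_def coset_action_def)
  moreover have inc: "incident \<Gamma> (act k x) (act k y)"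
    if "k \<in> carrier G" "x \<in> elements \<Gamma>" "y \<in> elements \<Gamma>" and xy: "incident \<Gamma> x y" for k x y
  proof -
    obtain u where "u \<in> snd x" "u \<in> snd y" using xy by (auto simp: incident)
    then have "u \<otimes> inv k \<in> snd (act k x)" "u \<otimes> inv k \<in> snd (act k y)"
      using that(2,3) by (auto simp: coset_action_def r_coset_def split: prod.split)
    then show ?thesis by (auto simp: incident)
  qed
  moreover have "incident \<Gamma> x y"
    if "x \<in> elements \<Gamma>" "y \<in> elements \<Gamma>" "incident \<Gamma> (act h x) (act h y)" for x y
    using inc[OF inv_closed[OF h] cl[OF h that(1)] cl[OF h that(2)] that(3)] inv[of "inv h"] h that
    by simp
  moreover have "fst (act h x) = fst x" if "x \<in> elements \<Gamma>" for x
    using elements_cell[OF that] h by (auto simp: act_cell)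
  ultimately show ?thesis
    using h by (auto simp: type_auts_def type_of)
qed

text \<open>The image of a chamber is a chamber, to which \<open>chamber_form\<close> applies. So
  far \<open>k\<close> depends on \<open>g\<close>.\<close>

lemma type_aut_cell:
  assumes f: "f \<in> type_auts \<Gamma>" and g: "g \<in> carrier G"
  obtains k where "k \<in> carrier G" "\<And>i. i \<in> I \<Longrightarrow> f (cell g i) = cell k i"
proof -
  have cl: "f (cell g i) \<in> elements \<Gamma>" "fst (f (cell g i)) = i" if "i \<in> I" for i
    using f cell_in_elements[OF that g] Bij_imp_funcset by (force simp: type_auts_def type_of)+
  have "chamber \<Gamma> (f ` cell g ` I)"
    unfolding chamber_def
  proof
    show "flag \<Gamma> (f ` cell g ` I)"
      using cl f cell_in_elements[OF _ g] cell_incident[OF g] by (auto simp: flag_def type_auts_def)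
    show "bij_betw (type_of \<Gamma>) (f ` cell g ` I) (type_set \<Gamma>)"
      using cl by (auto simp: bij_betw_def inj_on_def type_of type_set image_image)
  qed
  then obtain k where k: "k \<in> carrier G" "f ` cell g ` I = cell k ` I" by (rule chamber_form)
  have "f (cell g i) = cell k i" if "i \<in> I" for i
  proof -
    have "f (cell g i) \<in> cell k ` I" using k(2) that by blast
    then show ?thesis using cl(2)[OF that] by auto
  qed
  then show ?thesis using that k(1) by blast
qed

text \<open>
  By thinness, an automorphism is determined on a chamber by its values on an adjacent one.
\<close>

lemma type_aut_adjacent:
  assumes f: "f \<in> type_auts \<Gamma>" and g: "g \<in> carrier G" and k: "k \<in> carrier G"
    and eq: "\<And>i. i \<in> I \<Longrightarrow> f (cell g i) = cell k i"
    and m: "m \<in> I" and i: "i \<in> I"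
  shows "f (cell (\<rho> m \<otimes> g) i) = cell (\<rho> m \<otimes> k) i"
proof (cases "i = m")
  case False
  then show ?thesis using assms by (simp add: cell_gen_mult)
next
  case True
  let ?x = "cell (\<rho> m \<otimes> g) m"
  have xE: "?x \<in> elements \<Gamma>" and gE: "\<And>j. j \<in> I \<Longrightarrow> cell g j \<in> elements \<Gamma>"
    using m g gen_closed cell_in_elements by auto
  have bij: "bij_betw f (elements \<Gamma>) (elements \<Gamma>)"
    and inc: "\<And>x y. x \<in> elements \<Gamma> \<Longrightarrow> y \<in> elements \<Gamma> \<Longrightarrow> incident \<Gamma> (f x) (f y) = incident \<Gamma> x y"
    and type: "\<And>x. x \<in> elements \<Gamma> \<Longrightarrow> fst (f x) = fst x"
    using f by (auto simp: type_auts_def Bij_def type_of)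
  have fx: "f ?x \<in> elements \<Gamma>" "fst (f ?x) = m"
    using bij xE type[OF xE] by (auto simp: bij_betw_def)
  have "incident \<Gamma> (f ?x) (cell k j)" if "j \<in> I - {m}" for j
  proof -
    have "incident \<Gamma> ?x (cell g j)"
      using cell_incident[of "\<rho> m \<otimes> g" m j] cell_gen_mult[of j m g] that m g gen_closed by simp
    then show ?thesis using inc[OF xE gE, of j] eq[of j] that by simp
  qed
  moreover have "f ?x \<notin> cell k ` (I - {m})" using fx(2) by auto
  ultimately have "f ?x \<in> {cell k m, cell (\<rho> m \<otimes> k) m}"
    using fx(1) by (simp flip: panel_residue[OF m k]) (auto simp: residue_def)
  moreover have "f ?x \<noteq> f (cell g m)"
    using bij xE gE[OF m] cell_gen_mult_neq[OF m g] by (auto simp: bij_betw_def inj_on_def)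
  ultimately show ?thesis using True eq[OF m] by simp
qed

text \<open>Agreement with right multiplication by \<open>k\<close> spreads from a chamber to its
  neighbours by \<open>type_aut_adjacent\<close>, and the base chamber reaches all others because
  the generators generate \<open>G\<close>.\<close>

lemma type_aut_eq_act:
  assumes f: "f \<in> type_auts \<Gamma>" and k: "k \<in> carrier G"
    and eq: "\<And>i. i \<in> I \<Longrightarrow> f (cell \<one> i) = cell k i"
  shows "f = act (inv k)"
proof -
  have step: "\<forall>i\<in>I. f (cell (w \<otimes> g) i) = cell (w \<otimes> g \<otimes> k) i"
    if "w \<in> generate G (\<rho> ` I)" "g \<in> carrier G" "\<forall>i\<in>I. f (cell g i) = cell (g \<otimes> k) i" for w g
    using that
  proof (induction arbitrary: g)
    case (incl h)
    then show ?case
      using type_aut_adjacent[OF f incl(2), of "g \<otimes> k"] k gen_closed by (auto simp: m_assoc)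
  next
    case (inv h)
    then obtain m where m: "m \<in> I" "inv h = \<rho> m" 
      using inv_involution gen_closed gen_involution by fastforce
    then show ?case
      unfolding m(2)
      using type_aut_adjacent[OF f inv(2), of "g \<otimes> k"] inv k gen_closed by (auto simp: m_assoc)
  next
    case (eng h1 h2)
    then have "h1 \<in> carrier G" "h2 \<in> carrier G" using generates by auto
    then show ?case using eng.IH(1)[of "h2 \<otimes> g"] eng.IH(2)[of g] eng.prems k by (simp add: m_assoc)
  qed simp
  have "f x = act (inv k) x" if x: "x \<in> elements \<Gamma>" for x
  proof -
    obtain g i where "g \<in> carrier G" "i \<in> I" "x = cell g i" using elements_cell[OF x] by blast
    then show ?thesis using step[of g \<one>] generates eq k by (simp add: act_cell)
  qed
  \<comment> \<open>Both functions are undefined off \<open>elements \<Gamma>\<close>, so agreement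
    there makes them equal.\<close>
  then show ?thesis
    using f by (intro extensionalityI[of _ "elements \<Gamma>"])
      (auto simp: type_auts_def Bij_def coset_action_def)
qed

theorem regular_hypertope_geometry: "regular_hypertope \<Gamma>"
  unfolding regular_hypertope_def
proof (intro conjI allI impI, rule hypertope_geometry, elim conjE)
  fix C D assume "chamber \<Gamma> C" "chamber \<Gamma> D"
  then obtain g h where g: "g \<in> carrier G" "C = cell g ` I" and h: "h \<in> carrier G" "D = cell h ` I"
    by (metis chamber_form)
  show "\<exists>!f. f \<in> type_auts \<Gamma> \<and> f ` C = D"
  proof
    \<comment> \<open>\<open>act\<close> multiplies by the inverse of its argument, and
      \<open>g\<close> times the inverse of \<open>inv h \<otimes> g\<close> is
      \<open>h\<close>.\<close>
    have "act (inv h \<otimes> g) ` C = D"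
      using g h by (simp add: image_image act_cell inv_mult_group flip: m_assoc cong: image_cong_simp)
    then show "act (inv h \<otimes> g) \<in> type_auts \<Gamma> \<and> act (inv h \<otimes> g) ` C = D"
      using g h by (simp add: act_type_auts)
    fix f assume f: "f \<in> type_auts \<Gamma> \<and> f ` C = D"
    then obtain k where k: "k \<in> carrier G" "\<And>i. i \<in> I \<Longrightarrow> f (cell \<one> i) = cell k i"
      using type_aut_cell[of f \<one>] by auto
    have fk: "f = act (inv k)" using type_aut_eq_act f k by blast
    \<comment> \<open>\<open>f\<close> moves the chamber of \<open>g\<close> to that of
      \<open>g \<otimes> k\<close>, which must be that of \<open>h\<close>; comparing cells type by
      type puts the quotient in all \<open>par {i}\<close>.\<close>
    have "g \<otimes> k \<otimes> inv h \<in> par I"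
    proof (rule par_Inter)
      fix i assume i: "i \<in> I"
      have "cell (g \<otimes> k) i \<in> cell h ` I"
        using f g h k i by (auto simp: fk image_image act_cell)
      then have "cell (g \<otimes> k) i = cell h i" by (metis fst_cell imageE)
      then show "g \<otimes> k \<otimes> inv h \<in> par {i}"
        using g h k by (simp add: cell_def coset_eq_iff)
    qed (use g h k in auto)
    then have "g \<otimes> k = h" using g h k by (simp add: par_I inv_solve_right')
    then have "inv k = inv h \<otimes> g" using g k by (auto simp: inv_mult_group m_assoc)
    then show "f = act (inv h \<otimes> g)" using fk by simp
  qed
qed

theorem act_iso: "act \<in> iso G (type_aut_group \<Gamma>)"
proof (rule isoI)
  show "act \<in> hom G (type_aut_group \<Gamma>)"
  proof (rule homI)
    fix g h assume g: "g \<in> carrier G" and h: "h \<in> carrier G"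
    show "act g \<in> carrier (type_aut_group \<Gamma>)"
      using act_type_auts[OF g] by (simp add: type_aut_group_def)
    have "act (g \<otimes> h) = compose (elements \<Gamma>) (act g) (act h)"
    proof (rule extensionalityI[of _ "elements \<Gamma>"])
      fix x assume x: "x \<in> elements \<Gamma>"
      then obtain k i where "k \<in> carrier G" "i \<in> I" "x = cell k i" using elements_cell by blast
      then show "act (g \<otimes> h) x = compose (elements \<Gamma>) (act g) (act h) x"
        using g h x by (simp add: compose_def act_cell inv_mult_group m_assoc)
    qed (simp_all add: coset_action_def compose_def)
    moreover have "act g \<in> Bij (elements \<Gamma>)" "act h \<in> Bij (elements \<Gamma>)"
      using act_type_auts g h by (auto simp: type_auts_def)
    ultimately show "act (g \<otimes> h) = act g \<otimes>\<^bsub>type_aut_group \<Gamma>\<^esub> act h"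
      by (simp add: type_aut_group_def BijGroup_def)
  qed
  show "bij_betw act (carrier G) (carrier (type_aut_group \<Gamma>))"
    unfolding bij_betw_def
  proof
    show "inj_on act (carrier G)"
    proof (rule inj_onI)
      fix g h assume g: "g \<in> carrier G" and h: "h \<in> carrier G" and eq: "act g = act h"
      have "inv g \<otimes> inv (inv h) \<in> par I"
      proof (rule par_Inter)
        fix i assume "i \<in> I"
        then show "inv g \<otimes> inv (inv h) \<in> par {i}"
          using eq act_cell[of \<one> g i] act_cell[of \<one> h i] g h
          by (simp add: cell_def coset_eq_iff del: inv_inv)
      qed (use g h in auto)
      then show "g = h" using g h by (simp add: par_I inv_solve_left')
    qed
    have "f \<in> act ` carrier G" if "f \<in> type_auts \<Gamma>" for f
      using type_aut_cell[OF that one_closed] type_aut_eq_act[OF that] by (metis inv_closed imageI)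
    then show "act ` carrier G = carrier (type_aut_group \<Gamma>)"
      using act_type_auts by (auto simp: type_aut_group_def)
  qed
qed

theorem aut_group: "aut_group_of_regular_hypertope G I \<rho>"
  using regular_hypertope_geometry act_iso generates gen_closed
    ord_involution[OF gen_closed gen_involution gen_nontrivial]
  by (simp add: aut_group_of_regular_hypertope_def)

end

text \<open>
  If killing \<open>\<rho> i\<close> is injective on \<open>G\<^sub>i\<close> for all \<open>i\<close>, then the intersection property and
  flag-transitivity can be checked in the images, where the generator \<open>\<rho> i\<close> may be dropped
  from every word.
\<close>

locale retract_group = group G for G (structure) +
  fixes I :: "'i set" and \<rho> :: "'i \<Rightarrow> 'a" and H :: "'i \<Rightarrow> ('h, 'k) monoid_scheme"
    and f :: "'i \<Rightarrow> 'a \<Rightarrow> 'h"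
  assumes gen_closed: "i \<in> I \<Longrightarrow> \<rho> i \<in> carrier G"
    and target: "i \<in> I \<Longrightarrow> group (H i)"
    and hom: "i \<in> I \<Longrightarrow> f i \<in> hom G (H i)"
    and kills: "i \<in> I \<Longrightarrow> f i (\<rho> i) = \<one>\<^bsub>H i\<^esub>"
    and inj: "i \<in> I \<Longrightarrow> inj_on (f i) (generate G (\<rho> ` (I - {i})))"
begin

abbreviation "gen A \<equiv> generate G (\<rho> ` A)"

lemma gen_subgroup: "A \<subseteq> I \<Longrightarrow> subgroup (gen A) G"
  using gen_closed by (intro generate_is_subgroup) auto

lemma gen_in_carrier: "A \<subseteq> I \<Longrightarrow> u \<in> gen A \<Longrightarrow> u \<in> carrier G"
  using subgroup.mem_carrier[OF gen_subgroup] .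

text \<open>Erase every occurrence of \<open>\<rho> i\<close> from a word for \<open>u\<close>; the
  map \<open>f i\<close> does not notice.\<close>

lemma drop_gen:
  assumes i: "i \<in> I" and A: "A \<subseteq> I" and u: "u \<in> gen A"
  shows "\<exists>u'\<in>gen (A - {i}). f i u = f i u'"
proof -
  interpret f: group_hom G "H i" "f i"
    using hom[OF i] target[OF i] by (simp add: group_hom_def group_hom_axioms_def)
  have A': "A - {i} \<subseteq> I" using A by auto
  show ?thesis
    using u
  proof induction
    case one
    show ?case using generate.one by blast
  next
    case (incl h)
    show ?case
    proof (cases "h = \<rho> i")
      case True
      then show ?thesis using kills[OF i] generate.one[of G] by (intro bexI[of _ \<one>]) simp_all
    next
      case False
      then have "h \<in> gen (A - {i})" using incl by (auto intro: generate.incl)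
      then show ?thesis by blast
    qed
  next
    case (inv h)
    show ?case
    proof (cases "h = \<rho> i")
      case True
      then show ?thesis
        using kills[OF i] gen_closed[OF i] generate.one[of G] by (intro bexI[of _ \<one>]) simp_all
    next
      case False
      then have "inv h \<in> gen (A - {i})" using inv by (auto intro: generate.inv)
      then show ?thesis by blast
    qed
  next
    case (eng h1 h2)
    then obtain u1 u2 where u: "u1 \<in> gen (A - {i})" "u2 \<in> gen (A - {i})"
      "f i h1 = f i u1" "f i h2 = f i u2" by blast
    have "h1 \<in> carrier G" "h2 \<in> carrier G" "u1 \<in> carrier G" "u2 \<in> carrier G"
      using eng(1,2) u gen_in_carrier[OF A] gen_in_carrier[OF A'] by auto
    then show ?case
      using u by (intro bexI[of _ "u1 \<otimes> u2"]) (simp_all add: generate.eng)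
  qed
qed

text \<open>The element \<open>u\<close> and its shortened form from \<open>drop_gen\<close> both
  lie in the subgroup on which \<open>f i\<close> is injective, so they are equal.\<close>

lemma gen_Int:
  assumes i: "i \<in> I" and A: "A \<subseteq> I" and u: "u \<in> gen A" "u \<in> gen (I - {i})"
  shows "u \<in> gen (A - {i})"
proof -
  obtain u' where u': "u' \<in> gen (A - {i})" "f i u = f i u'" using drop_gen[OF i A u(1)] by blast
  have "gen (A - {i}) \<subseteq> gen (I - {i})" using A by (intro mono_generate) auto
  then have "u = u'" using inj_onD[OF inj[OF i]] u' u(2) by blast
  then show ?thesis using u' by simp
qed

lemma gen_Inter:
  assumes "finite J" "J \<noteq> {}" "J \<subseteq> I"
  shows "(\<Inter>j\<in>J. gen (I - {j})) \<subseteq> gen (I - J)"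
  using assms
proof (induction rule: finite_ne_induct)
  case (insert i J)
  have "u \<in> gen (I - J - {i})" if u: "u \<in> (\<Inter>j\<in>insert i J. gen (I - {j}))" for u
  proof (rule gen_Int)
    have "u \<in> (\<Inter>j\<in>J. gen (I - {j}))" using u by simp
    then show "u \<in> gen (I - J)" using insert by auto
  qed (use u insert.prems in auto)
  moreover have "I - J - {i} = I - insert i J" by auto
  ultimately show ?case by auto
qed auto

end

text \<open>The intersection property is \<open>gen_Inter\<close>. For flag-transitivity with three
  types, one or two cosets are immediate and only three pairwise meeting cosets need an
  argument.\<close>

lemma coset_hypertope_of_retracts:
  fixes \<rho> :: "nat \<Rightarrow> 'a" and I :: "nat set"
  assumes I: "I = {0, 1, 2}" and "retract_group G I \<rho> H f"
    and invol: "\<And>i. i \<in> I \<Longrightarrow> \<rho> i \<otimes>\<^bsub>G\<^esub> \<rho> i = \<one>\<^bsub>G\<^esub>"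
    and nontriv: "\<And>i. i \<in> I \<Longrightarrow> \<rho> i \<noteq> \<one>\<^bsub>G\<^esub>"
    and generates: "generate G (\<rho> ` I) = carrier G"
  shows "coset_hypertope G I \<rho>"
proof -
  interpret retract_group G I \<rho> H f by fact
  have sub: "subgroup (gen (I - K)) G" for K by (rule gen_subgroup) auto
  show ?thesis
  proof
    fix J A
    assume J: "J \<subseteq> I" "J \<noteq> {}"
      and A: "\<And>j. j \<in> J \<Longrightarrow> A j \<in> rcosets\<^bsub>G\<^esub> (gen (I - {j}))"
      and meet: "\<And>i j. i \<in> J \<Longrightarrow> j \<in> J \<Longrightarrow> A i \<inter> A j \<noteq> {}"
    have mult: "h \<otimes>\<^bsub>G\<^esub> g \<in> A j" if "j \<in> J" "g \<in> A j" "h \<in> gen (I - {j})" for g h j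
      using A[OF that(1)] that(2,3) subgroup.m_closed[OF sub that(3)] subgroup.mem_carrier[OF sub]
      by (auto simp: RCOSETS_def r_coset_def m_assoc[symmetric])
    have quot: "g \<otimes>\<^bsub>G\<^esub> inv\<^bsub>G\<^esub> h \<in> gen (I - {j})" "g \<in> carrier G"
      if j: "j \<in> J" "g \<in> A j" "h \<in> A j" for g h j
    proof -
      obtain x k k' where "x \<in> carrier G" "k \<in> gen (I - {j})" "k' \<in> gen (I - {j})"
        "g = k \<otimes>\<^bsub>G\<^esub> x" "h = k' \<otimes>\<^bsub>G\<^esub> x"
        using A[OF j(1)] j(2,3) by (auto simp: RCOSETS_def r_coset_def)
      moreover from this have "k \<in> carrier G" "k' \<in> carrier G"
        using subgroup.mem_carrier[OF sub] by auto
      ultimately show "g \<otimes>\<^bsub>G\<^esub> inv\<^bsub>G\<^esub> h \<in> gen (I - {j})" "g \<in> carrier G"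
        using subgroup.m_closed[OF sub _ subgroup.m_inv_closed[OF sub]]
        by (simp_all add: inv_mult_group m_assoc inv_solve_left' flip: m_assoc[of x])
    qed
    show "(\<Inter>j\<in>J. A j) \<noteq> {}"
    proof (cases "J = I")
      case True
      then have J012: "0 \<in> J" "1 \<in> J" "2 \<in> J" using I by auto
      obtain x y z where x: "x \<in> A 1" "x \<in> A 2" and y: "y \<in> A 0" "y \<in> A 2"
        and z: "z \<in> A 0" "z \<in> A 1"
        using meet[OF J012(2,3)] meet[OF J012(1,3)] meet[OF J012(1,2)] by blast
      have cl: "x \<in> carrier G" "y \<in> carrier G" "z \<in> carrier G"
        using quot(2) x y z J012 by blast+
      \<comment> \<open>The sides of the triangle with corners \<open>x\<close>, \<open>y\<close>,
        \<open>z\<close>: each quotient lies in the subgroup whose coset contains both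
        corners.\<close>
      define u v w where "u = z \<otimes>\<^bsub>G\<^esub> inv\<^bsub>G\<^esub> x" and "v = y \<otimes>\<^bsub>G\<^esub> inv\<^bsub>G\<^esub> x"
        and "w = z \<otimes>\<^bsub>G\<^esub> inv\<^bsub>G\<^esub> y"
      have u: "u \<in> gen (I - {1})" and v: "v \<in> gen (I - {2})" and w: "w \<in> gen (I - {0})"
        using quot(1) J012 x y z by (auto simp: u_def v_def w_def)
      have uvw: "u \<in> carrier G" "v \<in> carrier G" "w \<in> carrier G"
        using cl by (auto simp: u_def v_def w_def)
      have uwv: "u = w \<otimes>\<^bsub>G\<^esub> v"
        using cl by (simp add: u_def v_def w_def m_assoc) (simp flip: m_assoc)
      obtain v' w' where v': "v' \<in> gen (I - {2} - {1})" "f 1 v = f 1 v'"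
        and w': "w' \<in> gen (I - {0} - {1})" "f 1 w = f 1 w'"
        using drop_gen[of 1 "I - {2}" v] drop_gen[of 1 "I - {0}" w] v w I by auto
      have mono: "gen A \<subseteq> gen B" if "A \<subseteq> B" for A B
        using that by (intro mono_generate image_mono)
      have v'G: "v' \<in> gen (I - {1})" "v' \<in> gen (I - {2})"
        using v'(1) mono[of "I - {2} - {1}" "I - {1}"] mono[of "I - {2} - {1}" "I - {2}"]
        by auto
      have w'G: "w' \<in> gen (I - {1})" "w' \<in> gen (I - {0})"
        using w'(1) mono[of "I - {0} - {1}" "I - {1}"] mono[of "I - {0} - {1}" "I - {0}"]
        by auto
      have cl': "v' \<in> carrier G" "w' \<in> carrier G"
        using v'G w'G subgroup.mem_carrier[OF sub] by auto
      \<comment> \<open>Both sides lie in \<open>G_1\<close> and agree under \<open>f 1\<close>,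
        since \<open>v'\<close> and \<open>w'\<close> are \<open>v\<close> and \<open>w\<close> with
        \<open>\<rho> 1\<close> erased.\<close>
      have "u = w' \<otimes>\<^bsub>G\<^esub> v'"
      proof (rule inj_onD[OF inj])
        show "f 1 u = f 1 (w' \<otimes>\<^bsub>G\<^esub> v')"
          using hom_mult[OF hom, of 1] uvw cl' I v' w' by (simp add: uwv)
        show "w' \<otimes>\<^bsub>G\<^esub> v' \<in> gen (I - {1})"
          using subgroup.m_closed[OF sub w'G(1) v'G(1)] .
      qed (use u I in auto)
      \<comment> \<open>The common element. Read as \<open>v' \<otimes> x\<close> it lies in the
        cosets of types 1 and 2; read with \<open>z\<close> it lies in the coset of type 0.\<close>
      then have "inv\<^bsub>G\<^esub> w' \<otimes>\<^bsub>G\<^esub> z = v' \<otimes>\<^bsub>G\<^esub> x"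
        using cl cl' by (simp add: u_def inv_solve_right' inv_solve_left' m_assoc)
      then have "v' \<otimes>\<^bsub>G\<^esub> x \<in> A 0" "v' \<otimes>\<^bsub>G\<^esub> x \<in> A 1" "v' \<otimes>\<^bsub>G\<^esub> x \<in> A 2"
        using mult[OF J012(1) z(1) subgroup.m_inv_closed[OF sub w'G(2)]]
          mult[OF J012(2) x(1) v'G(1)] mult[OF J012(3) x(2) v'G(2)] by auto
      then show ?thesis using True I by auto
    next
      case False
      then have "J \<subset> I" "finite I" using J(1) I by auto
      then have "card J < 3" "card J > 0"
        using J psubset_card_mono[of I J] finite_subset[of J I] by (simp_all add: I card_gt_0_iff)
      then have "card J = 1 \<or> card J = 2" by linarith
      then obtain i j where "J = {i, j}" by (metis card_1_singletonE card_2_iff insert_absorb2)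
      then show ?thesis using meet[of i j] by blast
    qed
  qed (use I gen_closed invol nontriv generates gen_Inter in \<open>auto simp: finite_subset\<close>)
qed

section \<open>The defining relations\<close>

definition gcomm :: "('g, 'c) monoid_scheme \<Rightarrow> 'g \<Rightarrow> 'g \<Rightarrow> 'g"
  where "gcomm G u v = inv\<^bsub>G\<^esub> u \<otimes>\<^bsub>G\<^esub> (inv\<^bsub>G\<^esub> v \<otimes>\<^bsub>G\<^esub> (u \<otimes>\<^bsub>G\<^esub> v))"

text \<open>The commutator relators appear as commuting equations, the form in which
  \<open>conj_x\<close>, \<open>conj_y\<close> and \<open>conj_z\<close> use them.\<close>

definition base_relations :: "('g, 'c) monoid_scheme \<Rightarrow> nat \<Rightarrow> nat \<Rightarrow> nat \<Rightarrow> 'g \<Rightarrow> 'g \<Rightarrow> 'g \<Rightarrow> bool"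
  where "base_relations G s t l a b c \<longleftrightarrow>
    a \<otimes>\<^bsub>G\<^esub> a = \<one>\<^bsub>G\<^esub> \<and> b \<otimes>\<^bsub>G\<^esub> b = \<one>\<^bsub>G\<^esub> \<and> c \<otimes>\<^bsub>G\<^esub> c = \<one>\<^bsub>G\<^esub> \<and>
    (a \<otimes>\<^bsub>G\<^esub> b) [^]\<^bsub>G\<^esub> ((2::nat) ^ s) = \<one>\<^bsub>G\<^esub> \<and>
    (b \<otimes>\<^bsub>G\<^esub> c) [^]\<^bsub>G\<^esub> ((2::nat) ^ t) = \<one>\<^bsub>G\<^esub> \<and>
    (a \<otimes>\<^bsub>G\<^esub> c) [^]\<^bsub>G\<^esub> ((2::nat) ^ l) = \<one>\<^bsub>G\<^esub> \<and>
    (a \<otimes>\<^bsub>G\<^esub> b) [^]\<^bsub>G\<^esub> (4::nat) \<otimes>\<^bsub>G\<^esub> c = c \<otimes>\<^bsub>G\<^esub> (a \<otimes>\<^bsub>G\<^esub> b) [^]\<^bsub>G\<^esub> (4::nat) \<and>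
    a \<otimes>\<^bsub>G\<^esub> (b \<otimes>\<^bsub>G\<^esub> c) [^]\<^bsub>G\<^esub> (4::nat) = (b \<otimes>\<^bsub>G\<^esub> c) [^]\<^bsub>G\<^esub> (4::nat) \<otimes>\<^bsub>G\<^esub> a \<and>
    (a \<otimes>\<^bsub>G\<^esub> c) [^]\<^bsub>G\<^esub> (2::nat) \<otimes>\<^bsub>G\<^esub> b = b \<otimes>\<^bsub>G\<^esub> (a \<otimes>\<^bsub>G\<^esub> c) [^]\<^bsub>G\<^esub> (2::nat)"

definition even_relation :: "('g, 'c) monoid_scheme \<Rightarrow> nat \<Rightarrow> 'g \<Rightarrow> 'g \<Rightarrow> 'g \<Rightarrow> bool"
  where "even_relation G k a b c \<longleftrightarrow>
    gcomm G ((a \<otimes>\<^bsub>G\<^esub> b) [^]\<^bsub>G\<^esub> (2::nat)) c [^]\<^bsub>G\<^esub> k = \<one>\<^bsub>G\<^esub>"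

definition odd_relation :: "('g, 'c) monoid_scheme \<Rightarrow> nat \<Rightarrow> 'g \<Rightarrow> 'g \<Rightarrow> 'g \<Rightarrow> bool"
  where "odd_relation G k a b c \<longleftrightarrow>
    gcomm G ((a \<otimes>\<^bsub>G\<^esub> b) [^]\<^bsub>G\<^esub> (2::nat)) ((b \<otimes>\<^bsub>G\<^esub> c) [^]\<^bsub>G\<^esub> (2::nat)) [^]\<^bsub>G\<^esub> k = \<one>\<^bsub>G\<^esub>"

definition hyp_relations ::
    "('g, 'c) monoid_scheme \<Rightarrow> nat \<Rightarrow> nat \<Rightarrow> nat \<Rightarrow> nat \<Rightarrow> 'g \<Rightarrow> 'g \<Rightarrow> 'g \<Rightarrow> bool"
  where "hyp_relations G n s t l a b c \<longleftrightarrow> base_relations G s t l a b c \<and>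
    (if even (n - s - t - l) then even_relation G (2 ^ ((n - s - t - l) div 2)) a b c
     else odd_relation G (2 ^ ((n - s - t - l - 1) div 2)) a b c)"

lemma (in group) pow_two: "x \<in> carrier G \<Longrightarrow> x [^] (2::nat) = x \<otimes> x"
  by (simp add: numeral_2_eq_2)

lemma (in group) gcomm_eq_one_iff:
  assumes "u \<in> carrier G" "v \<in> carrier G"
  shows "gcomm G u v = \<one> \<longleftrightarrow> u \<otimes> v = v \<otimes> u"
proof -
  have "gcomm G u v = inv (v \<otimes> u) \<otimes> (u \<otimes> v)"
    using assms by (simp add: gcomm_def inv_mult_group m_assoc)
  then show ?thesis using assms by (simp add: inv_solve_left')
qed

lemma (in group) weval_hyp_relators:
  assumes f: "f \<in> {0, 1, 2} \<rightarrow> carrier G"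
  shows "(\<forall>r\<in>hyp_relators n s t l. weval G f r = \<one>) \<longleftrightarrow> hyp_relations G n s t l (f 0) (f 1) (f 2)"
proof -
  have cl: "f 0 \<in> carrier G" "f 1 \<in> carrier G" "f 2 \<in> carrier G" using f by auto
  then have cl': "f (Suc 0) \<in> carrier G" by simp
  have wf: "r0 \<in> words {0, 1, 2}" "r1 \<in> words {0, 1, 2}" "r2 \<in> words {0, 1, 2}"
    "r0 @ r1 \<in> words {0, 1, 2}" "r1 @ r2 \<in> words {0, 1, 2}" "r0 @ r2 \<in> words {0, 1, 2}"
    by simp_all
  have ev: "weval G f r0 = f 0" "weval G f r1 = f 1" "weval G f r2 = f 2"
    "weval G f (r0 @ r1) = f 0 \<otimes> f 1" "weval G f (r1 @ r2) = f 1 \<otimes> f 2"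
    "weval G f (r0 @ r2) = f 0 \<otimes> f 2"
    using cl cl' by simp_all
  note pw = weval_wpow[OF f wf(1)] weval_wpow[OF f wf(2)] weval_wpow[OF f wf(3)]
    weval_wpow[OF f wf(4)] weval_wpow[OF f wf(5)] weval_wpow[OF f wf(6)]
  note cm = weval_wcomm[OF f] weval_wpow[OF f wcomm_words] gcomm_def[symmetric]
  have "(\<forall>r\<in>base_relators s t l. weval G f r = \<one>) \<longleftrightarrow> base_relations G s t l (f 0) (f 1) (f 2)"
    unfolding base_relators_def base_relations_def ball_simps
    by (simp only: pw cm ev wf wpow_words gcomm_eq_one_iff cl m_closed nat_pow_closed pow_two
        simp_thms ball_empty)
  then show ?thesis
    by (cases "even (n - s - t - l)")
      (simp_all only: hyp_relators_def hyp_relations_def ball_Un even_relation_def odd_relation_def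
        pw cm ev wf wpow_words ball_simps simp_thms if_True if_False)
qed

lemma hyp_relators_words: "r \<in> hyp_relators n s t l \<Longrightarrow> r \<in> words {0, 1, 2}"
  by (auto simp: hyp_relators_def base_relators_def split: if_splits)

lemma hyp_group_is_group: "group (hyp_group n s t l)"
  by (simp add: hyp_group_def presented_group_is_group)

lemma hyp_gen_closed: "i \<in> {0, 1, 2} \<Longrightarrow> hyp_gen n s t l i \<in> carrier (hyp_group n s t l)"
  unfolding hyp_gen_def hyp_group_def by (rule funcset_mem[OF pres_gen_closed])

lemma generate_hyp_gen:
  "generate (hyp_group n s t l) (hyp_gen n s t l ` {0, 1, 2}) = carrier (hyp_group n s t l)"
  unfolding hyp_gen_def hyp_group_def by (rule generate_pres_gen)

lemma hyp_gen_relations: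
  "hyp_relations (hyp_group n s t l) n s t l
    (hyp_gen n s t l 0) (hyp_gen n s t l 1) (hyp_gen n s t l 2)"
proof -
  interpret group "hyp_group n s t l" by (rule hyp_group_is_group)
  have "weval (hyp_group n s t l) (hyp_gen n s t l) r = \<one>\<^bsub>hyp_group n s t l\<^esub>"
    if "r \<in> hyp_relators n s t l" for r
    using weval_relator[OF that hyp_relators_words[OF that]]
    by (simp add: hyp_group_def hyp_gen_def)
  then show ?thesis
    using weval_hyp_relators[of "hyp_gen n s t l"] hyp_gen_closed by blast
qed

lemma hyp_group_universal:
  assumes "group H" and cl: "a \<in> carrier H" "b \<in> carrier H" "c \<in> carrier H"
    and rel: "hyp_relations H n s t l a b c"
  obtains h where "h \<in> hom (hyp_group n s t l) H"
    "h (hyp_gen n s t l 0) = a" "h (hyp_gen n s t l 1) = b" "h (hyp_gen n s t l 2) = c"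
proof -
  interpret H: group H by fact
  define f where "f i = (if i = 0 then a else if i = 1 then b else c)" for i :: nat
  have f: "f \<in> {0, 1, 2} \<rightarrow> carrier H" using cl by (auto simp: f_def)
  have "\<forall>r\<in>hyp_relators n s t l. weval H f r = \<one>\<^bsub>H\<^esub>"
    using rel by (simp add: H.weval_hyp_relators[OF f]) (simp add: f_def)
  then obtain h where "h \<in> hom (hyp_group n s t l) H"
    "\<And>i. i \<in> {0, 1, 2} \<Longrightarrow> h (hyp_gen n s t l i) = f i"
    using presented_group_universal[OF \<open>group H\<close> f, of "hyp_relators n s t l"]
    unfolding hyp_group_def hyp_gen_def by blast
  then show ?thesis using that[of h] by (simp add: f_def)
qed

section \<open>The normal subgroup of commuting rotations\<close>

context group
begin

lemma int_pow_integer_mod_hom: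
  assumes "g \<in> carrier G" "g [^] r = \<one>"
  shows "(\<lambda>i. g [^] i) \<in> hom (integer_mod_group r) G"
  using assms by (intro homI) (simp_all add: int_pow_mod int_pow_mult)

lemma involution_cancel:
  "a \<in> carrier G \<Longrightarrow> a \<otimes> a = \<one> \<Longrightarrow> u \<in> carrier G \<Longrightarrow> a \<otimes> (a \<otimes> u) = u"
  by (simp flip: m_assoc)

lemma involution_inverts_pow:
  assumes "p \<in> carrier G" "p \<otimes> p = \<one>" "q \<in> carrier G" "q \<otimes> q = \<one>"
  shows "p \<otimes> (p \<otimes> q) [^] (k::nat) \<otimes> inv p = inv ((p \<otimes> q) [^] k)"
    and "q \<otimes> (p \<otimes> q) [^] k \<otimes> inv q = inv ((p \<otimes> q) [^] k)"
proof -
  have "p \<otimes> (p \<otimes> q) \<otimes> inv p = inv (p \<otimes> q)" "q \<otimes> (p \<otimes> q) \<otimes> inv q = inv (p \<otimes> q)"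
    using assms by (simp_all add: inv_mult_group inv_involution m_assoc involution_cancel)
  then show "p \<otimes> (p \<otimes> q) [^] k \<otimes> inv p = inv ((p \<otimes> q) [^] k)"
    and "q \<otimes> (p \<otimes> q) [^] k \<otimes> inv q = inv ((p \<otimes> q) [^] k)"
    using assms(1,3) by (simp_all only: nat_pow_conj nat_pow_inv m_closed)
qed

text \<open>Inverting twice is the identity, so \<open>g^2\<close> centralises \<open>y\<close>, and
  with it all even powers of \<open>g\<close>.\<close>

lemma even_pow_commutes:
  fixes k :: nat
  assumes cl: "g \<in> carrier G" "y \<in> carrier G" and inv: "g \<otimes> y \<otimes> inv g = inv y"
  shows "g [^] (2 * k) \<otimes> y = y \<otimes> g [^] (2 * k)"
proof -
  have "g \<otimes> inv y \<otimes> inv g = inv (g \<otimes> y \<otimes> inv g)"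
    using cl by (simp add: inv_mult_group m_assoc)
  then have inv': "g \<otimes> inv y = y \<otimes> g" using cl inv by (simp add: inv_solve_right')
  have "g \<otimes> g \<otimes> y = g \<otimes> (g \<otimes> y \<otimes> inv g) \<otimes> g" using cl by (simp add: m_assoc)
  also have "\<dots> = y \<otimes> (g \<otimes> g)" using cl by (simp add: inv inv' m_assoc)
  finally have "(g [^] (2::nat)) \<otimes> y = y \<otimes> (g [^] (2::nat))" using cl by (simp add: pow_two)
  then show ?thesis using cl by (simp add: group_commutes_pow flip: nat_pow_pow)
qed

end

locale hyp_relators_group = group G for G (structure) +
  fixes a b c :: 'a and s t l :: nat
  assumes closed [simp]: "a \<in> carrier G" "b \<in> carrier G" "c \<in> carrier G"
    and gen: "generate G {a, b, c} = carrier G"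
    and rel: "base_relations G s t l a b c"
    and st: "s \<ge> 2" "t \<ge> 2" "l \<ge> 1"
begin

lemma invol: "a \<otimes> a = \<one>" "b \<otimes> b = \<one>" "c \<otimes> c = \<one>"
  using rel by (auto simp: base_relations_def)

lemma inv_gens [simp]: "inv a = a" "inv b = b" "inv c = c"
  using invol by (simp_all add: inv_involution)

definition x where "x = (a \<otimes> b) [^] (4::nat)"
definition y where "y = (b \<otimes> c) [^] (4::nat)"
definition z where "z = (a \<otimes> c) [^] (2::nat)"

lemma xyz_closed [simp]: "x \<in> carrier G" "y \<in> carrier G" "z \<in> carrier G"
  by (simp_all add: x_def y_def z_def)

lemma xyz_pow: "x [^] ((2::nat) ^ (s - 2)) = \<one>" "y [^] ((2::nat) ^ (t - 2)) = \<one>"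
  "z [^] ((2::nat) ^ (l - 1)) = \<one>"
proof -
  have four: "4 * 2 ^ (u - 2) = (2::nat) ^ u" if u: "u \<ge> 2" for u
  proof -
    obtain v where "u = 2 + v" using le_Suc_ex[OF u] by blast
    then show ?thesis by (simp add: power_add)
  qed
  have "2 * 2 ^ (l - 1) = (2::nat) ^ l"
    using st power_Suc[of "2::nat" "l - 1"] by simp
  then show "x [^] ((2::nat) ^ (s - 2)) = \<one>" "y [^] ((2::nat) ^ (t - 2)) = \<one>"
    "z [^] ((2::nat) ^ (l - 1)) = \<one>"
    using rel four st by (simp_all add: x_def y_def z_def nat_pow_pow base_relations_def)
qed

text \<open>Two of the generators are reflections of the dihedral group in which \<open>x\<close> is
  a rotation, hence invert it; the third commutes with \<open>x\<close> by a commutator relator. The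
  same pattern gives \<open>conj_y\<close> and \<open>conj_z\<close>.\<close>

lemma conj_x: "a \<otimes> x \<otimes> inv a = inv x" "b \<otimes> x \<otimes> inv b = inv x" "c \<otimes> x \<otimes> inv c = x"
proof -
  show "a \<otimes> x \<otimes> inv a = inv x" "b \<otimes> x \<otimes> inv b = inv x"
    unfolding x_def by (rule involution_inverts_pow; simp add: invol)+
  have "c \<otimes> x = x \<otimes> c" using rel by (simp add: base_relations_def x_def)
  then show "c \<otimes> x \<otimes> inv c = x" by (simp add: m_assoc invol)
qed

lemma conj_y: "a \<otimes> y \<otimes> inv a = y" "b \<otimes> y \<otimes> inv b = inv y" "c \<otimes> y \<otimes> inv c = inv y"
proof -
  show "b \<otimes> y \<otimes> inv b = inv y" "c \<otimes> y \<otimes> inv c = inv y"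
    unfolding y_def by (rule involution_inverts_pow; simp add: invol)+
  have "a \<otimes> y = y \<otimes> a" using rel by (simp add: base_relations_def y_def)
  then show "a \<otimes> y \<otimes> inv a = y" by (simp add: m_assoc invol)
qed

lemma conj_z: "a \<otimes> z \<otimes> inv a = inv z" "b \<otimes> z \<otimes> inv b = z" "c \<otimes> z \<otimes> inv c = inv z"
proof -
  show "a \<otimes> z \<otimes> inv a = inv z" "c \<otimes> z \<otimes> inv c = inv z"
    unfolding z_def by (rule involution_inverts_pow; simp add: invol)+
  have "b \<otimes> z = z \<otimes> b" using rel by (simp add: base_relations_def z_def)
  then show "b \<otimes> z \<otimes> inv b = z" by (simp add: m_assoc invol)
qed

lemma conj_mult: "u \<in> carrier G \<Longrightarrow> v \<in> carrier G \<Longrightarrow> w \<in> carrier G \<Longrightarrow>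
    u \<otimes> v \<otimes> w \<otimes> inv (u \<otimes> v) = u \<otimes> (v \<otimes> w \<otimes> inv v) \<otimes> inv u"
  by (simp add: inv_mult_group m_assoc)

lemma conj_inv: "u \<in> carrier G \<Longrightarrow> w \<in> carrier G \<Longrightarrow> u \<otimes> inv w \<otimes> inv u = inv (u \<otimes> w \<otimes> inv u)"
  by (simp add: inv_mult_group m_assoc)

lemma xyz_commute: "x \<otimes> y = y \<otimes> x" "x \<otimes> z = z \<otimes> x" "y \<otimes> z = z \<otimes> y"
proof -
  \<comment> \<open>In each product exactly one factor inverts the element and the other fixes it.
    Since \<open>x\<close> and \<open>y\<close> are fourth powers of these products,
    \<open>even_pow_commutes\<close> applies with exponent 2 * 2.\<close>
  have "(a \<otimes> b) \<otimes> y \<otimes> inv (a \<otimes> b) = inv y" "(a \<otimes> b) \<otimes> z \<otimes> inv (a \<otimes> b) = inv z"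
    "(b \<otimes> c) \<otimes> z \<otimes> inv (b \<otimes> c) = inv z"
    by (simp_all only: conj_mult closed xyz_closed conj_inv conj_y conj_z inv_inv)
  then show "x \<otimes> y = y \<otimes> x" "x \<otimes> z = z \<otimes> x" "y \<otimes> z = z \<otimes> y"
    using even_pow_commutes[of "a \<otimes> b" y 2] even_pow_commutes[of "a \<otimes> b" z 2]
      even_pow_commutes[of "b \<otimes> c" z 2]
    by (simp_all add: x_def[symmetric] y_def[symmetric])
qed

abbreviation "C_N \<equiv> integer_mod_group (2 ^ (s - 2)) \<times>\<times> integer_mod_group (2 ^ (t - 2))
  \<times>\<times> integer_mod_group (2 ^ (l - 1))"

text \<open>The candidate isomorphism from the product of cyclic groups onto \<open>N\<close>. That
  it is a homomorphism bounds the size of \<open>N\<close> from above; injectivity has to wait for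
  the dihedral quotients.\<close>

definition eta where "eta = (\<lambda>(i::int, j::int, k::int). x [^] i \<otimes> (y [^] j \<otimes> z [^] k))"

lemma int_pow_commute:
  assumes "u \<in> carrier G" "v \<in> carrier G" "u \<otimes> v = v \<otimes> u"
  shows "u [^] (i::int) \<otimes> v [^] (j::int) = v [^] j \<otimes> u [^] i"
proof -
  have "u \<otimes> v \<otimes> inv u = v" using assms by (simp add: inv_solve_right')
  then have "u \<otimes> v [^] j \<otimes> inv u = v [^] j" using assms by (simp add: int_pow_conj)
  then have "u \<otimes> v [^] j = v [^] j \<otimes> u" using assms(1,2) by (simp add: inv_solve_right')
  then have "v [^] j \<otimes> u \<otimes> inv (v [^] j) = u"
    using assms(1,2) by (metis int_pow_closed inv_solve_right' m_closed)
  then have "v [^] j \<otimes> u [^] i \<otimes> inv (v [^] j) = u [^] i" using assms by (simp add: int_pow_conj)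
  then show ?thesis using assms(1,2) by (metis int_pow_closed inv_solve_right' m_closed)
qed

lemma eta_hom: "eta \<in> hom C_N G"
proof -
  have yz: "(\<lambda>(j, k). y [^] j \<otimes> z [^] k) \<in>
      hom (integer_mod_group (2 ^ (t - 2)) \<times>\<times> integer_mod_group (2 ^ (l - 1))) G"
    by (intro DirProd_lift_hom int_pow_integer_mod_hom xyz_pow int_pow_commute xyz_commute) simp_all
  have "(\<lambda>(i, u). x [^] i \<otimes> (\<lambda>(j, k). y [^] j \<otimes> z [^] k) u) \<in> hom C_N G"
  proof (rule DirProd_lift_hom[OF int_pow_integer_mod_hom[OF _ xyz_pow(1)] yz])
    fix i :: int and u :: "int \<times> int"
    obtain j k where u: "u = (j, k)" by force
    have "x [^] i \<otimes> (y [^] j \<otimes> z [^] k) = (x [^] i \<otimes> y [^] j) \<otimes> z [^] k" by (simp add: m_assoc)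
    also have "\<dots> = y [^] j \<otimes> (x [^] i \<otimes> z [^] k)"
      by (simp add: int_pow_commute[of x y] xyz_commute m_assoc)
    also have "\<dots> = y [^] j \<otimes> z [^] k \<otimes> x [^] i"
      by (simp add: int_pow_commute[of x z] xyz_commute m_assoc)
    finally show "x [^] i \<otimes> (case u of (j, k) \<Rightarrow> y [^] j \<otimes> z [^] k) =
        (case u of (j, k) \<Rightarrow> y [^] j \<otimes> z [^] k) \<otimes> x [^] i" by (simp add: u)
  qed simp_all
  moreover have "(\<lambda>(i, u). x [^] i \<otimes> (\<lambda>(j, k). y [^] j \<otimes> z [^] k) u) = eta"
    by (auto simp: eta_def)
  ultimately show ?thesis by simp
qed

definition N where "N = eta ` carrier C_N"

lemma group_C_N: "group C_N"
  by (intro DirProd_group) simp_all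

lemma N_subgroup: "subgroup N G"
proof -
  interpret group_hom C_N G eta
    using eta_hom group_C_N by (simp add: group_hom_def group_hom_axioms_def)
  show ?thesis unfolding N_def by (rule img_is_subgroup)
qed

lemma eta_in_N: "eta (i, j, k) \<in> N"
proof -
  have "eta (i, j, k) = eta (i mod int (2 ^ (s - 2)), j mod int (2 ^ (t - 2)), k mod int (2 ^ (l - 1)))"
    unfolding eta_def prod.case int_pow_mod[OF xyz_closed(1) xyz_pow(1)]
      int_pow_mod[OF xyz_closed(2) xyz_pow(2)] int_pow_mod[OF xyz_closed(3) xyz_pow(3)] ..
  then show ?thesis by (auto simp: N_def carrier_integer_mod_group)
qed

lemma xyz_in_N: "x \<in> N" "y \<in> N" "z \<in> N"
  using eta_in_N[of 1 0 0] eta_in_N[of 0 1 0] eta_in_N[of 0 0 1] by (simp_all add: eta_def)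

text \<open>Conjugation by a generator sends each of \<open>x\<close>, \<open>y\<close>,
  \<open>z\<close> to itself or its inverse, so it maps their products back into \<open>N\<close>.
  The set \<open>?T\<close> of elements conjugating \<open>N\<close> into itself is closed under
  products.\<close>

lemma N_normal: "N \<lhd> G"
proof -
  let ?T = "{g \<in> carrier G. \<forall>h\<in>N. g \<otimes> h \<otimes> inv g \<in> N}"
  have N: "n \<in> carrier G" if "n \<in> N" for n using subgroup.mem_carrier[OF N_subgroup that] .
  note Ninv = subgroup.m_inv_closed[OF N_subgroup] and Nm = subgroup.m_closed[OF N_subgroup]
  have gens: "g \<in> ?T" if "g \<in> {a, b, c}" for g
  proof -
    have g: "g \<in> carrier G" using that by auto
    have xyz: "g \<otimes> x \<otimes> inv g \<in> N" "g \<otimes> y \<otimes> inv g \<in> N" "g \<otimes> z \<otimes> inv g \<in> N"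
      using that
      by (elim insertE emptyE; simp only: conj_x conj_y conj_z xyz_in_N Ninv)+
    have "g \<otimes> eta (i, j, k) \<otimes> inv g \<in> N" for i j k
    proof -
      have "g \<otimes> eta (i, j, k) \<otimes> inv g = (g \<otimes> x [^] i \<otimes> inv g) \<otimes>
          ((g \<otimes> y [^] j \<otimes> inv g) \<otimes> (g \<otimes> z [^] k \<otimes> inv g))"
        using hom_mult[OF conj_hom[OF g]] by (simp add: eta_def)
      then show ?thesis
        using g xyz by (simp add: int_pow_conj Nm subgroup_int_pow_closed[OF N_subgroup])
    qed
    then show ?thesis using g by (auto simp: N_def)
  qed
  have "g \<in> ?T" if "g \<in> generate G {a, b, c}" for g
    using that
  proof induction
    case one
    show ?case using N by simp
  next
    case (incl h)
    then show ?case by (rule gens)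
  next
    case (inv h)
    \<comment> \<open>\<open>?T\<close> is not visibly closed under inverses, but the generators are
      their own inverses.\<close>
    then have "inv h = h" by auto
    then show ?case using gens[OF inv] by simp
  next
    case (eng g h)
    then show ?case by (auto simp: conj_mult N)
  qed
  then show ?thesis using N_subgroup gen by (simp add: normal_inv_iff)
qed

end

text \<open>The composite of \<open>\<pi>\<close> and \<open>\<psi>\<close> agrees with the
  projection to \<open>G Mod N\<close> on generators, hence everywhere; whatever
  \<open>\<pi>\<close> kills is therefore killed by the projection.\<close>

lemma kernel_eq_normal:
  assumes "group G" "group Q" and pi: "\<pi> \<in> hom G Q" and N: "N \<lhd> G" "N \<subseteq> kernel G Q \<pi>"
    and psi: "\<psi> \<in> hom Q (G Mod N)" and S: "S \<subseteq> carrier G" "generate G S = carrier G"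
    and eq: "\<And>g. g \<in> S \<Longrightarrow> \<psi> (\<pi> g) = N #>\<^bsub>G\<^esub> g"
  shows "kernel G Q \<pi> = N"
proof
  interpret G: group G by fact
  interpret N: normal N G by fact
  have grp: "group (G Mod N)" by (rule N.factorgroup_is_group)
  have hom: "\<psi> \<circ> \<pi> \<in> hom G (G Mod N)" using hom_compose[OF pi psi] .
  have all: "\<psi> (\<pi> g) = N #>\<^bsub>G\<^esub> g" if "g \<in> carrier G" for g
    using G.hom_eq_on_generate[OF grp hom N.r_coset_hom_Mod S(1), of g] eq that S(2) by simp
  show "kernel G Q \<pi> \<subseteq> N"
  proof
    fix g assume g: "g \<in> kernel G Q \<pi>"
    then have "N #>\<^bsub>G\<^esub> g = \<psi> \<one>\<^bsub>Q\<^esub>" using all[of g] by (simp add: kernel_def)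
    also have "\<dots> = N" using hom_one[OF psi \<open>group Q\<close> grp] by simp
    finally show "g \<in> N" using g G.rcos_self[OF _ N.subgroup_axioms, of g] by (simp add: kernel_def)
  qed
qed (use N in simp)

section \<open>The toroidal quotients\<close>

context group
begin

lemma dihedral_lift_closed [simp]:
  "p \<in> carrier G \<Longrightarrow> q \<in> carrier G \<Longrightarrow> dihedral_lift G p q u \<in> carrier G"
  by (simp add: dihedral_lift_def split: prod.split)

text \<open>If \<open>g\<close> carries the pair \<open>(p, q)\<close> to \<open>(p', q')\<close>,
  it carries one lift to the other. The case of equal pairs says that \<open>g\<close> commutes with
  the lift, which is applied twice in \<open>dihedral_lift_commute\<close>.\<close>

lemma dihedral_lift_conj:
  assumes g: "g \<in> carrier G" and p: "p \<in> carrier G" "p' \<in> carrier G" "g \<otimes> p = p' \<otimes> g"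
    and q: "q \<in> carrier G" "q' \<in> carrier G" "g \<otimes> q = q' \<otimes> g"
  shows "g \<otimes> dihedral_lift G p q u = dihedral_lift G p' q' u \<otimes> g"
proof -
  obtain i x where u: "u = (i, x)" by force
  have "g \<otimes> (p \<otimes> q) = (g \<otimes> p) \<otimes> q" using g p(1) q(1) by (simp add: m_assoc)
  also have "\<dots> = p' \<otimes> (g \<otimes> q)" using g p q(1) by (simp add: m_assoc)
  also have "\<dots> = (p' \<otimes> q') \<otimes> g" using g p(1,2) q by (simp add: m_assoc)
  finally have "g \<otimes> (p \<otimes> q) \<otimes> inv g = p' \<otimes> q'"
    using g p q by (metis inv_solve_right' m_closed)
  then have "g \<otimes> (p \<otimes> q) [^] i \<otimes> inv g = (p' \<otimes> q') [^] i"
    using g p q by (simp add: int_pow_conj)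
  then have pw: "g \<otimes> (p \<otimes> q) [^] i = (p' \<otimes> q') [^] i \<otimes> g"
    using g p q by (metis inv_solve_right' m_closed int_pow_closed)
  have "g \<otimes> ((p \<otimes> q) [^] i \<otimes> p) = (g \<otimes> (p \<otimes> q) [^] i) \<otimes> p"
    using g p q by (simp add: m_assoc)
  also have "\<dots> = (p' \<otimes> q') [^] i \<otimes> (g \<otimes> p)"
    unfolding pw using g p(1,2) q by (simp add: m_assoc)
  also have "\<dots> = (p' \<otimes> q') [^] i \<otimes> p' \<otimes> g"
    using g p q by (simp add: m_assoc)
  finally show ?thesis using g p(1,2) q(1,2) pw by (simp add: dihedral_lift_def u)
qed

lemma dihedral_lift_commute:
  assumes cl: "p \<in> carrier G" "q \<in> carrier G" "p' \<in> carrier G" "q' \<in> carrier G"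
    and "p \<otimes> p' = p' \<otimes> p" "p \<otimes> q' = q' \<otimes> p" "q \<otimes> p' = p' \<otimes> q" "q \<otimes> q' = q' \<otimes> q"
  shows "dihedral_lift G p q u \<otimes> dihedral_lift G p' q' v =
    dihedral_lift G p' q' v \<otimes> dihedral_lift G p q u"
  using assms
  by (intro dihedral_lift_conj dihedral_lift_conj[symmetric] dihedral_lift_closed) simp_all

end

lemma hom_dihedral_lift:
  assumes "group G" "group H" "h \<in> hom G H" "p \<in> carrier G" "q \<in> carrier G"
  shows "h (dihedral_lift G p q u) = dihedral_lift H (h p) (h q) u"
proof -
  interpret group_hom G H h using assms by (simp add: group_hom_def group_hom_axioms_def)
  show ?thesis using assms(4,5) by (simp add: dihedral_lift_def hom_int_pow split: prod.split)
qed

definition swap_by :: "('d \<Rightarrow> 'd) \<Rightarrow> 'd \<times> 'd \<Rightarrow> 'd \<times> 'd"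
  where "swap_by \<theta> = (\<lambda>(u, v). (\<theta> v, \<theta> u))"

definition swap_action :: "('d, 'e) monoid_scheme \<Rightarrow> int \<Rightarrow> 'd \<times> 'd \<Rightarrow> 'd \<times> 'd"
  where "swap_action D e =
    restrict (if e = 0 then id else swap_by id) (carrier (D \<times>\<times> D))"

text \<open>The first factor is the plain exchange of coordinates, the second the exchange twisted
  by \<open>\<theta>\<close>. They commute, their product being \<open>\<theta>\<close> on both
  coordinates, and they are involutions when \<open>\<theta>\<close> is.\<close>

definition klein_action ::
    "('d, 'e) monoid_scheme \<Rightarrow> ('d \<Rightarrow> 'd) \<Rightarrow> int \<times> int \<Rightarrow> 'd \<times> 'd \<Rightarrow> 'd \<times> 'd"
  where "klein_action D \<theta> = (\<lambda>(e, f).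
    restrict ((if e = 0 then id else swap_by id) \<circ> (if f = 0 then id else swap_by \<theta>))
      (carrier (D \<times>\<times> D)))"

lemma swap_by_hom: "\<theta> \<in> hom D D \<Longrightarrow> swap_by \<theta> \<in> hom (D \<times>\<times> D) (D \<times>\<times> D)"
  by (rule homI) (auto simp: swap_by_def hom_mult intro: hom_in_carrier)

lemma id_hom: "id \<in> hom D D"
  by (simp add: hom_def)

lemma swap_action_hom:
  assumes "group D"
  shows "swap_action D \<in> hom (integer_mod_group 2) (AutoGroup (D \<times>\<times> D))"
proof -
  have "(\<lambda>e. restrict ((\<lambda>e::int. if e = 0 then id else swap_by id) e) (carrier (D \<times>\<times> D)))
      \<in> hom (integer_mod_group 2) (AutoGroup (D \<times>\<times> D))"
  proof (rule restrict_action_hom)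
    show "(if e = 0 then id else swap_by id) \<in> hom (D \<times>\<times> D) (D \<times>\<times> D)" for e :: int
      using swap_by_hom[OF id_hom] id_hom by auto
  qed (auto simp: DirProd_group assms carrier_C2 swap_by_def)
  then show ?thesis by (simp add: swap_action_def[abs_def])
qed

lemma klein_action_hom:
  assumes "group D" and hom: "\<theta> \<in> hom D D" and invol: "\<And>u. u \<in> carrier D \<Longrightarrow> \<theta> (\<theta> u) = u"
  shows "klein_action D \<theta> \<in>
    hom (integer_mod_group 2 \<times>\<times> integer_mod_group 2) (AutoGroup (D \<times>\<times> D))"
proof -
  let ?act = "\<lambda>(e::int, f::int).
    (if e = 0 then id else swap_by id) \<circ> (if f = 0 then id else swap_by \<theta>)"
  have "(\<lambda>x. restrict (?act x) (carrier (D \<times>\<times> D)))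
      \<in> hom (integer_mod_group 2 \<times>\<times> integer_mod_group 2) (AutoGroup (D \<times>\<times> D))"
  proof (rule restrict_action_hom)
    show "?act x \<in> hom (D \<times>\<times> D) (D \<times>\<times> D)" for x
      using swap_by_hom[OF id_hom] swap_by_hom[OF hom] id_hom
      by (auto intro: hom_compose split: prod.split)
  qed (auto simp: DirProd_group assms carrier_C2 swap_by_def)
  moreover have "klein_action D \<theta> = (\<lambda>x. restrict (?act x) (carrier (D \<times>\<times> D)))"
    by (auto simp: klein_action_def fun_eq_iff)
  ultimately show ?thesis by simp
qed

text \<open>The Coxeter relations of the square tiling with Schlaefli symbol {4,4}; they are what
  remains of the base relations when \<open>x\<close>, \<open>y\<close>, \<open>z\<close> become
  trivial.\<close>

definition core_relations :: "('g, 'c) monoid_scheme \<Rightarrow> 'g \<Rightarrow> 'g \<Rightarrow> 'g \<Rightarrow> bool"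
  where "core_relations G a b c \<longleftrightarrow>
    a \<otimes>\<^bsub>G\<^esub> a = \<one>\<^bsub>G\<^esub> \<and> b \<otimes>\<^bsub>G\<^esub> b = \<one>\<^bsub>G\<^esub> \<and> c \<otimes>\<^bsub>G\<^esub> c = \<one>\<^bsub>G\<^esub> \<and>
    (a \<otimes>\<^bsub>G\<^esub> b) [^]\<^bsub>G\<^esub> (4::nat) = \<one>\<^bsub>G\<^esub> \<and> (b \<otimes>\<^bsub>G\<^esub> c) [^]\<^bsub>G\<^esub> (4::nat) = \<one>\<^bsub>G\<^esub> \<and>
    (a \<otimes>\<^bsub>G\<^esub> c) [^]\<^bsub>G\<^esub> (2::nat) = \<one>\<^bsub>G\<^esub>"

lemma (in group) pow_four: "x \<in> carrier G \<Longrightarrow> x [^] (4::nat) = x \<otimes> x \<otimes> (x \<otimes> x)"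
  using nat_pow_mult[of x 2 2] by (simp add: pow_two)

lemma (in group) pow_dvd_eq_one: "x \<in> carrier G \<Longrightarrow> x [^] (k::nat) = \<one> \<Longrightarrow> k dvd m \<Longrightarrow> x [^] m = \<one>"
  by (auto simp: dvd_def simp flip: nat_pow_pow)

lemma (in group) core_imp_base_relations:
  assumes cl: "a \<in> carrier G" "b \<in> carrier G" "c \<in> carrier G" and core: "core_relations G a b c"
    and st: "s \<ge> 2" "t \<ge> 2" "l \<ge> 1"
  shows "base_relations G s t l a b c"
proof -
  have "(4::nat) dvd 2 ^ s" "(4::nat) dvd 2 ^ t" "(2::nat) dvd 2 ^ l"
    using st le_imp_power_dvd[of 2 s "2::nat"] le_imp_power_dvd[of 2 t "2::nat"] by auto
  then show ?thesis
    using cl core by (auto simp: core_relations_def base_relations_def intro: pow_dvd_eq_one)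
qed

locale toroidal = group G for G (structure) +
  fixes a b c :: 'a
  assumes closed [simp]: "a \<in> carrier G" "b \<in> carrier G" "c \<in> carrier G"
    and core: "core_relations G a b c"
begin

lemma invol [simp]: "a \<otimes> a = \<one>" "b \<otimes> b = \<one>" "c \<otimes> c = \<one>"
  using core by (auto simp: core_relations_def)

lemmas cancel [simp] = involution_cancel[OF closed(1) invol(1)]
  involution_cancel[OF closed(2) invol(2)] involution_cancel[OF closed(3) invol(3)]

lemma inv_gens [simp]: "inv a = a" "inv b = b" "inv c = c"
  by (simp_all add: inv_involution)

text \<open>An involution equals its inverse, applied to \<open>ac\<close>, \<open>(ab)^2\<close>
  and \<open>(bc)^2\<close>. Each rule replaces a word by a lexicographically smaller one of the
  same length, so together with the cancellations they serve as a rewrite system.\<close>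

lemma braid:
  "c \<otimes> a = a \<otimes> c"
  "b \<otimes> (a \<otimes> (b \<otimes> a)) = a \<otimes> (b \<otimes> (a \<otimes> b))"
  "c \<otimes> (b \<otimes> (c \<otimes> b)) = b \<otimes> (c \<otimes> (b \<otimes> c))"
proof -
  have "(a \<otimes> c) \<otimes> (a \<otimes> c) = \<one>" using core by (simp add: core_relations_def pow_two)
  then show "c \<otimes> a = a \<otimes> c"
    using inv_involution[of "a \<otimes> c"] by (simp add: inv_mult_group)
  have "((a \<otimes> b) \<otimes> (a \<otimes> b)) \<otimes> ((a \<otimes> b) \<otimes> (a \<otimes> b)) = \<one>"
    using core by (simp add: core_relations_def pow_four)
  then show "b \<otimes> (a \<otimes> (b \<otimes> a)) = a \<otimes> (b \<otimes> (a \<otimes> b))"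
    using inv_involution[of "(a \<otimes> b) \<otimes> (a \<otimes> b)"] by (simp add: inv_mult_group m_assoc)
  have "((b \<otimes> c) \<otimes> (b \<otimes> c)) \<otimes> ((b \<otimes> c) \<otimes> (b \<otimes> c)) = \<one>"
    using core by (simp add: core_relations_def pow_four)
  then show "c \<otimes> (b \<otimes> (c \<otimes> b)) = b \<otimes> (c \<otimes> (b \<otimes> c))"
    using inv_involution[of "(b \<otimes> c) \<otimes> (b \<otimes> c)"] by (simp add: inv_mult_group m_assoc)
qed

text \<open>The same rules in front of a further factor, as they occur inside products associated to
  the right.\<close>

lemma braid':
  assumes "u \<in> carrier G"
  shows "c \<otimes> (a \<otimes> u) = a \<otimes> (c \<otimes> u)"
    "b \<otimes> (a \<otimes> (b \<otimes> (a \<otimes> u))) = a \<otimes> (b \<otimes> (a \<otimes> (b \<otimes> u)))"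
    "c \<otimes> (b \<otimes> (c \<otimes> (b \<otimes> u))) = b \<otimes> (c \<otimes> (b \<otimes> (c \<otimes> u)))"
  using assms braid[THEN arg_cong[where f = "\<lambda>v. v \<otimes> u"]] by (simp_all add: m_assoc)

lemmas normalize = m_assoc braid braid'

text \<open>
  In the even case the reflections in the sides of the square tiling generate a product of two
  dihedral groups: \<open>a\<close>, \<open>bcb\<close> are perpendicular to \<open>bab\<close>, \<open>c\<close>, and \<open>b\<close> swaps the two directions.
\<close>

lemma even_lift:
  assumes k: "k > 0" and rel: "even_relation G k a b c"
  defines "D \<equiv> dihedral_group (2 * (2 * k))"
  obtains \<psi> where "\<psi> \<in> hom (semidirect (D \<times>\<times> D) (integer_mod_group 2) (swap_action D)) G"
    "\<psi> ((dihP, \<one>\<^bsub>D\<^esub>), 0) = a" "\<psi> ((\<one>\<^bsub>D\<^esub>, \<one>\<^bsub>D\<^esub>), 1) = b" "\<psi> ((\<one>\<^bsub>D\<^esub>, dihQ (2 * k)), 0) = c"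
proof -
  interpret D: dihedral "2 * k" using k by unfold_locales simp
  define p1 q1 p2 q2 where "p1 = a" and "q1 = b \<otimes> (c \<otimes> b)" and "p2 = b \<otimes> (a \<otimes> b)" and "q2 = c"
  note defs = p1_def q1_def p2_def q2_def
  have cl [simp]: "p1 \<in> carrier G" "q1 \<in> carrier G" "p2 \<in> carrier G" "q2 \<in> carrier G"
    by (simp_all add: defs)
  have inv12: "p1 \<otimes> p1 = \<one>" "q1 \<otimes> q1 = \<one>" "p2 \<otimes> p2 = \<one>" "q2 \<otimes> q2 = \<one>"
    by (simp_all add: defs normalize)
  have comm: "p1 \<otimes> p2 = p2 \<otimes> p1" "p1 \<otimes> q2 = q2 \<otimes> p1" "q1 \<otimes> p2 = p2 \<otimes> q1" "q1 \<otimes> q2 = q2 \<otimes> q1"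
    by (simp_all add: defs normalize)
  have "inv ((a \<otimes> b) [^] (2::nat)) = (a \<otimes> b) [^] (2::nat)"
    by (rule inv_involution) (simp_all add: pow_two normalize)
  \<comment> \<open>\<open>(ab)^2\<close> is \<open>p1 p2\<close>, where \<open>p1\<close> commutes
    with \<open>p2\<close> and with \<open>q2 = c\<close>. So \<open>p1\<close> cancels from the
    commutator and \<open>p2 q2 p2 q2\<close> remains.\<close>
  then have "gcomm G ((a \<otimes> b) [^] (2::nat)) c = (p2 \<otimes> q2) [^] (2::nat)"
    by (simp add: gcomm_def pow_two defs normalize)
  then have pq2: "(p2 \<otimes> q2) [^] (2 * k) = \<one>"
    using rel by (simp add: even_relation_def nat_pow_pow)
  \<comment> \<open>\<open>b\<close> exchanges the two directions, so the order bound carries over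
    to the other one.\<close>
  have "p1 \<otimes> q1 = b \<otimes> (p2 \<otimes> q2) \<otimes> inv b" by (simp add: defs normalize)
  then have pq1: "(p1 \<otimes> q1) [^] (2 * k) = \<one>"
    using nat_pow_conj[of b "p2 \<otimes> q2" "2 * k"] pq2 by simp
  define f1 f2 where "f1 = dihedral_lift G p1 q1" and "f2 = dihedral_lift G p2 q2"
  have f1: "f1 \<in> hom D G" "f1 dihP = p1" "f1 (dihQ (2 * k)) = q1"
    and f2: "f2 \<in> hom D G" "f2 dihP = p2" "f2 (dihQ (2 * k)) = q2"
    unfolding f1_def f2_def D_def
    using dihedral_lift_hom[OF D.r_pos cl(1) inv12(1) cl(2) inv12(2) pq1]
      dihedral_lift_hom[OF D.r_pos cl(3) inv12(3) cl(4) inv12(4) pq2]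
      dihedral_lift_P[OF D.r_pos cl(1) inv12(1) cl(2) inv12(2) pq1]
      dihedral_lift_P[OF D.r_pos cl(3) inv12(3) cl(4) inv12(4) pq2]
      dihedral_lift_Q[OF D.r_pos cl(1) inv12(1) cl(2) inv12(2) pq1]
      dihedral_lift_Q[OF D.r_pos cl(3) inv12(3) cl(4) inv12(4) pq2] by simp_all
  have fcl [simp]: "f1 u \<in> carrier G" "f2 u \<in> carrier G" for u
    by (simp_all add: f1_def f2_def)
  have one: "f1 \<one>\<^bsub>D\<^esub> = \<one>" "f2 \<one>\<^bsub>D\<^esub> = \<one>"
    unfolding D_def using hom_one[OF f1(1)[unfolded D_def] D.is_group is_group]
      hom_one[OF f2(1)[unfolded D_def] D.is_group is_group] by auto
  have fcomm: "f1 u \<otimes> f2 v = f2 v \<otimes> f1 u" for u v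
    unfolding f1_def f2_def using comm by (intro dihedral_lift_commute) simp_all
  have sw: "b \<otimes> f1 u = f2 u \<otimes> b" "b \<otimes> f2 u = f1 u \<otimes> b" for u
    unfolding f1_def f2_def by (rule dihedral_lift_conj; simp add: defs normalize)+
  have f: "(\<lambda>(u, v). f1 u \<otimes> f2 v) \<in> hom (D \<times>\<times> D) G"
    using f1(1) f2(1) fcomm by (intro DirProd_lift_hom) simp_all
  have h: "(\<lambda>e::int. b [^] e) \<in> hom (integer_mod_group 2) G"
    by (rule int_pow_integer_mod_hom) (simp_all add: pow_two)
  have psi: "(\<lambda>(w, e). (\<lambda>(u, v). f1 u \<otimes> f2 v) w \<otimes> b [^] e)
      \<in> hom (semidirect (D \<times>\<times> D) (integer_mod_group 2) (swap_action D)) G"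
  proof (rule semidirect_lift_hom[OF f h])
    fix e :: int and w
    assume e: "e \<in> carrier (integer_mod_group 2)" and "w \<in> carrier (D \<times>\<times> D)"
    then obtain u v where w: "w = (u, v)" "u \<in> carrier D" "v \<in> carrier D" by auto
    show "swap_action D e w \<in> carrier (D \<times>\<times> D)"
      using w by (simp add: swap_action_def swap_by_def)
    have "f1 v \<otimes> f2 u \<otimes> b = b \<otimes> (f1 u \<otimes> f2 v)"
    proof -
      have "b \<otimes> (f1 u \<otimes> f2 v) = f2 u \<otimes> (b \<otimes> f2 v)"
        by (simp add: sw(1) flip: m_assoc)
      then show ?thesis by (simp add: sw(2) fcomm flip: m_assoc)
    qed
    then show "(case swap_action D e w of (u, v) \<Rightarrow> f1 u \<otimes> f2 v) \<otimes> b [^] e =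
        b [^] e \<otimes> (case w of (u, v) \<Rightarrow> f1 u \<otimes> f2 v)"
      using e w by (auto simp: swap_action_def swap_by_def carrier_C2)
  qed
  show ?thesis
    by (rule that[OF psi]) (simp_all add: one f1 f2 defs)
qed

text \<open>
  In the odd case one uses the diagonal reflections instead: \<open>b\<close>, \<open>acbca\<close> are perpendicular to
  \<open>aba\<close>, \<open>cbc\<close>, and both \<open>a\<close> and \<open>c\<close> swap the two directions.
\<close>

lemma odd_lift:
  assumes k: "k > 0" and rel: "odd_relation G k a b c"
  defines "D \<equiv> dihedral_group (2 * (2 * k))"
  defines "\<theta> \<equiv> dihedral_lift D (dihQ (2 * k)) dihP"
  obtains \<psi> where
    "\<psi> \<in> hom (semidirect (D \<times>\<times> D) (integer_mod_group 2 \<times>\<times> integer_mod_group 2) (klein_action D \<theta>)) G"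
    "\<psi> ((\<one>\<^bsub>D\<^esub>, \<one>\<^bsub>D\<^esub>), (1, 0)) = a" "\<psi> ((dihP, \<one>\<^bsub>D\<^esub>), (0, 0)) = b"
    "\<psi> ((\<one>\<^bsub>D\<^esub>, \<one>\<^bsub>D\<^esub>), (0, 1)) = c"
proof -
  interpret D: dihedral "2 * k" using k by unfold_locales simp
  define p1 q1 p2 q2 where "p1 = b" and "q1 = a \<otimes> (c \<otimes> (b \<otimes> (c \<otimes> a)))"
    and "p2 = a \<otimes> (b \<otimes> a)" and "q2 = c \<otimes> (b \<otimes> c)"
  note defs = p1_def q1_def p2_def q2_def
  have cl [simp]: "p1 \<in> carrier G" "q1 \<in> carrier G" "p2 \<in> carrier G" "q2 \<in> carrier G"
    by (simp_all add: defs)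
  have inv12: "p1 \<otimes> p1 = \<one>" "q1 \<otimes> q1 = \<one>" "p2 \<otimes> p2 = \<one>" "q2 \<otimes> q2 = \<one>"
    by (simp_all add: defs normalize)
  have comm: "p1 \<otimes> p2 = p2 \<otimes> p1" "p1 \<otimes> q2 = q2 \<otimes> p1" "q1 \<otimes> p2 = p2 \<otimes> q1" "q1 \<otimes> q2 = q2 \<otimes> q1"
    by (simp_all add: defs normalize)
  have "inv ((a \<otimes> b) [^] (2::nat)) = (a \<otimes> b) [^] (2::nat)"
    "inv ((b \<otimes> c) [^] (2::nat)) = (b \<otimes> c) [^] (2::nat)"
    by (rule inv_involution; simp add: pow_two normalize)+
  \<comment> \<open>Here \<open>(ab)^2\<close> is \<open>p2 p1\<close> and \<open>(bc)^2\<close> is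
    \<open>p1 q2\<close>; the mirror \<open>p1\<close> is perpendicular to \<open>p2\<close> and
    \<open>q2\<close> and cancels again.\<close>
  then have "gcomm G ((a \<otimes> b) [^] (2::nat)) ((b \<otimes> c) [^] (2::nat)) = (p2 \<otimes> q2) [^] (2::nat)"
    by (simp add: gcomm_def pow_two defs normalize)
  then have pq2: "(p2 \<otimes> q2) [^] (2 * k) = \<one>"
    using rel by (simp add: odd_relation_def nat_pow_pow)
  have "p1 \<otimes> q1 = a \<otimes> (p2 \<otimes> q2) \<otimes> inv a" by (simp add: defs normalize)
  then have pq1: "(p1 \<otimes> q1) [^] (2 * k) = \<one>"
    using nat_pow_conj[of a "p2 \<otimes> q2" "2 * k"] pq2 by simp
  define f1 f2 where "f1 = dihedral_lift G p1 q1" and "f2 = dihedral_lift G p2 q2"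
  have f1: "f1 \<in> hom D G" "f1 dihP = p1" "f1 (dihQ (2 * k)) = q1"
    and f2: "f2 \<in> hom D G" "f2 dihP = p2" "f2 (dihQ (2 * k)) = q2"
    unfolding f1_def f2_def D_def
    using dihedral_lift_hom[OF D.r_pos cl(1) inv12(1) cl(2) inv12(2) pq1]
      dihedral_lift_hom[OF D.r_pos cl(3) inv12(3) cl(4) inv12(4) pq2]
      dihedral_lift_P[OF D.r_pos cl(1) inv12(1) cl(2) inv12(2) pq1]
      dihedral_lift_P[OF D.r_pos cl(3) inv12(3) cl(4) inv12(4) pq2]
      dihedral_lift_Q[OF D.r_pos cl(1) inv12(1) cl(2) inv12(2) pq1]
      dihedral_lift_Q[OF D.r_pos cl(3) inv12(3) cl(4) inv12(4) pq2] by simp_all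
  have fcl [simp]: "f1 u \<in> carrier G" "f2 u \<in> carrier G" for u
    by (simp_all add: f1_def f2_def)
  have one: "f1 \<one>\<^bsub>D\<^esub> = \<one>" "f2 \<one>\<^bsub>D\<^esub> = \<one>"
    unfolding D_def using hom_one[OF f1(1)[unfolded D_def] D.is_group is_group]
      hom_one[OF f2(1)[unfolded D_def] D.is_group is_group] by auto
  have fcomm: "f1 u \<otimes> f2 v = f2 v \<otimes> f1 u" for u v
    unfolding f1_def f2_def using comm by (intro dihedral_lift_commute) simp_all
  have th: "f1 (\<theta> u) = dihedral_lift G q1 p1 u" "f2 (\<theta> u) = dihedral_lift G q2 p2 u" for u
    using hom_dihedral_lift[OF D.is_group is_group f1(1)[unfolded D_def] D.Q_closed D.P_closed]
      hom_dihedral_lift[OF D.is_group is_group f2(1)[unfolded D_def] D.Q_closed D.P_closed] f1 f2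
    by (simp_all add: \<theta>_def D_def)
  have thcl: "\<theta> u \<in> carrier D" for u
    unfolding \<theta>_def D_def by (rule D.D.dihedral_lift_closed[OF D.Q_closed D.P_closed])
  have swa: "a \<otimes> f1 u = f2 u \<otimes> a" "a \<otimes> f2 u = f1 u \<otimes> a" for u
    unfolding f1_def f2_def by (rule dihedral_lift_conj; simp add: defs normalize)+
  \<comment> \<open>Unlike \<open>a\<close>, which sends \<open>p1, q1\<close> to
    \<open>p2, q2\<close>, conjugation by \<open>c\<close> sends \<open>p1, q1\<close> to
    \<open>q2, p2\<close>. This crossing is the reason for the twist
    \<open>\<theta>\<close>.\<close>
  have swc: "c \<otimes> f1 u = f2 (\<theta> u) \<otimes> c" "c \<otimes> f2 u = f1 (\<theta> u) \<otimes> c" for u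
    unfolding th unfolding f1_def f2_def by (rule dihedral_lift_conj; simp add: defs normalize)+
  have f: "(\<lambda>(u, v). f1 u \<otimes> f2 v) \<in> hom (D \<times>\<times> D) G"
    using f1(1) f2(1) fcomm by (intro DirProd_lift_hom) simp_all
  have ha: "(\<lambda>e::int. a [^] e) \<in> hom (integer_mod_group 2) G"
    and hc: "(\<lambda>e::int. c [^] e) \<in> hom (integer_mod_group 2) G"
    by (rule int_pow_integer_mod_hom; simp add: pow_two)+
  have h: "(\<lambda>(e::int, e'::int). a [^] e \<otimes> c [^] e') \<in>
      hom (integer_mod_group 2 \<times>\<times> integer_mod_group 2) G"
    by (rule DirProd_lift_hom[OF ha hc]) (auto simp: carrier_C2 braid)
  have psi: "(\<lambda>(w, x). (\<lambda>(u, v). f1 u \<otimes> f2 v) w \<otimes> (\<lambda>(e::int, e'::int). a [^] e \<otimes> c [^] e') x)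
      \<in> hom (semidirect (D \<times>\<times> D) (integer_mod_group 2 \<times>\<times> integer_mod_group 2) (klein_action D \<theta>)) G"
  proof (rule semidirect_lift_hom[OF f h])
    fix x w
    assume "x \<in> carrier (integer_mod_group 2 \<times>\<times> integer_mod_group 2)"
      and "w \<in> carrier (D \<times>\<times> D)"
    then obtain u v e e' where w: "w = (u, v)" "u \<in> carrier D" "v \<in> carrier D"
      and x: "x = (e, e')" "e \<in> {0, 1}" "e' \<in> {0, 1}" by (auto simp: carrier_C2)
    show "klein_action D \<theta> x w \<in> carrier (D \<times>\<times> D)"
      using w x by (auto simp: klein_action_def swap_by_def thcl)
    have A: "f1 v \<otimes> f2 u \<otimes> a = a \<otimes> (f1 u \<otimes> f2 v)" for u v
    proof -
      have "a \<otimes> (f1 u \<otimes> f2 v) = f2 u \<otimes> (a \<otimes> f2 v)"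
        by (simp add: swa(1) flip: m_assoc)
      then show ?thesis by (simp add: swa(2) fcomm flip: m_assoc)
    qed
    have C: "f1 (\<theta> v) \<otimes> f2 (\<theta> u) \<otimes> c = c \<otimes> (f1 u \<otimes> f2 v)" for u v
    proof -
      have "c \<otimes> (f1 u \<otimes> f2 v) = f2 (\<theta> u) \<otimes> (c \<otimes> f2 v)"
        by (simp add: swc(1) flip: m_assoc)
      then show ?thesis by (simp add: swc(2) fcomm flip: m_assoc)
    qed
    have AC: "f1 (\<theta> u) \<otimes> f2 (\<theta> v) \<otimes> (a \<otimes> c) = a \<otimes> c \<otimes> (f1 u \<otimes> f2 v)"
    proof -
      have "f1 (\<theta> u) \<otimes> f2 (\<theta> v) \<otimes> (a \<otimes> c) = (f1 (\<theta> u) \<otimes> f2 (\<theta> v) \<otimes> a) \<otimes> c"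
        by (simp add: m_assoc)
      also have "\<dots> = a \<otimes> (f1 (\<theta> v) \<otimes> f2 (\<theta> u) \<otimes> c)" unfolding A by (simp add: m_assoc)
      finally show ?thesis unfolding C by (simp add: m_assoc)
    qed
    show "(case klein_action D \<theta> x w of (u, v) \<Rightarrow> f1 u \<otimes> f2 v) \<otimes>
          (case x of (e, e') \<Rightarrow> a [^] e \<otimes> c [^] e') =
        (case x of (e, e') \<Rightarrow> a [^] e \<otimes> c [^] e') \<otimes> (case w of (u, v) \<Rightarrow> f1 u \<otimes> f2 v)"
      using x(2,3) w(2,3) A C AC
      by (elim insertE emptyE) (simp_all add: x(1) w(1) klein_action_def swap_by_def)
  qed
  show ?thesis
    by (rule that[OF psi]) (simp_all add: one f1 f2 p1_def)
qed

end

section \<open>The semidirect products as concrete models satisfying the relations\<close>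

locale doubled_dihedral = dihedral +
  fixes K :: "('k, 'e) monoid_scheme" and \<phi> :: "'k \<Rightarrow> (int \<times> int) \<times> (int \<times> int) \<Rightarrow> (int \<times> int) \<times> (int \<times> int)"
  assumes K: "group K" and phi: "\<phi> \<in> hom K (AutoGroup (D \<times>\<times> D))"
begin

abbreviation "Q \<equiv> semidirect (D \<times>\<times> D) K \<phi>"

lemma Q_group: "group Q"
  by (intro semidirect_is_group DirProd_group K phi) simp_all

sublocale K: group K by (rule K)
sublocale Q: group Q by (rule Q_group)

lemma phi_one: "u \<in> carrier D \<Longrightarrow> v \<in> carrier D \<Longrightarrow> \<phi> \<one>\<^bsub>K\<^esub> (u, v) = (u, v)"
  using hom_one[OF phi K group.AutoGroup[OF DirProd_group[OF is_group is_group]]]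
  by (simp add: AutoGroup_def BijGroup_def)

definition inj1 where "inj1 u = ((u, \<one>\<^bsub>D\<^esub>), \<one>\<^bsub>K\<^esub>)"
definition inj2 where "inj2 u = ((\<one>\<^bsub>D\<^esub>, u), \<one>\<^bsub>K\<^esub>)"

lemma inj1_hom: "inj1 \<in> hom D Q" and inj2_hom: "inj2 \<in> hom D Q"
  by (rule homI; simp add: inj1_def inj2_def carrier_semidirect mult_semidirect phi_one)+

text \<open>The preimages of \<open>H\<close> under \<open>inj1\<close> and \<open>inj2\<close> are
  subgroups of \<open>D\<close> containing both standard reflections, hence all of \<open>D\<close>;
  every element of \<open>Q\<close> is a product of one element from each copy and one from
  \<open>K\<close>.\<close>

lemma generate_Q:
  assumes H: "subgroup H Q" and gens: "inj1 dihP \<in> H" "inj1 (dihQ r) \<in> H" "inj2 dihP \<in> H" "inj2 (dihQ r) \<in> H"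
    and K: "\<And>x. x \<in> carrier K \<Longrightarrow> ((\<one>\<^bsub>D\<^esub>, \<one>\<^bsub>D\<^esub>), x) \<in> H"
  shows "H = carrier Q"
proof
  show "H \<subseteq> carrier Q" using subgroup.subset[OF H] .
  have pre: "carrier D \<subseteq> {u \<in> carrier D. h u \<in> H}"
    if h: "h \<in> hom D Q" "h dihP \<in> H" "h (dihQ r) \<in> H" for h
  proof -
    interpret h: group_hom D Q h
      using h(1) Q_group by (simp add: group_hom_def group_hom_axioms_def)
    have "subgroup {u \<in> carrier D. h u \<in> H} D"
    proof (rule D.subgroupI)
      show "{u \<in> carrier D. h u \<in> H} \<noteq> {}" using subgroup.one_closed[OF H] h.hom_one by fastforce
    qed (auto simp: subgroup.m_closed[OF H] subgroup.m_inv_closed[OF H])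
    from subgroup_eq_carrier[OF this] h show ?thesis by simp
  qed
  show "carrier Q \<subseteq> H"
  proof
    fix w assume "w \<in> carrier Q"
    then obtain u v x where w: "w = ((u, v), x)" "u \<in> carrier D" "v \<in> carrier D" "x \<in> carrier K"
      by (auto simp: carrier_semidirect)
    have "inj1 u \<in> H" "inj2 v \<in> H" using pre[OF inj1_hom] pre[OF inj2_hom] gens w by auto
    then have "inj1 u \<otimes>\<^bsub>Q\<^esub> inj2 v \<otimes>\<^bsub>Q\<^esub> ((\<one>\<^bsub>D\<^esub>, \<one>\<^bsub>D\<^esub>), x) \<in> H"
      using K[OF w(4)] by (intro subgroup.m_closed[OF H])
    then show "w \<in> H" using w by (simp add: inj1_def inj2_def mult_semidirect phi_one)
  qed
qed

lemma order_Q: "order Q = (2 * r) * (2 * r) * order K"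
  using order_D by (simp add: order_def carrier_semidirect card_cartesian_product)

text \<open>Shaped to match the last relator, whose commutator evaluates to the square of this
  rotation in both models.\<close>

lemma inj2_PQ_pow:
  assumes "r = 2 * k"
  shows "(inj2 (dihP \<otimes>\<^bsub>D\<^esub> dihQ r) [^]\<^bsub>Q\<^esub> (2::nat)) [^]\<^bsub>Q\<^esub> k = \<one>\<^bsub>Q\<^esub>"
proof -
  interpret group_hom D Q inj2
    using inj2_hom Q_group by (simp add: group_hom_def group_hom_axioms_def)
  have "inj2 ((dihP \<otimes>\<^bsub>D\<^esub> dihQ r) [^]\<^bsub>D\<^esub> r) = \<one>\<^bsub>Q\<^esub>"
    using PQ_pow_eq_one_iff[of r] by simp
  then have "inj2 (dihP \<otimes>\<^bsub>D\<^esub> dihQ r) [^]\<^bsub>Q\<^esub> (2 * k) = \<one>\<^bsub>Q\<^esub>"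
    unfolding assms[symmetric] by (subst hom_nat_pow[symmetric]) simp_all
  then show ?thesis
    by (subst Q.nat_pow_pow) simp_all
qed

end

context dihedral
begin

text \<open>The automorphism exchanging the two standard reflections, which is the twist
  \<open>\<theta>\<close> of \<open>odd_lift\<close>.\<close>

definition flip where "flip = dihedral_lift D (dihQ r) dihP"

lemma flip_hom: "flip \<in> hom D D" and flip_P [simp]: "flip dihP = dihQ r"
  and flip_Q [simp]: "flip (dihQ r) = dihP"
proof -
  have "inv\<^bsub>D\<^esub> (dihP \<otimes>\<^bsub>D\<^esub> dihQ r) = dihQ r \<otimes>\<^bsub>D\<^esub> dihP"
    by (simp add: D.inv_mult_group D.inv_involution)
  then have "(dihQ r \<otimes>\<^bsub>D\<^esub> dihP) [^]\<^bsub>D\<^esub> r = \<one>\<^bsub>D\<^esub>"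
    using D.nat_pow_inv[of "dihP \<otimes>\<^bsub>D\<^esub> dihQ r" r] by (simp add: PQ_pow_eq_one_iff)
  note * = r_pos Q_closed Q_Q P_closed P_P this
  show "flip \<in> hom D D" "flip dihP = dihQ r" "flip (dihQ r) = dihP"
    unfolding flip_def by (rule D.dihedral_lift_hom[OF *] D.dihedral_lift_P[OF *] D.dihedral_lift_Q[OF *])+
qed

lemma flip_flip: "u \<in> carrier D \<Longrightarrow> flip (flip u) = u"
proof -
  assume u: "u \<in> carrier D"
  have "(flip \<circ> flip) u = id u"
    by (rule D.hom_eq_on_generate[of D "flip \<circ> flip" id "{dihP, dihQ r}"])
      (use u hom_compose[OF flip_hom flip_hom] id_hom generate_PQ in auto)
  then show ?thesis by simp
qed

lemma flip_one [simp]: "flip \<one>\<^bsub>D\<^esub> = \<one>\<^bsub>D\<^esub>"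
  using hom_one[OF flip_hom] by simp

lemma even_model:
  defines "Q \<equiv> semidirect (D \<times>\<times> D) (integer_mod_group 2) (swap_action D)"
  defines "a \<equiv> ((dihP, \<one>\<^bsub>D\<^esub>), 0)" and "b \<equiv> ((\<one>\<^bsub>D\<^esub>, \<one>\<^bsub>D\<^esub>), 1)" and "c \<equiv> ((\<one>\<^bsub>D\<^esub>, dihQ r), 0)"
  assumes r: "r = 2 * k"
  shows "group Q" "a \<in> carrier Q" "b \<in> carrier Q" "c \<in> carrier Q" "core_relations Q a b c"
    "even_relation Q k a b c" "generate Q {a, b, c} = carrier Q" "order Q = (2 * r) * (2 * r) * 2"
proof -
  interpret dd: doubled_dihedral r "integer_mod_group 2" "swap_action D"
    by (intro doubled_dihedral.intro dihedral_axioms doubled_dihedral_axioms.intro swap_action_hom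
        is_group group_integer_mod_group)
  show grp: "group Q" unfolding Q_def by (rule dd.Q_group)
  show cl: "a \<in> carrier Q" "b \<in> carrier Q" "c \<in> carrier Q"
    by (simp_all add: Q_def a_def b_def c_def carrier_semidirect carrier_C2)
  note calc = Q_def a_def b_def c_def mult_semidirect swap_action_def swap_by_def one_semidirect
    D.m_assoc
  note pow = group.pow_two[OF grp] group.pow_four[OF grp]
  have mcl: "u \<otimes>\<^bsub>Q\<^esub> v \<in> carrier Q" if "u \<in> carrier Q" "v \<in> carrier Q" for u v
    using that monoid.m_closed[OF group.is_monoid[OF grp]] by blast
  show "core_relations Q a b c"
    unfolding core_relations_def using cl
    by (simp add: pow mcl) (simp add: calc)
  \<comment> \<open>Conjugating by \<open>b\<close> moves \<open>dihP\<close> to the other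
    coordinate, so \<open>a\<close> times \<open>bab\<close> has \<open>dihP\<close> in
    both.\<close>
  have w: "(a \<otimes>\<^bsub>Q\<^esub> b) [^]\<^bsub>Q\<^esub> (2::nat) = ((dihP, dihP), 0)"
    using cl by (simp add: pow mcl) (simp add: calc)
  have invs: "inv\<^bsub>Q\<^esub> ((dihP, dihP), 0) = ((dihP, dihP), 0)" "inv\<^bsub>Q\<^esub> c = c"
    by (rule group.inv_involution[OF grp];
        simp add: calc carrier_semidirect carrier_C2)+
  have "gcomm Q ((a \<otimes>\<^bsub>Q\<^esub> b) [^]\<^bsub>Q\<^esub> (2::nat)) c = dd.inj2 (dihP \<otimes>\<^bsub>D\<^esub> dihQ r) [^]\<^bsub>Q\<^esub> (2::nat)"
    unfolding gcomm_def w invs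
    by (subst pow(1)) (simp_all add: calc dd.inj2_def carrier_semidirect carrier_C2)
  then show "even_relation Q k a b c"
    unfolding even_relation_def using dd.inj2_PQ_pow[OF r, folded Q_def] by simp
  have sub: "subgroup (generate Q {a, b, c}) Q"
    using cl by (intro group.generate_is_subgroup[OF grp]) auto
  have gens: "a \<in> generate Q {a, b, c}" "b \<in> generate Q {a, b, c}" "c \<in> generate Q {a, b, c}"
    by (auto intro: generate.incl)
  note m = subgroup.m_closed[OF sub]
  \<comment> \<open>The same four words as \<open>p1\<close>, \<open>q1\<close>, \<open>p2\<close>,
    \<open>q2\<close> in \<open>even_lift\<close>.\<close>
  have "dd.inj1 dihP = a" "dd.inj1 (dihQ r) = b \<otimes>\<^bsub>Q\<^esub> c \<otimes>\<^bsub>Q\<^esub> b" "dd.inj2 dihP = b \<otimes>\<^bsub>Q\<^esub> a \<otimes>\<^bsub>Q\<^esub> b"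
    "dd.inj2 (dihQ r) = c"
    by (simp_all add: calc dd.inj1_def dd.inj2_def)
  moreover have "((\<one>\<^bsub>D\<^esub>, \<one>\<^bsub>D\<^esub>), e) \<in> generate Q {a, b, c}" if "e \<in> carrier (integer_mod_group 2)" for e
    using that gens(2) subgroup.one_closed[OF sub] by (auto simp: carrier_C2 b_def Q_def one_semidirect)
  ultimately show "generate Q {a, b, c} = carrier Q"
    unfolding Q_def using gens m by (intro dd.generate_Q) (simp_all add: sub flip: Q_def)
  show "order Q = (2 * r) * (2 * r) * 2"
    unfolding Q_def dd.order_Q by (simp add: order_def carrier_C2)
qed

lemma odd_model:
  defines "Q \<equiv> semidirect (D \<times>\<times> D) (integer_mod_group 2 \<times>\<times> integer_mod_group 2) (klein_action D flip)"
  defines "a \<equiv> ((\<one>\<^bsub>D\<^esub>, \<one>\<^bsub>D\<^esub>), (1, 0))" and "b \<equiv> ((dihP, \<one>\<^bsub>D\<^esub>), (0, 0))"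
    and "c \<equiv> ((\<one>\<^bsub>D\<^esub>, \<one>\<^bsub>D\<^esub>), (0, 1))"
  assumes r: "r = 2 * k"
  shows "group Q" "a \<in> carrier Q" "b \<in> carrier Q" "c \<in> carrier Q" "core_relations Q a b c"
    "odd_relation Q k a b c" "generate Q {a, b, c} = carrier Q" "order Q = (2 * r) * (2 * r) * 4"
proof -
  interpret dd: doubled_dihedral r "integer_mod_group 2 \<times>\<times> integer_mod_group 2" "klein_action D flip"
    by (intro doubled_dihedral.intro dihedral_axioms doubled_dihedral_axioms.intro klein_action_hom
        is_group DirProd_group group_integer_mod_group flip_hom flip_flip)
  show grp: "group Q" unfolding Q_def by (rule dd.Q_group)
  show cl: "a \<in> carrier Q" "b \<in> carrier Q" "c \<in> carrier Q"
    by (simp_all add: Q_def a_def b_def c_def carrier_semidirect carrier_C2)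
  note calc = Q_def a_def b_def c_def mult_semidirect klein_action_def swap_by_def one_semidirect
    D.m_assoc
  note pow = group.pow_two[OF grp] group.pow_four[OF grp]
  have mcl: "u \<otimes>\<^bsub>Q\<^esub> v \<in> carrier Q" if "u \<in> carrier Q" "v \<in> carrier Q" for u v
    using that monoid.m_closed[OF group.is_monoid[OF grp]] by blast
  show "core_relations Q a b c"
    unfolding core_relations_def using cl
    by (simp add: pow mcl) (simp add: calc)
  have w: "(a \<otimes>\<^bsub>Q\<^esub> b) [^]\<^bsub>Q\<^esub> (2::nat) = ((dihP, dihP), (0, 0))"
    "(b \<otimes>\<^bsub>Q\<^esub> c) [^]\<^bsub>Q\<^esub> (2::nat) = ((dihP, dihQ r), (0, 0))"
    using cl by (simp_all add: pow mcl) (simp_all add: calc)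
  have invs: "inv\<^bsub>Q\<^esub> ((dihP, dihP), (0, 0)) = ((dihP, dihP), (0, 0))"
    "inv\<^bsub>Q\<^esub> ((dihP, dihQ r), (0, 0)) = ((dihP, dihQ r), (0, 0))"
    by (rule group.inv_involution[OF grp];
        simp add: calc carrier_semidirect carrier_C2)+
  have "gcomm Q ((a \<otimes>\<^bsub>Q\<^esub> b) [^]\<^bsub>Q\<^esub> (2::nat)) ((b \<otimes>\<^bsub>Q\<^esub> c) [^]\<^bsub>Q\<^esub> (2::nat)) =
      dd.inj2 (dihP \<otimes>\<^bsub>D\<^esub> dihQ r) [^]\<^bsub>Q\<^esub> (2::nat)"
    unfolding gcomm_def w invs
    by (subst pow(1)) (simp_all add: calc dd.inj2_def carrier_semidirect carrier_C2)
  then show "odd_relation Q k a b c"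
    unfolding odd_relation_def using dd.inj2_PQ_pow[OF r, folded Q_def] by simp
  have sub: "subgroup (generate Q {a, b, c}) Q"
    using cl by (intro group.generate_is_subgroup[OF grp]) auto
  have gens: "a \<in> generate Q {a, b, c}" "b \<in> generate Q {a, b, c}" "c \<in> generate Q {a, b, c}"
    by (auto intro: generate.incl)
  note m = subgroup.m_closed[OF sub]
  \<comment> \<open>The same four words as in \<open>odd_lift\<close>; \<open>c\<close> turns
    \<open>dihP\<close> in the first coordinate into \<open>dihQ r\<close> in the second because of
    \<open>flip\<close>.\<close>
  have "dd.inj1 dihP = b" "dd.inj1 (dihQ r) = a \<otimes>\<^bsub>Q\<^esub> c \<otimes>\<^bsub>Q\<^esub> b \<otimes>\<^bsub>Q\<^esub> c \<otimes>\<^bsub>Q\<^esub> a"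
    "dd.inj2 dihP = a \<otimes>\<^bsub>Q\<^esub> b \<otimes>\<^bsub>Q\<^esub> a" "dd.inj2 (dihQ r) = c \<otimes>\<^bsub>Q\<^esub> b \<otimes>\<^bsub>Q\<^esub> c"
    by (simp_all add: calc dd.inj1_def dd.inj2_def)
  moreover have "((\<one>\<^bsub>D\<^esub>, \<one>\<^bsub>D\<^esub>), e) \<in> generate Q {a, b, c}"
    if "e \<in> carrier (integer_mod_group 2 \<times>\<times> integer_mod_group 2)" for e
  proof -
    have "a \<otimes>\<^bsub>Q\<^esub> c = ((\<one>\<^bsub>D\<^esub>, \<one>\<^bsub>D\<^esub>), (1, 1))" by (simp add: calc)
    then show ?thesis
      using that gens(1,3) m[OF gens(1,3)] subgroup.one_closed[OF sub]
      by (auto simp: carrier_C2 a_def c_def Q_def one_semidirect)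
  qed
  ultimately show "generate Q {a, b, c} = carrier Q"
    unfolding Q_def using gens m by (intro dd.generate_Q) (simp_all add: sub flip: Q_def)
  show "order Q = (2 * r) * (2 * r) * 4"
    unfolding Q_def dd.order_Q by (simp add: order_def carrier_C2)
qed

end

section \<open>The group as an extension\<close>

lemma (in group_hom) gcomm_hom:
  "u \<in> carrier G \<Longrightarrow> v \<in> carrier G \<Longrightarrow> h (gcomm G u v) = gcomm H (h u) (h v)"
  by (simp add: gcomm_def)

lemma (in group_hom) relation_hom:
  assumes "a \<in> carrier G" "b \<in> carrier G" "c \<in> carrier G"
  shows "even_relation G k a b c \<Longrightarrow> even_relation H k (h a) (h b) (h c)"
    and "odd_relation G k a b c \<Longrightarrow> odd_relation H k (h a) (h b) (h c)"
proof -
  have cl: "gcomm G u v \<in> carrier G" if "u \<in> carrier G" "v \<in> carrier G" for u v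
    using that by (simp add: gcomm_def)
  show "even_relation G k a b c \<Longrightarrow> even_relation H k (h a) (h b) (h c)"
    using assms hom_nat_pow[OF cl, of "(a \<otimes> b) [^] (2::nat)" c k]
    by (simp add: even_relation_def gcomm_hom hom_nat_pow)
  show "odd_relation G k a b c \<Longrightarrow> odd_relation H k (h a) (h b) (h c)"
    using assms hom_nat_pow[OF cl, of "(a \<otimes> b) [^] (2::nat)" "(b \<otimes> c) [^] (2::nat)" k]
    by (simp add: odd_relation_def gcomm_hom hom_nat_pow)
qed

lemma (in group) gcomm_one:
  "u \<in> carrier G \<Longrightarrow> gcomm G u \<one> = \<one>" "u \<in> carrier G \<Longrightarrow> gcomm G \<one> u = \<one>"
  by (simp_all add: gcomm_def)

text \<open>With one generator trivial, every commutator relator has a trivial argument, and the two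
  rotations involving that generator become involutions, whose \<open>2^k\<close>-th powers vanish
  for \<open>k\<close> at least 1. So only one power relation survives, whatever \<open>n\<close>
  is.\<close>

lemma (in group) degenerate_relations:
  assumes p: "p \<in> carrier G" "p \<otimes> p = \<one>" and q: "q \<in> carrier G" "q \<otimes> q = \<one>"
    and "s \<ge> 1" "t \<ge> 1" "l \<ge> 1"
  shows "(p \<otimes> q) [^] ((2::nat) ^ s) = \<one> \<Longrightarrow> hyp_relations G n s t l p q \<one>"
    and "(p \<otimes> q) [^] ((2::nat) ^ t) = \<one> \<Longrightarrow> hyp_relations G n s t l \<one> p q"
    and "(p \<otimes> q) [^] ((2::nat) ^ l) = \<one> \<Longrightarrow> hyp_relations G n s t l p \<one> q"
proof -
  have "p [^] ((2::nat) ^ k) = \<one>" "q [^] ((2::nat) ^ k) = \<one>" if "k \<ge> 1" for k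
    using pow_dvd_eq_one[OF p(1), of 2 "2 ^ k"] pow_dvd_eq_one[OF q(1), of 2 "2 ^ k"] that p q
    by (simp_all add: pow_two)
  moreover have "p [^] (4::nat) = \<one>" "q [^] (4::nat) = \<one>" "p [^] (2::nat) = \<one>" "q [^] (2::nat) = \<one>"
    using p q by (simp_all add: pow_four pow_two)
  ultimately show "(p \<otimes> q) [^] ((2::nat) ^ s) = \<one> \<Longrightarrow> hyp_relations G n s t l p q \<one>"
    and "(p \<otimes> q) [^] ((2::nat) ^ t) = \<one> \<Longrightarrow> hyp_relations G n s t l \<one> p q"
    and "(p \<otimes> q) [^] ((2::nat) ^ l) = \<one> \<Longrightarrow> hyp_relations G n s t l p \<one> q"
    using assms
    by (simp_all add: hyp_relations_def base_relations_def even_relation_def odd_relation_def gcomm_one)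
qed

text \<open>The lift of the dihedral group back into \<open>G\<close> is a left inverse of
  \<open>h\<close> on the subgroup generated by \<open>a\<close> and \<open>b\<close>, as one sees
  on these two generators.\<close>

lemma (in dihedral) retract_inj:
  assumes "group G" "a \<in> carrier G" "b \<in> carrier G" "a \<otimes>\<^bsub>G\<^esub> a = \<one>\<^bsub>G\<^esub>" "b \<otimes>\<^bsub>G\<^esub> b = \<one>\<^bsub>G\<^esub>"
    and ab: "(a \<otimes>\<^bsub>G\<^esub> b) [^]\<^bsub>G\<^esub> r = \<one>\<^bsub>G\<^esub>"
    and h: "h \<in> hom G D" "h a = dihP" "h b = dihQ r"
  shows "inj_on h (generate G {a, b})" "group.ord G (a \<otimes>\<^bsub>G\<^esub> b) = r"
proof -
  interpret G: group G by fact
  interpret h: group_hom G D h using h by (simp add: group_hom_def group_hom_axioms_def)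
  note * = r_pos assms(2,4,3,5) ab
  have "(dihedral_lift G a b \<circ> h) u = id u" if "u \<in> generate G {a, b}" for u
    by (rule G.hom_eq_on_generate[OF \<open>group G\<close> hom_compose[OF h(1) G.dihedral_lift_hom[OF *]] id_hom _ _ that])
      (use assms in \<open>auto simp: h G.dihedral_lift_P[OF *] G.dihedral_lift_Q[OF *]\<close>)
  then show "inj_on h (generate G {a, b})"
    by (metis comp_apply id_apply inj_onI)
  have "G.ord (a \<otimes>\<^bsub>G\<^esub> b) dvd r" using ab assms by (simp add: G.pow_eq_id)
  moreover have "(dihP \<otimes>\<^bsub>D\<^esub> dihQ r) [^]\<^bsub>D\<^esub> G.ord (a \<otimes>\<^bsub>G\<^esub> b) = \<one>\<^bsub>D\<^esub>"
    using h.hom_nat_pow[of "a \<otimes>\<^bsub>G\<^esub> b" "G.ord (a \<otimes>\<^bsub>G\<^esub> b)"] assms by simp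
  then have "r dvd G.ord (a \<otimes>\<^bsub>G\<^esub> b)" by (simp only: PQ_pow_eq_one_iff)
  ultimately show "G.ord (a \<otimes>\<^bsub>G\<^esub> b) = r" by (rule dvd_antisym)
qed

context hyp_relators_group
begin

text \<open>Each dihedral quotient isolates one exponent: killing \<open>c\<close> turns
  \<open>y\<close> into \<open>b^4\<close> and \<open>z\<close> into \<open>a^2\<close>, both
  trivial, and leaves only the power of \<open>x\<close>; the other two maps do the same for
  \<open>y\<close> and \<open>z\<close>.\<close>

lemma eta_inj:
  assumes h2: "h2 \<in> hom G (dihedral_group (2 * 2 ^ s))" "h2 a = dihP" "h2 b = dihQ (2 ^ s)"
      "h2 c = \<one>\<^bsub>dihedral_group (2 * 2 ^ s)\<^esub>"
    and h0: "h0 \<in> hom G (dihedral_group (2 * 2 ^ t))" "h0 b = dihP" "h0 c = dihQ (2 ^ t)"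
      "h0 a = \<one>\<^bsub>dihedral_group (2 * 2 ^ t)\<^esub>"
    and h1: "h1 \<in> hom G (dihedral_group (2 * 2 ^ l))" "h1 a = dihP" "h1 c = dihQ (2 ^ l)"
      "h1 b = \<one>\<^bsub>dihedral_group (2 * 2 ^ l)\<^esub>"
  shows "inj_on eta (carrier C_N)"
proof -
  interpret D2: dihedral "2 ^ s" by unfold_locales simp
  interpret D0: dihedral "2 ^ t" by unfold_locales simp
  interpret D1: dihedral "2 ^ l" by unfold_locales simp
  interpret h2: group_hom G D2.D h2 using h2 by (simp add: group_hom_def group_hom_axioms_def)
  interpret h0: group_hom G D0.D h0 using h0 by (simp add: group_hom_def group_hom_axioms_def)
  interpret h1: group_hom G D1.D h1 using h1 by (simp add: group_hom_def group_hom_axioms_def)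
  interpret eta: group_hom C_N G eta
    using eta_hom group_C_N by (simp add: group_hom_def group_hom_axioms_def)
  have im2: "h2 x = (dihP \<otimes>\<^bsub>D2.D\<^esub> dihQ (2 ^ s)) [^]\<^bsub>D2.D\<^esub> (4::nat)" "h2 y = \<one>\<^bsub>D2.D\<^esub>" "h2 z = \<one>\<^bsub>D2.D\<^esub>"
    by (simp_all add: x_def y_def z_def h2.hom_nat_pow h2 D2.D.pow_four D2.D.pow_two)
  have im0: "h0 y = (dihP \<otimes>\<^bsub>D0.D\<^esub> dihQ (2 ^ t)) [^]\<^bsub>D0.D\<^esub> (4::nat)" "h0 x = \<one>\<^bsub>D0.D\<^esub>" "h0 z = \<one>\<^bsub>D0.D\<^esub>"
    by (simp_all add: x_def y_def z_def h0.hom_nat_pow h0 D0.D.pow_four D0.D.pow_two)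
  have im1: "h1 z = (dihP \<otimes>\<^bsub>D1.D\<^esub> dihQ (2 ^ l)) [^]\<^bsub>D1.D\<^esub> (2::nat)" "h1 x = \<one>\<^bsub>D1.D\<^esub>" "h1 y = \<one>\<^bsub>D1.D\<^esub>"
    by (simp_all add: x_def y_def z_def h1.hom_nat_pow h1 D1.D.pow_four D1.D.pow_two)
  \<comment> \<open>Used with \<open>v\<close> equal to 2 for the fourth powers \<open>x\<close>,
    \<open>y\<close> and 1 for the square \<open>z\<close>; \<open>u - v\<close> is then the
    exponent of the corresponding factor of \<open>C_N\<close>.\<close>
  have small: "i = 0" if "2 ^ u dvd 2 ^ v * i" "i < 2 ^ (u - v)" "v \<le> u" for u v i :: nat
  proof -
    have "(2::nat) ^ u = 2 ^ v * 2 ^ (u - v)" using that(3) by (simp flip: power_add)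
    then have "2 ^ (u - v) dvd i" using that(1) by simp
    then show ?thesis using that(2) by (auto dest: dvd_imp_le)
  qed
  have "w = \<one>\<^bsub>C_N\<^esub>" if w: "w \<in> carrier C_N" "eta w = \<one>" for w
  proof -
    obtain i j k where ijk: "w = (int i, int j, int k)" "i < 2 ^ (s - 2)" "j < 2 ^ (t - 2)" "k < 2 ^ (l - 1)"
    proof -
      obtain i j k where "w = (i, j, k)" "0 \<le> i" "i < 2 ^ (s - 2)" "0 \<le> j" "j < 2 ^ (t - 2)"
        "0 \<le> k" "k < 2 ^ (l - 1)"
        using w(1) by (auto simp: carrier_integer_mod_group)
      then show ?thesis using that[of "nat i" "nat j" "nat k"] by (simp add: nat_less_iff)
    qed
    have e: "x [^] i \<otimes> (y [^] j \<otimes> z [^] k) = \<one>" using w(2) by (simp add: eta_def ijk(1) int_pow_int)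
    have "h2 (x [^] i \<otimes> (y [^] j \<otimes> z [^] k)) = (dihP \<otimes>\<^bsub>D2.D\<^esub> dihQ (2 ^ s)) [^]\<^bsub>D2.D\<^esub> (4 * i)"
      by (simp add: h2.hom_nat_pow im2 D2.D.nat_pow_pow)
    then have "2 ^ s dvd 4 * i" by (simp add: e D2.PQ_pow_eq_one_iff[symmetric])
    then have "i = 0" using small[of s 2 i] ijk st by simp
    moreover have "h0 (x [^] i \<otimes> (y [^] j \<otimes> z [^] k)) = (dihP \<otimes>\<^bsub>D0.D\<^esub> dihQ (2 ^ t)) [^]\<^bsub>D0.D\<^esub> (4 * j)"
      by (simp add: h0.hom_nat_pow im0 D0.D.nat_pow_pow)
    then have "2 ^ t dvd 4 * j" by (simp add: e D0.PQ_pow_eq_one_iff[symmetric])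
    then have "j = 0" using small[of t 2 j] ijk st by simp
    moreover have "h1 (x [^] i \<otimes> (y [^] j \<otimes> z [^] k)) = (dihP \<otimes>\<^bsub>D1.D\<^esub> dihQ (2 ^ l)) [^]\<^bsub>D1.D\<^esub> (2 * k)"
      by (simp add: h1.hom_nat_pow im1 D1.D.nat_pow_pow)
    then have "2 ^ l dvd 2 * k" by (simp add: e D1.PQ_pow_eq_one_iff[symmetric])
    then have "k = 0" using small[of l 1 k] ijk st by simp
    ultimately show ?thesis by (simp add: ijk(1))
  qed
  then show ?thesis unfolding eta.inj_on_one_iff by blast
qed

lemma quotient_core: "toroidal (G Mod N) (N #> a) (N #> b) (N #> c)"
proof -
  interpret N: normal N G by (rule N_normal)
  have grp: "group (G Mod N)" by (rule N.factorgroup_is_group)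
  interpret q: group_hom G "G Mod N" "\<lambda>g. N #> g"
    using N.r_coset_hom_Mod grp by (simp add: group_hom_def group_hom_axioms_def)
  have kill: "N #> n = \<one>\<^bsub>G Mod N\<^esub>" if "n \<in> N" for n
    using that N.rcos_const[OF is_group] by simp
  have "core_relations (G Mod N) (N #> a) (N #> b) (N #> c)"
    unfolding core_relations_def
    using kill[OF xyz_in_N(1)] kill[OF xyz_in_N(2)] kill[OF xyz_in_N(3)] q.hom_one invol
    unfolding x_def y_def z_def
    by (simp only: q.hom_mult[symmetric] q.hom_nat_pow[symmetric] closed m_closed simp_thms)
  then show ?thesis
    using grp q.hom_closed by (simp add: toroidal_def toroidal_axioms_def)
qed

text \<open>Common to both parities: \<open>\<psi>\<close> forces the kernel of \<open>\<pi>\<close>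
  to be \<open>N\<close>, \<open>eta\<close> identifies \<open>N\<close> with \<open>C_N\<close>,
  and the order follows from the theorem of Lagrange.\<close>

lemma extension_of_quotient:
  assumes eta: "inj_on eta (carrier C_N)"
    and Q: "group Q" and pi: "\<pi> \<in> hom G Q" and surj: "generate Q {\<pi> a, \<pi> b, \<pi> c} = carrier Q"
    and core: "core_relations Q (\<pi> a) (\<pi> b) (\<pi> c)"
    and psi: "\<psi> \<in> hom Q (G Mod N)" "\<psi> (\<pi> a) = N #> a" "\<psi> (\<pi> b) = N #> b" "\<psi> (\<pi> c) = N #> c"
  shows "is_extension G C_N Q" "order G = 2 ^ (s - 2) * (2 ^ (t - 2) * 2 ^ (l - 1)) * order Q"
proof -
  interpret pi: group_hom G Q \<pi> using pi Q by (simp add: group_hom_def group_hom_axioms_def)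
  interpret N: normal N G by (rule N_normal)
  have xyz: "\<pi> x = \<one>\<^bsub>Q\<^esub>" "\<pi> y = \<one>\<^bsub>Q\<^esub>" "\<pi> z = \<one>\<^bsub>Q\<^esub>"
    using core by (simp_all add: core_relations_def x_def y_def z_def pi.hom_nat_pow)
  have "eta w \<in> kernel G Q \<pi>" for w
    by (cases w) (simp add: eta_def kernel_def pi.hom_int_pow xyz)
  then have "N \<subseteq> kernel G Q \<pi>" by (auto simp: N_def)
  then have ker: "kernel G Q \<pi> = N"
    using psi gen by (intro kernel_eq_normal[OF is_group Q pi N_normal _ psi(1), of "{a, b, c}"]) auto
  have "\<pi> ` carrier G = generate Q (\<pi> ` {a, b, c})"
    using pi.generate_img[of "{a, b, c}"] gen by simp
  then have iso: "G Mod N \<cong> Q"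
    using pi.FactGroup_iso_set surj ker by (auto simp: is_iso_def)
  have "eta \<in> iso C_N (G\<lparr>carrier := N\<rparr>)"
    using eta eta_hom by (auto simp: iso_def hom_def bij_betw_def N_def)
  then have eta_iso: "C_N \<cong> G\<lparr>carrier := N\<rparr>" by (auto simp: is_iso_def)
  then show "is_extension G C_N Q"
    unfolding is_extension_def
    using N_normal iso group.iso_sym[OF group_C_N eta_iso] by blast
  have "card (rcosets N) = order Q"
    using iso_same_card[OF iso] by (simp add: FactGroup_def order_def)
  moreover have "card (carrier (integer_mod_group k)) = k" if "k > 0" for k
    using that by (simp add: carrier_integer_mod_group)
  then have "card N = 2 ^ (s - 2) * (2 ^ (t - 2) * 2 ^ (l - 1))"
    using eta by (simp add: N_def card_image card_cartesian_product)
  ultimately show "order G = 2 ^ (s - 2) * (2 ^ (t - 2) * 2 ^ (l - 1)) * order Q"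
    using lagrange[OF N_subgroup] by (simp add: mult.commute)
qed

end

theorem theorem3p2:
  fixes n s t l :: nat
  assumes "n \<ge> 10" and "s \<ge> 2" and "t \<ge> 2" and "l \<ge> 1" and "n \<ge> s + t + l"
  shows "let G = hyp_group n s t l;
             \<rho> = hyp_gen n s t l;
             N = integer_mod_group (2 ^ (s - 2)) \<times>\<times> integer_mod_group (2 ^ (t - 2))
                   \<times>\<times> integer_mod_group (2 ^ (l - 1));
             D = dihedral_group (2 ^ ((n - s - t - l + 4) div 2));
             D' = dihedral_group (2 ^ ((n - s - t - l + 3) div 2));
             C2 = integer_mod_group 2
         in order G = 2 ^ n \<and>
            aut_group_of_regular_hypertope G {0, 1, 2} \<rho> \<and>
            geom_rank (gens_geometry G {0, 1, 2} \<rho>) = 3 \<and>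
            group.ord G (\<rho> 0 \<otimes>\<^bsub>G\<^esub> \<rho> 1) = 2 ^ s \<and>
            group.ord G (\<rho> 1 \<otimes>\<^bsub>G\<^esub> \<rho> 2) = 2 ^ t \<and>
            group.ord G (\<rho> 0 \<otimes>\<^bsub>G\<^esub> \<rho> 2) = 2 ^ l \<and>
            (even (n - s - t - l) \<longrightarrow>
              (\<exists>\<phi> \<in> hom C2 (AutoGroup (D \<times>\<times> D)).
                 is_extension G N (semidirect (D \<times>\<times> D) C2 \<phi>))) \<and>
            (odd (n - s - t - l) \<longrightarrow>
              (\<exists>\<phi> \<in> hom (C2 \<times>\<times> C2) (AutoGroup (D' \<times>\<times> D')).
                 is_extension G N (semidirect (D' \<times>\<times> D') (C2 \<times>\<times> C2) \<phi>)))"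
proof -
  define G where "G = hyp_group n s t l"
  define \<rho> where "\<rho> = hyp_gen n s t l"
  define m where "m = n - s - t - l"
  have n: "n = s + t + l + m" using assms by (simp add: m_def)
  interpret G: group G unfolding G_def by (rule hyp_group_is_group)
  have cl [simp]: "\<rho> 0 \<in> carrier G" "\<rho> 1 \<in> carrier G" "\<rho> 2 \<in> carrier G"
    using hyp_gen_closed by (simp_all add: G_def \<rho>_def)
  have gen: "generate G {\<rho> 0, \<rho> 1, \<rho> 2} = carrier G"
    using generate_hyp_gen[of n s t l] by (simp add: G_def \<rho>_def)
  have relG: "hyp_relations G n s t l (\<rho> 0) (\<rho> 1) (\<rho> 2)"
    unfolding G_def \<rho>_def by (rule hyp_gen_relations)
  interpret hyp_relators_group G "\<rho> 0" "\<rho> 1" "\<rho> 2" s t l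
    using cl gen relG assms by unfold_locales (simp_all add: hyp_relations_def)
  interpret Ds: dihedral "2 ^ s" by unfold_locales simp
  interpret Dt: dihedral "2 ^ t" by unfold_locales simp
  interpret Dl: dihedral "2 ^ l" by unfold_locales simp
  have one_le: "s \<ge> 1" "t \<ge> 1" "l \<ge> 1" using assms by auto
  note universal = hyp_group_universal[of _ _ _ _ n s t l, folded G_def \<rho>_def]
  obtain h2 where h2: "h2 \<in> hom G Ds.D" "h2 (\<rho> 0) = dihP" "h2 (\<rho> 1) = dihQ (2 ^ s)"
      "h2 (\<rho> 2) = \<one>\<^bsub>Ds.D\<^esub>"
    by (rule universal[OF Ds.is_group Ds.P_closed Ds.Q_closed Ds.D.one_closed Ds.D.degenerate_relations(1)[OF
        Ds.P_closed Ds.P_P Ds.Q_closed Ds.Q_Q one_le]]) (simp_all add: Ds.PQ_pow_eq_one_iff)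
  obtain h0 where h0: "h0 \<in> hom G Dt.D" "h0 (\<rho> 1) = dihP" "h0 (\<rho> 2) = dihQ (2 ^ t)"
      "h0 (\<rho> 0) = \<one>\<^bsub>Dt.D\<^esub>"
    by (rule universal[OF Dt.is_group Dt.D.one_closed Dt.P_closed Dt.Q_closed Dt.D.degenerate_relations(2)[OF
        Dt.P_closed Dt.P_P Dt.Q_closed Dt.Q_Q one_le]]) (simp_all add: Dt.PQ_pow_eq_one_iff)
  obtain h1 where h1: "h1 \<in> hom G Dl.D" "h1 (\<rho> 0) = dihP" "h1 (\<rho> 2) = dihQ (2 ^ l)"
      "h1 (\<rho> 1) = \<one>\<^bsub>Dl.D\<^esub>"
    by (rule universal[OF Dl.is_group Dl.P_closed Dl.D.one_closed Dl.Q_closed Dl.D.degenerate_relations(3)[OF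
        Dl.P_closed Dl.P_P Dl.Q_closed Dl.Q_Q one_le]]) (simp_all add: Dl.PQ_pow_eq_one_iff)
  have pows: "(\<rho> 0 \<otimes>\<^bsub>G\<^esub> \<rho> 1) [^]\<^bsub>G\<^esub> ((2::nat) ^ s) = \<one>\<^bsub>G\<^esub>"
    "(\<rho> 1 \<otimes>\<^bsub>G\<^esub> \<rho> 2) [^]\<^bsub>G\<^esub> ((2::nat) ^ t) = \<one>\<^bsub>G\<^esub>"
    "(\<rho> 0 \<otimes>\<^bsub>G\<^esub> \<rho> 2) [^]\<^bsub>G\<^esub> ((2::nat) ^ l) = \<one>\<^bsub>G\<^esub>"
    using rel by (simp_all add: base_relations_def)
  note r2 = Ds.retract_inj[OF G.is_group cl(1,2) invol(1,2) pows(1) h2(1-3)]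
  note r0 = Dt.retract_inj[OF G.is_group cl(2,3) invol(2,3) pows(2) h0(1-3)]
  note r1 = Dl.retract_inj[OF G.is_group cl(1,3) invol(1,3) pows(3) h1(1-3)]

  have hypertope: "coset_hypertope G {0, 1, 2} \<rho>"
  proof -
    define H where "H i = (if i = 0 then Dt.D else if i = 1 then Dl.D else Ds.D)" for i :: nat
    define f where "f i = (if i = 0 then h0 else if i = 1 then h1 else h2)" for i :: nat
    have sets: "\<rho> ` ({0, 1, 2} - {0}) = {\<rho> 1, \<rho> 2}" "\<rho> ` ({0, 1, 2} - {1}) = {\<rho> 0, \<rho> 2}"
      "\<rho> ` ({0, 1, 2} - {2}) = {\<rho> 0, \<rho> 1}" by auto
    have retract: "retract_group G {0, 1, 2} \<rho> H f"
    proof (intro retract_group.intro retract_group_axioms.intro G.is_group)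
      have "inj_on (f 0) (generate G (\<rho> ` ({0, 1, 2} - {0})))"
        "inj_on (f 1) (generate G (\<rho> ` ({0, 1, 2} - {1})))"
        "inj_on (f 2) (generate G (\<rho> ` ({0, 1, 2} - {2})))"
        unfolding sets using r0(1) r1(1) r2(1) by (simp_all add: f_def)
      then show "inj_on (f i) (generate G (\<rho> ` ({0, 1, 2} - {i})))" if "i \<in> {0, 1, 2}" for i
        using that by (elim insertE emptyE) (simp_all only:)
    qed (use cl h0 h1 h2 in \<open>auto simp: H_def f_def\<close>)
    have invols: "\<rho> i \<otimes>\<^bsub>G\<^esub> \<rho> i = \<one>\<^bsub>G\<^esub>" if "i \<in> {0, 1, 2}" for i
      using that invol by auto
    have "\<rho> 0 \<noteq> \<one>\<^bsub>G\<^esub>" "\<rho> 2 \<noteq> \<one>\<^bsub>G\<^esub>"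
      using h1(2,3) hom_one[OF h1(1) G.is_group Dl.is_group]
      by (auto simp: one_dihedral dihP_def dihQ_def)
    moreover have "\<rho> 1 \<noteq> \<one>\<^bsub>G\<^esub>"
      using h0(2) hom_one[OF h0(1) G.is_group Dt.is_group]
      by (auto simp: one_dihedral dihP_def)
    ultimately have "\<rho> i \<noteq> \<one>\<^bsub>G\<^esub>" if "i \<in> {0, 1, 2}" for i
      using that by auto
    then show ?thesis
      using coset_hypertope_of_retracts[OF HOL.refl retract invols] gen by simp
  qed
  interpret hyp: coset_hypertope G "{0, 1, 2}" \<rho> by (rule hypertope)
  note aut = hyp.aut_group
  have rank: "geom_rank (gens_geometry G {0, 1, 2} \<rho>) = 3"
    by (simp add: geom_rank_def gens_geometry_def coset_geometry_def)

  interpret tor: toroidal "G Mod N" "N #>\<^bsub>G\<^esub> \<rho> 0" "N #>\<^bsub>G\<^esub> \<rho> 1" "N #>\<^bsub>G\<^esub> \<rho> 2"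
    by (rule quotient_core)
  interpret q: group_hom G "G Mod N" "\<lambda>g. N #>\<^bsub>G\<^esub> g"
    using normal.r_coset_hom_Mod[OF N_normal] tor.is_group
    by (simp add: group_hom_def group_hom_axioms_def)
  note inj = eta_inj[OF h2 h0 h1]

  have even: "order G = 2 ^ n \<and> (\<exists>\<phi> \<in> hom (integer_mod_group 2) (AutoGroup (D \<times>\<times> D)).
      is_extension G C_N (semidirect (D \<times>\<times> D) (integer_mod_group 2) \<phi>))"
    if m_even: "even m" and D: "D = dihedral_group (2 ^ ((m + 4) div 2))" for D
  proof -
    define k where "k = (2::nat) ^ (m div 2)"
    have m2: "m = 2 * (m div 2)" using m_even by simp
    have "(m + 4) div 2 = Suc (Suc (m div 2))" by simp
    \<comment> \<open>\<open>dihedral_group\<close> is indexed by its order; the exponent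
      \<open>m div 2 + 2\<close> makes this \<open>4 * k\<close>, so the rotations have order
      \<open>2 * k\<close>.\<close>
    then have Dk: "D = dihedral_group (2 * (2 * k))" by (simp add: D k_def)
    interpret Dk: dihedral "2 * k" by unfold_locales (simp add: k_def)
    note model = Dk.even_model[OF HOL.refl, folded Dk]
    have relQ: "hyp_relations (semidirect (D \<times>\<times> D) (integer_mod_group 2) (swap_action D)) n s t l
        ((dihP, \<one>\<^bsub>D\<^esub>), 0) ((\<one>\<^bsub>D\<^esub>, \<one>\<^bsub>D\<^esub>), 1) ((\<one>\<^bsub>D\<^esub>, dihQ (2 * k)), 0)"
      unfolding hyp_relations_def m_def[symmetric] k_def[symmetric]
      using group.core_imp_base_relations[OF model(1-5) st] model(6) m_even by simp
    obtain \<pi> where pi: "\<pi> \<in> hom G (semidirect (D \<times>\<times> D) (integer_mod_group 2) (swap_action D))"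
      "\<pi> (\<rho> 0) = ((dihP, \<one>\<^bsub>D\<^esub>), 0)" "\<pi> (\<rho> 1) = ((\<one>\<^bsub>D\<^esub>, \<one>\<^bsub>D\<^esub>), 1)"
      "\<pi> (\<rho> 2) = ((\<one>\<^bsub>D\<^esub>, dihQ (2 * k)), 0)"
      by (rule universal[OF model(1-4) relQ])
    have "even_relation G k (\<rho> 0) (\<rho> 1) (\<rho> 2)"
      using relG m_even unfolding hyp_relations_def m_def[symmetric] k_def[symmetric] by simp
    then have "even_relation (G Mod N) k (N #>\<^bsub>G\<^esub> \<rho> 0) (N #>\<^bsub>G\<^esub> \<rho> 1) (N #>\<^bsub>G\<^esub> \<rho> 2)"
      by (rule q.relation_hom(1)[OF cl])
    then obtain \<psi> where psi:
      "\<psi> \<in> hom (semidirect (D \<times>\<times> D) (integer_mod_group 2) (swap_action D)) (G Mod N)"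
      "\<psi> ((dihP, \<one>\<^bsub>D\<^esub>), 0) = N #>\<^bsub>G\<^esub> \<rho> 0" "\<psi> ((\<one>\<^bsub>D\<^esub>, \<one>\<^bsub>D\<^esub>), 1) = N #>\<^bsub>G\<^esub> \<rho> 1"
      "\<psi> ((\<one>\<^bsub>D\<^esub>, dihQ (2 * k)), 0) = N #>\<^bsub>G\<^esub> \<rho> 2"
      using tor.even_lift[of k, folded Dk] by (auto simp: k_def)
    have ext: "is_extension G C_N (semidirect (D \<times>\<times> D) (integer_mod_group 2) (swap_action D))"
        "order G = 2 ^ (s - 2) * (2 ^ (t - 2) * 2 ^ (l - 1)) *
          order (semidirect (D \<times>\<times> D) (integer_mod_group 2) (swap_action D))"
      by (rule extension_of_quotient[OF inj model(1) pi(1), unfolded pi(2-), OF model(7,5) psi])+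
    obtain s' t' l' m' where "s = 2 + s'" "t = 2 + t'" "l = 1 + l'" "m = 2 * m'"
      using assms m2 le_Suc_ex by metis
    \<comment> \<open>The model contributes \<open>(4k)^2 * 2 = 2^(m+5)\<close> and \<open>N\<close>
      contributes \<open>2^(s+t+l-5)\<close>.\<close>
    then have "order G = 2 ^ n"
      unfolding ext(2) model(8) by (simp add: k_def n power_add power_even_eq power2_eq_square)
    then show ?thesis
      using ext(1) swap_action_hom[OF Dk.is_group, folded Dk] by blast
  qed

  have odd: "order G = 2 ^ n \<and>
      (\<exists>\<phi> \<in> hom (integer_mod_group 2 \<times>\<times> integer_mod_group 2) (AutoGroup (D \<times>\<times> D)).
        is_extension G C_N (semidirect (D \<times>\<times> D) (integer_mod_group 2 \<times>\<times> integer_mod_group 2) \<phi>))"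
    if m_odd: "odd m" and D: "D = dihedral_group (2 ^ ((m + 3) div 2))" for D
  proof -
    define k where "k = (2::nat) ^ ((m - 1) div 2)"
    obtain m' where m': "m = 2 * m' + 1" using m_odd by (auto elim: oddE)
    then have km: "k = 2 ^ m'" by (simp add: k_def)
    have "(m + 3) div 2 = Suc (Suc m')" by (simp add: m')
    then have Dk: "D = dihedral_group (2 * (2 * k))" by (simp add: D km)
    interpret Dk: dihedral "2 * k" by unfold_locales (simp add: k_def)
    define \<phi> where "\<phi> = klein_action D Dk.flip"
    note model = Dk.odd_model[OF HOL.refl, folded Dk, folded \<phi>_def]
    have relQ: "hyp_relations (semidirect (D \<times>\<times> D) (integer_mod_group 2 \<times>\<times> integer_mod_group 2) \<phi>) n s t l
        ((\<one>\<^bsub>D\<^esub>, \<one>\<^bsub>D\<^esub>), (1, 0)) ((dihP, \<one>\<^bsub>D\<^esub>), (0, 0)) ((\<one>\<^bsub>D\<^esub>, \<one>\<^bsub>D\<^esub>), (0, 1))"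
      unfolding hyp_relations_def m_def[symmetric] k_def[symmetric]
      using group.core_imp_base_relations[OF model(1-5) st] model(6) m_odd by simp
    obtain \<pi> where pi: "\<pi> \<in> hom G (semidirect (D \<times>\<times> D) (integer_mod_group 2 \<times>\<times> integer_mod_group 2) \<phi>)"
      "\<pi> (\<rho> 0) = ((\<one>\<^bsub>D\<^esub>, \<one>\<^bsub>D\<^esub>), (1, 0))" "\<pi> (\<rho> 1) = ((dihP, \<one>\<^bsub>D\<^esub>), (0, 0))"
      "\<pi> (\<rho> 2) = ((\<one>\<^bsub>D\<^esub>, \<one>\<^bsub>D\<^esub>), (0, 1))"
      by (rule universal[OF model(1-4) relQ])
    have "odd_relation G k (\<rho> 0) (\<rho> 1) (\<rho> 2)"
      using relG m_odd unfolding hyp_relations_def m_def[symmetric] k_def[symmetric] by simp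
    then have "odd_relation (G Mod N) k (N #>\<^bsub>G\<^esub> \<rho> 0) (N #>\<^bsub>G\<^esub> \<rho> 1) (N #>\<^bsub>G\<^esub> \<rho> 2)"
      by (rule q.relation_hom(2)[OF cl])
    then obtain \<psi> where psi:
      "\<psi> \<in> hom (semidirect (D \<times>\<times> D) (integer_mod_group 2 \<times>\<times> integer_mod_group 2) \<phi>) (G Mod N)"
      "\<psi> ((\<one>\<^bsub>D\<^esub>, \<one>\<^bsub>D\<^esub>), (1, 0)) = N #>\<^bsub>G\<^esub> \<rho> 0" "\<psi> ((dihP, \<one>\<^bsub>D\<^esub>), (0, 0)) = N #>\<^bsub>G\<^esub> \<rho> 1"
      "\<psi> ((\<one>\<^bsub>D\<^esub>, \<one>\<^bsub>D\<^esub>), (0, 1)) = N #>\<^bsub>G\<^esub> \<rho> 2"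
      \<comment> \<open>The twist built inside \<open>odd_lift\<close> is \<open>Dk.flip\<close>, so
        model and lift refer to the same semidirect product.\<close>
      using tor.odd_lift[of k, folded Dk.flip_def Dk, folded \<phi>_def] by (auto simp: k_def)
    have ext: "is_extension G C_N (semidirect (D \<times>\<times> D) (integer_mod_group 2 \<times>\<times> integer_mod_group 2) \<phi>)"
        "order G = 2 ^ (s - 2) * (2 ^ (t - 2) * 2 ^ (l - 1)) *
          order (semidirect (D \<times>\<times> D) (integer_mod_group 2 \<times>\<times> integer_mod_group 2) \<phi>)"
      by (rule extension_of_quotient[OF inj model(1) pi(1), unfolded pi(2-), OF model(7,5) psi])+
    obtain s' t' l' where "s = 2 + s'" "t = 2 + t'" "l = 1 + l'"
      using assms le_Suc_ex by metis
    \<comment> \<open>Now \<open>k^2 = 2^(m-1)\<close>, and the four-group replaces the group of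
      order two: \<open>(4k)^2 * 4\<close> is \<open>2^(m+5)\<close> again.\<close>
    then have "order G = 2 ^ n"
      unfolding ext(2) model(8) by (simp add: km m' n power_add power_even_eq power2_eq_square)
    moreover have "\<phi> \<in> hom (integer_mod_group 2 \<times>\<times> integer_mod_group 2) (AutoGroup (D \<times>\<times> D))"
      unfolding \<phi>_def Dk by (rule klein_action_hom[OF Dk.is_group Dk.flip_hom Dk.flip_flip])
    ultimately show ?thesis using ext(1) by blast
  qed

  show ?thesis
    unfolding Let_def G_def[symmetric] \<rho>_def[symmetric] m_def[symmetric]
    using aut rank r0(2) r1(2) r2(2) even[OF _ HOL.refl] odd[OF _ HOL.refl] by blast
qed

end
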